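(* Let $\Sigma_\circ$ be a totally mutable seed in $\mathcal F$ such that every seed mutation equivalent to $\Sigma_\circ$ is coprime. Then the upper bound $\mathcal U(\Sigma)$ is independent of the choice of a seed $\Sigma\sim\Sigma_\circ$, and it is equal to the upper cluster algebra $\overline{\mathcal A}(\Sigma_\circ)$.
   Context: Let $\mathbb P$ be a torsion-free abelian group, written multiplicatively, $\mathbb{ZP}$ its integer group ring, $n\ge 1$, and $\mathcal F$ a field isomorphic to the field of rational functions in $n$ independent variables over the fraction field of $\mathbb{ZP}$. A seed in $\mathcal F$ is a triple $\Sigma=(\mathbf x,\mathbf p,B)$ where: $\mathbf x=\{x_1,\dots,x_n\}$ (the cluster; its elements are the cluster variables) is a transcendence basis of $\mathcal F$ over the fraction field of $\mathbb{ZP}$ (so that $\mathcal F$ is the field of rational functions in $\mathbf x$); $\mathbf p=(p_1^\pm,\dots,p_n^\pm)$ is a $2n$-tuple of elements of $\mathbb P$; $B=(b_{ij})$ is an $n\times n$ integer matrix (the exchange matrix) which is sign-skew-symmetric, i.e. for all $i,j$ either $b_{ij}=b_{ji}=0$ or $b_{ij}b_{ji}<0$. Seeds differing by a simultaneous relabeling are identified. For $j\in[1,n]=\{1,\dots,n\}$ put $P_j=P_j(\mathbf x)=p_j^+\prod_{b_{ij}>0}x_i^{b_{ij}}+p_j^-\prod_{b_{ij}<0}x_i^{-b_{ij}}$, define $x_j'\in\mathcal F$ by the exchange relation $x_jx_j'=P_j$, and let $\mathbf x_j=(\mathbf x-\{x_j\})\cup\{x_j'\}$. The upper bound is $\mathcal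 U(\Sigma)=\mathbb{ZP}[\mathbf x^{\pm1}]\cap\mathbb{ZP}[\mathbf x_1^{\pm1}]\cap\dots\cap\mathbb{ZP}[\mathbf x_n^{\pm1}]$, where $\mathbb{ZP}[\mathbf x^{\pm1}]$ denotes the ring of Laurent polynomials in the elements of $\mathbf x$. A seed is coprime if $P_1,\dots,P_n$ are pairwise coprime in $\mathbb{ZP}[\mathbf x]=\mathbb{ZP}[x_1,\dots,x_n]$, i.e. for $i\ne j$ any common divisor of $P_i$ and $P_j$ belongs to $\mathbb P$ up to sign. Matrix mutation in direction $k$: $\mu_k(B)=B'=(b'_{ij})$ with $b'_{ij}=-b_{ij}$ if $i=k$ or $j=k$, and $b'_{ij}=b_{ij}+\frac{|b_{ik}|b_{kj}+b_{ik}|b_{kj}|}{2}$ otherwise. A seed $\Sigma'=(\mathbf x',\mathbf p',B')$ is obtained from $\Sigma$ by a seed mutation in direction $k$ if $\mathbf x'=\mathbf x_k$, $B'=\mu_k(B)$, $p_k'^{\pm}=p_k^{\mp}$, and for $i\ne k$: $p_i'^+/p_i'^-=(p_k^+)^{b_{ki}}p_i^+/p_i^-$ if $b_{ki}\ge0$ and $p_i'^+/p_i'^-=(p_k^-)^{b_{ki}}p_i^+/p_i^-$ if $b_{ki}\le 0$ (the tuple $\mathbf p'$ need not be unique). Mutation equivalence $\sim$ of seeds (or matrices) is the equivalence relation generated by mutations. A seed is totally mutable if every matrix mutation equivalent to its exchange matrix is sign-skew-symmetric. For a totally mutable seed $\Sigma_\circ$, the upper cluster algebra $\overline{\mathcal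 A}(\Sigma_\circ)$ is the intersection of the subalgebras $\mathcal U(\Sigma)\subset\mathcal F$ over all seeds $\Sigma\sim\Sigma_\circ$. *)

theory Defs
  imports
    "HOL-Library.Poly_Mapping"
    "HOL-Analysis.Finite_Cartesian_Product"
begin

text \<open>
  Conventions.  The coefficient group is a type \<open>'p\<close> of class \<open>ab_group_add\<close>, and its integer group
  ring is \<open>'p \<Rightarrow>\<^sub>0 int\<close> with the convolution product of \<open>Poly_Mapping\<close>.  The multiplicative notation
  for the group is recovered by writing \<open>p\<close> as the basis element \<open>Poly_Mapping.single p 1\<close>, since
  \<open>single p 1 * single q 1 = single (p + q) 1\<close>.  The index set \<open>{1, ..., n}\<close> is a finite type \<open>'n\<close>.

  The ambient field is a type \<open>'f\<close>, and \<open>\<iota>\<close> denotes the inclusion of the group ring into it.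
\<close>

definition torsion_free :: "'p::ab_group_add itself \<Rightarrow> bool" where
  "torsion_free _ \<longleftrightarrow> (\<forall>(p::'p) m::nat. m > 0 \<and> (\<Sum>i<m. p) = 0 \<longrightarrow> p = 0)"

definition ring_embedding :: "('a::comm_ring_1 \<Rightarrow> 'b::comm_ring_1) \<Rightarrow> bool" where
  "ring_embedding \<iota> \<longleftrightarrow>
     \<iota> 1 = 1 \<and> (\<forall>a b. \<iota> (a + b) = \<iota> a + \<iota> b) \<and> (\<forall>a b. \<iota> (a * b) = \<iota> a * \<iota> b) \<and> inj \<iota>"

definition frac_subfield :: "('a::comm_ring_1 \<Rightarrow> 'f::field) \<Rightarrow> 'f set" where
  "frac_subfield \<iota> = {\<iota> a / \<iota> b | a b. b \<noteq> 0}"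

definition polynomials :: "'f::field set \<Rightarrow> ('n::finite \<Rightarrow> 'f) \<Rightarrow> 'f set" where
  "polynomials A x =
     {\<Sum>e\<in>E. c e * (\<Prod>i\<in>UNIV. x i ^ e i) | (E :: ('n \<Rightarrow> nat) set) c. finite E \<and> c ` E \<subseteq> A}"

definition laurent_polynomials :: "'f::field set \<Rightarrow> ('n::finite \<Rightarrow> 'f) \<Rightarrow> 'f set" where
  "laurent_polynomials A x =
     {\<Sum>e\<in>E. c e * (\<Prod>i\<in>UNIV. x i powi e i) | (E :: ('n \<Rightarrow> int) set) c. finite E \<and> c ` E \<subseteq> A}"

definition rational_functions :: "'f::field set \<Rightarrow> ('n::finite \<Rightarrow> 'f) \<Rightarrow> 'f set" where
  "rational_functions A x =
     {f / g | f g. f \<in> polynomials A x \<and> g \<in> polynomials A x \<and> g \<noteq> 0}"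

definition alg_independent :: "'f::field set \<Rightarrow> ('n::finite \<Rightarrow> 'f) \<Rightarrow> bool" where
  "alg_independent K x \<longleftrightarrow>
     (\<forall>(E :: ('n \<Rightarrow> nat) set) c. finite E \<and> c ` E \<subseteq> K \<and>
        (\<Sum>e\<in>E. c e * (\<Prod>i\<in>UNIV. x i ^ e i)) = 0 \<longrightarrow> (\<forall>e\<in>E. c e = 0))"

text \<open>
  For a subfield \<open>K\<close>, the whole field is the field of rational functions over \<open>K\<close> in the independent
  variables \<open>x i\<close>.
\<close>

definition free_generators :: "'f::field set \<Rightarrow> ('n::finite \<Rightarrow> 'f) \<Rightarrow> bool" where
  "free_generators K x \<longleftrightarrow> alg_independent K x \<and> rational_functions K x = UNIV"

text \<open>
  The ambient field, containing the group ring via \<open>\<iota>\<close>, is isomorphic over the fraction field of the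
  group ring to the field of rational functions in \<open>CARD('n)\<close> independent variables.
\<close>

definition ambient_field ::
  "(('p::ab_group_add \<Rightarrow>\<^sub>0 int) \<Rightarrow> 'f::field) \<Rightarrow> 'n::finite itself \<Rightarrow> bool" where
  "ambient_field \<iota> _ \<longleftrightarrow>
     ring_embedding \<iota> \<and> (\<exists>z :: 'n \<Rightarrow> 'f. free_generators (frac_subfield \<iota>) z)"

definition grp :: "(('p::ab_group_add \<Rightarrow>\<^sub>0 int) \<Rightarrow> 'f::field) \<Rightarrow> 'p \<Rightarrow> 'f" where
  "grp \<iota> p = \<iota> (Poly_Mapping.single p 1)"


definition sign_skew_symmetric :: "int^'n^'n \<Rightarrow> bool" where
  "sign_skew_symmetric B \<longleftrightarrow>
     (\<forall>i j. (B $ i $ j = 0 \<and> B $ j $ i = 0) \<or> B $ i $ j * B $ j $ i < 0)"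

text \<open>The integer division by 2 below is exact.\<close>

definition matrix_mutation :: "'n \<Rightarrow> int^'n^'n \<Rightarrow> int^'n^'n" where
  "matrix_mutation k B = (\<chi> i j.
     if i = k \<or> j = k then - (B $ i $ j)
     else B $ i $ j + (\<bar>B $ i $ k\<bar> * B $ k $ j + B $ i $ k * \<bar>B $ k $ j\<bar>) div 2)"

definition matrix_mutation_equiv :: "int^'n^'n \<Rightarrow> int^'n^'n \<Rightarrow> bool" where
  "matrix_mutation_equiv = equivclp (\<lambda>B B'. \<exists>k. B' = matrix_mutation k B)"


text \<open>
  Seeds are labeled; the identification of seeds differing by a simultaneous relabeling is built into
  the equivalence relation \<open>mutation_equiv\<close> instead.
\<close>

record ('p, 'f, 'n::finite) seed =
  cluster :: "'n \<Rightarrow> 'f"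
  coeff_plus :: "'n \<Rightarrow> 'p"
  coeff_minus :: "'n \<Rightarrow> 'p"
  exchange_matrix :: "int^'n^'n"

definition is_seed ::
  "(('p::ab_group_add \<Rightarrow>\<^sub>0 int) \<Rightarrow> 'f::field) \<Rightarrow> ('p, 'f, 'n::finite) seed \<Rightarrow> bool" where
  "is_seed \<iota> \<Sigma> \<longleftrightarrow>
     free_generators (frac_subfield \<iota>) (cluster \<Sigma>) \<and> sign_skew_symmetric (exchange_matrix \<Sigma>)"

definition exchange_poly ::
  "(('p::ab_group_add \<Rightarrow>\<^sub>0 int) \<Rightarrow> 'f::field) \<Rightarrow> ('p, 'f, 'n::finite) seed \<Rightarrow> 'n \<Rightarrow> 'f" where
  "exchange_poly \<iota> \<Sigma> j =
     (let x = cluster \<Sigma>; B = exchange_matrix \<Sigma> in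
        grp \<iota> (coeff_plus \<Sigma> j) * (\<Prod>i \<in> {i. B $ i $ j > 0}. x i ^ nat (B $ i $ j))
      + grp \<iota> (coeff_minus \<Sigma> j) * (\<Prod>i \<in> {i. B $ i $ j < 0}. x i ^ nat (- (B $ i $ j))))"

definition adjacent_cluster ::
  "(('p::ab_group_add \<Rightarrow>\<^sub>0 int) \<Rightarrow> 'f::field) \<Rightarrow> ('p, 'f, 'n::finite) seed \<Rightarrow> 'n \<Rightarrow> 'n \<Rightarrow> 'f" where
  "adjacent_cluster \<iota> \<Sigma> j = (cluster \<Sigma>)(j := exchange_poly \<iota> \<Sigma> j / cluster \<Sigma> j)"

definition upper_bound ::
  "(('p::ab_group_add \<Rightarrow>\<^sub>0 int) \<Rightarrow> 'f::field) \<Rightarrow> ('p, 'f, 'n::finite) seed \<Rightarrow> 'f set" where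
  "upper_bound \<iota> \<Sigma> =
     laurent_polynomials (range \<iota>) (cluster \<Sigma>)
     \<inter> (\<Inter>j. laurent_polynomials (range \<iota>) (adjacent_cluster \<iota> \<Sigma> j))"

text \<open>Divisibility is taken in the polynomial ring, not in the ambient field (where it is trivial).\<close>

definition coprime_seed ::
  "(('p::ab_group_add \<Rightarrow>\<^sub>0 int) \<Rightarrow> 'f::field) \<Rightarrow> ('p, 'f, 'n::finite) seed \<Rightarrow> bool" where
  "coprime_seed \<iota> \<Sigma> \<longleftrightarrow>
     (let R = polynomials (range \<iota>) (cluster \<Sigma>) in
      \<forall>i j. i \<noteq> j \<longrightarrow>
        (\<forall>d\<in>R. (\<exists>q\<in>R. exchange_poly \<iota> \<Sigma> i = d * q) \<and> (\<exists>q\<in>R. exchange_poly \<iota> \<Sigma> j = d * q)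
           \<longrightarrow> (\<exists>p. d = grp \<iota> p \<or> d = - grp \<iota> p)))"

text \<open>
  The relations between the coefficients are equations in the coefficient group; they are stated
  through its image in the ambient field, where it is written multiplicatively.
\<close>

definition seed_mutation ::
  "(('p::ab_group_add \<Rightarrow>\<^sub>0 int) \<Rightarrow> 'f::field) \<Rightarrow> 'n \<Rightarrow>
   ('p, 'f, 'n::finite) seed \<Rightarrow> ('p, 'f, 'n) seed \<Rightarrow> bool" where
  "seed_mutation \<iota> k \<Sigma> \<Sigma>' \<longleftrightarrow>
     is_seed \<iota> \<Sigma> \<and> is_seed \<iota> \<Sigma>' \<and>
     cluster \<Sigma>' = adjacent_cluster \<iota> \<Sigma> k \<and>
     exchange_matrix \<Sigma>' = matrix_mutation k (exchange_matrix \<Sigma>) \<and>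
     coeff_plus \<Sigma>' k = coeff_minus \<Sigma> k \<and>
     coeff_minus \<Sigma>' k = coeff_plus \<Sigma> k \<and>
     (\<forall>i. i \<noteq> k \<longrightarrow>
        (let b = exchange_matrix \<Sigma> $ k $ i;
             ratio = grp \<iota> (coeff_plus \<Sigma> i) / grp \<iota> (coeff_minus \<Sigma> i);
             ratio' = grp \<iota> (coeff_plus \<Sigma>' i) / grp \<iota> (coeff_minus \<Sigma>' i)
         in (b \<ge> 0 \<longrightarrow> ratio' = grp \<iota> (coeff_plus \<Sigma> k) powi b * ratio) \<and>
            (b \<le> 0 \<longrightarrow> ratio' = grp \<iota> (coeff_minus \<Sigma> k) powi b * ratio)))"

definition relabel :: "('n \<Rightarrow> 'n) \<Rightarrow> ('p, 'f, 'n::finite) seed \<Rightarrow> ('p, 'f, 'n) seed" where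
  "relabel \<pi> \<Sigma> =
     \<lparr>cluster = cluster \<Sigma> \<circ> \<pi>,
      coeff_plus = coeff_plus \<Sigma> \<circ> \<pi>,
      coeff_minus = coeff_minus \<Sigma> \<circ> \<pi>,
      exchange_matrix = (\<chi> i j. exchange_matrix \<Sigma> $ \<pi> i $ \<pi> j)\<rparr>"

definition mutation_equiv ::
  "(('p::ab_group_add \<Rightarrow>\<^sub>0 int) \<Rightarrow> 'f::field) \<Rightarrow>
   ('p, 'f, 'n::finite) seed \<Rightarrow> ('p, 'f, 'n) seed \<Rightarrow> bool" where
  "mutation_equiv \<iota> = equivclp (\<lambda>\<Sigma> \<Sigma>'.
     (\<exists>k. seed_mutation \<iota> k \<Sigma> \<Sigma>') \<or> (\<exists>\<pi>. bij \<pi> \<and> \<Sigma>' = relabel \<pi> \<Sigma>))"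

definition totally_mutable :: "('p, 'f, 'n::finite) seed \<Rightarrow> bool" where
  "totally_mutable \<Sigma> \<longleftrightarrow>
     (\<forall>B. matrix_mutation_equiv (exchange_matrix \<Sigma>) B \<longrightarrow> sign_skew_symmetric B)"

definition upper_cluster_algebra ::
  "(('p::ab_group_add \<Rightarrow>\<^sub>0 int) \<Rightarrow> 'f::field) \<Rightarrow> ('p, 'f, 'n::finite) seed \<Rightarrow> 'f set" where
  "upper_cluster_algebra \<iota> \<Sigma>\<^sub>0 = (\<Inter>\<Sigma> \<in> {\<Sigma>. mutation_equiv \<iota> \<Sigma> \<Sigma>\<^sub>0}. upper_bound \<iota> \<Sigma>)"

end

theory Submission
  imports Defs "HOL-Library.Function_Algebras" "HOL-Library.Product_Plus"
begin

text \<open>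
  The point is that a single mutation \<open>\<Sigma> \<rightarrow> \<Sigma>'\<close> in direction \<open>k\<close> preserves the upper bound; as relabeling
  does so too, the theorem follows by induction along a chain of mutations. Mutation is symmetric, so the
  inclusion \<open>U(\<Sigma>) \<subseteq> U(\<Sigma>')\<close> suffices. Of the Laurent rings whose intersection is \<open>U(\<Sigma>')\<close>, those of the
  cluster of \<open>\<Sigma>'\<close> and of its neighbour in direction \<open>k\<close> already occur in \<open>U(\<Sigma>)\<close>. In the neighbour in a
  direction \<open>j \<noteq> k\<close> only \<open>x\<^sub>k\<close> and \<open>x\<^sub>j\<close> have been replaced, so all other variables can be put into a
  coefficient ring \<open>R\<close>, and the problem has two variables. It is governed by one observation
  (\<open>coeff_divisible\<close>): for \<open>t\<close> transcendental over \<open>S\<close>, a Laurent polynomial in \<open>t\<close> over \<open>S\<close>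
  is one in \<open>P / t\<close> exactly when the coefficient of \<open>t ^ (- m)\<close> is divisible by \<open>P ^ m\<close>.

  If \<open>b\<^sub>k\<^sub>j \<noteq> 0\<close>, one may assume \<open>b\<^sub>k\<^sub>j < 0\<close> by the symmetry between \<open>p\<^sup>+\<close> and \<open>p\<^sup>-\<close>. Then every element of \<open>U(\<Sigma>)\<close> is a polynomial over \<open>R\<close> in \<open>x\<^sub>k\<close>,
  \<open>x\<^sub>j\<close>, \<open>x\<^sub>k'\<close>, \<open>x\<^sub>j'\<close> (\<open>generated_by_four\<close>), and these four elements are Laurent polynomials in the new pair
  of variables (\<open>upper_bound_connected\<close>), because modulo \<open>x\<^sub>j\<close> the old and the new \<open>P\<^sub>j\<close> agree up to a unit.

  If \<open>b\<^sub>k\<^sub>j = 0\<close>, then \<open>P\<^sub>k\<close> and \<open>P\<^sub>j\<close> lie in \<open>R\<close>, and \<open>P\<^sub>j\<close> changes only by a coefficient. Coefficients divisible by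
  powers of \<open>P\<^sub>k\<close> and of \<open>P\<^sub>j\<close> have to be divisible by their product (\<open>upper_bound_disconnected\<close>). The group ring of a
  torsion-free group need not be factorial, so this is not a matter of unique factorization. However,
  the exchange polynomials are binomials: up to monomials they are \<open>1 + u\<close> and \<open>1 + v\<close> in the group ring of
  the group of Laurent monomials. Divisibility by \<open>1 + u\<close> is detected by alternating sums along the cosets of
  the cyclic group generated by \<open>u\<close>. These show that the factor \<open>1 + v\<close> can be cancelled in a divisibility by
  \<open>1 + u\<close> (\<open>binomial_euclid\<close>), unless \<open>u\<close> and \<open>v\<close> are odd powers of one monomial \<open>w = Y / X\<close>. In that exceptional
  case \<open>X + Y\<close> divides both exchange polynomials, contrary to coprimality (\<open>coprime_no_common_odd_root\<close>).
\<close>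

section \<open>Subrings of a field and Laurent expansions\<close>

definition is_subring :: "'f::comm_ring_1 set \<Rightarrow> bool" where
  "is_subring S \<longleftrightarrow> 1 \<in> S \<and> (\<forall>a\<in>S. \<forall>b\<in>S. a - b \<in> S \<and> a * b \<in> S)"

lemma is_subringI:
  assumes "1 \<in> S" "\<And>a b. a \<in> S \<Longrightarrow> b \<in> S \<Longrightarrow> a - b \<in> S" "\<And>a b. a \<in> S \<Longrightarrow> b \<in> S \<Longrightarrow> a * b \<in> S"
  shows "is_subring S"
  using assms by (auto simp: is_subring_def)

context
  fixes S :: "'f::comm_ring_1 set"
  assumes S: "is_subring S"
begin

lemma subring_one: "1 \<in> S"
  and subring_diff: "a \<in> S \<Longrightarrow> b \<in> S \<Longrightarrow> a - b \<in> S"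
  and subring_mult: "a \<in> S \<Longrightarrow> b \<in> S \<Longrightarrow> a * b \<in> S"
  using S by (auto simp: is_subring_def)

lemma subring_zero: "0 \<in> S"
  using subring_diff[OF subring_one subring_one] by simp

lemma subring_minus: "a \<in> S \<Longrightarrow> - a \<in> S"
  using subring_diff[OF subring_zero, of a] by simp

lemma subring_add: "a \<in> S \<Longrightarrow> b \<in> S \<Longrightarrow> a + b \<in> S"
  using subring_diff[of a "- b"] subring_minus by simp

lemma subring_power: "a \<in> S \<Longrightarrow> a ^ n \<in> S"
  by (induction n) (auto intro: subring_one subring_mult)

lemma subring_sum: "(\<And>i. i \<in> I \<Longrightarrow> f i \<in> S) \<Longrightarrow> sum f I \<in> S"
  by (induction I rule: infinite_finite_induct) (auto intro: subring_zero subring_add)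

lemma subring_prod: "(\<And>i. i \<in> I \<Longrightarrow> f i \<in> S) \<Longrightarrow> prod f I \<in> S"
  by (induction I rule: infinite_finite_induct) (auto intro: subring_one subring_mult)

lemma subring_of_nat: "of_nat n \<in> S"
  by (induction n) (auto intro: subring_zero subring_one subring_add)

lemma subring_of_int: "of_int n \<in> S"
  by (cases n) (auto simp del: of_nat_Suc intro: subring_of_nat subring_minus)

lemmas subring_intros = subring_one subring_zero subring_diff subring_mult subring_minus
  subring_add subring_power

end

lemma subring_powi:
  fixes t :: "'f::field"
  assumes "is_subring S" "t \<in> S" "inverse t \<in> S"
  shows "t powi j \<in> S"
  using assms by (auto simp: power_int_def intro: subring_power)

inductive_set ring_hull :: "'f::comm_ring_1 set \<Rightarrow> 'f set" for X where
  base: "a \<in> X \<Longrightarrow> a \<in> ring_hull X"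
| one: "1 \<in> ring_hull X"
| diff: "a \<in> ring_hull X \<Longrightarrow> b \<in> ring_hull X \<Longrightarrow> a - b \<in> ring_hull X"
| mult: "a \<in> ring_hull X \<Longrightarrow> b \<in> ring_hull X \<Longrightarrow> a * b \<in> ring_hull X"

lemma subring_ring_hull: "is_subring (ring_hull X)"
  by (rule is_subringI) (auto intro: ring_hull.intros)

lemma ring_hull_least:
  assumes "is_subring S" "X \<subseteq> S"
  shows "ring_hull X \<subseteq> S"
proof
  fix a assume "a \<in> ring_hull X"
  then show "a \<in> S"
    by induction (use assms in \<open>auto intro: subring_intros\<close>)
qed

lemma ring_hull_mono: "X \<subseteq> ring_hull Y \<Longrightarrow> ring_hull X \<subseteq> ring_hull Y"
  by (rule ring_hull_least[OF subring_ring_hull])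

lemma ring_hull_absorb: "ring_hull (ring_hull X \<union> Y) = ring_hull (X \<union> Y)"
proof (rule antisym; rule ring_hull_mono)
  have "ring_hull X \<subseteq> ring_hull (X \<union> Y)"
    by (rule ring_hull_mono) (auto intro: ring_hull.base)
  then show "ring_hull X \<union> Y \<subseteq> ring_hull (X \<union> Y)"
    by (auto intro: ring_hull.base)
qed (auto intro: ring_hull.base)

text \<open>
  The subgroup of a ring generated by \<open>X\<close>. Laurent rings are generated, as groups, by the terms
  \<open>coefficient * monomial\<close>, and an induction over this subgroup produces expansions into finite sums.
\<close>

inductive_set add_span :: "'f::comm_ring_1 set \<Rightarrow> 'f set" for X where
  base: "a \<in> X \<Longrightarrow> a \<in> add_span X"
| zero: "0 \<in> add_span X"
| diff: "a \<in> add_span X \<Longrightarrow> b \<in> add_span X \<Longrightarrow> a - b \<in> add_span X"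

lemma ring_hull_subset_add_span:
  assumes one: "1 \<in> X" and mult: "\<And>a b. a \<in> X \<Longrightarrow> b \<in> X \<Longrightarrow> a * b \<in> X" and "Y \<subseteq> X"
  shows "ring_hull Y \<subseteq> add_span X"
proof (rule ring_hull_least[OF is_subringI])
  fix a b assume "a \<in> add_span X" "b \<in> add_span X"
  then show "a * b \<in> add_span X"
  proof (induction a)
    case (base a)
    from base(2) show ?case
      by induction (use base mult in \<open>auto intro: add_span.intros simp: right_diff_distrib\<close>)
  qed (auto intro: add_span.intros simp: left_diff_distrib)
qed (use assms in \<open>auto intro: add_span.intros\<close>)

definition laurent_ext :: "'f::field set \<Rightarrow> 'f \<Rightarrow> 'f set" where
  "laurent_ext S t = ring_hull (S \<union> {t, inverse t})"

lemma subring_laurent_ext: "is_subring (laurent_ext S t)"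
  by (simp add: laurent_ext_def subring_ring_hull)

text \<open>
  The bound \<open>M\<close> of the expansion may be enlarged at will, so that several expansions can be written over
  one common range of exponents.
\<close>

lemma laurent_expansion:
  fixes t :: "'f::field"
  assumes S: "is_subring S" and t: "t \<noteq> 0" and y: "y \<in> laurent_ext S t"
  obtains c N where "\<And>j. c j \<in> S" and "\<And>M. N \<le> M \<Longrightarrow> y = (\<Sum>j=-int M..int M. c j * t powi j)"
proof -
  define X where "X = {s * t powi j | s j. s \<in> S}"
  have XI: "s * t powi j \<in> X" if "s \<in> S" for s j
    using that by (auto simp: X_def)
  have "ring_hull (S \<union> {t, inverse t}) \<subseteq> add_span X"
  proof (rule ring_hull_subset_add_span)
    show "1 \<in> X" using XI[OF subring_one[OF S], of 0] by simp
    fix a b assume "a \<in> X" "b \<in> X"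
    then obtain s i s' j where s: "s \<in> S" "s' \<in> S" "a = s * t powi i" "b = s' * t powi j"
      by (auto simp: X_def)
    then have "a * b = (s * s') * t powi (i + j)"
      using t by (simp add: power_int_add)
    then show "a * b \<in> X"
      using XI subring_mult[OF S s(1,2)] by metis
  next
    show "S \<union> {t, inverse t} \<subseteq> X"
    proof -
      have "S \<subseteq> X" using XI[where j=0] by auto
      moreover have "t \<in> X" using XI[OF subring_one[OF S], of 1] by simp
      moreover have "inverse t \<in> X" using XI[OF subring_one[OF S], of "-1"] by (simp add: power_int_minus)
      ultimately show ?thesis by auto
    qed
  qed
  then have "y \<in> add_span X" using y by (auto simp: laurent_ext_def)
  then have "\<exists>c N. (\<forall>j. c j \<in> S) \<and> (\<forall>M\<ge>N. y = (\<Sum>j=-int M..int M. c j * t powi j))"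
  proof induction
    case (base a)
    then obtain s i where s: "s \<in> S" "a = s * t powi i" by (auto simp: X_def)
    have "a = (\<Sum>j=-int M..int M. (if j = i then s else 0) * t powi j)" if "M \<ge> nat \<bar>i\<bar>" for M
    proof -
      have "i \<in> {-int M..int M}" using that by auto
      then have "(\<Sum>j=-int M..int M. (if j = i then s else 0) * t powi j)
          = (\<Sum>j\<in>{i}. (if j = i then s else 0) * t powi j)"
        by (intro sum.mono_neutral_right) auto
      then show ?thesis using s by simp
    qed
    then show ?case
      using s subring_zero[OF S] by (intro exI[of _ "\<lambda>j. if j = i then s else 0"] exI[of _ "nat \<bar>i\<bar>"]) auto
  next
    case zero
    show ?case by (rule exI[of _ "\<lambda>_. 0"]) (simp add: subring_zero[OF S])
  next
    case (diff a b)
    then obtain c N d N' where c: "\<forall>j. c j \<in> S" "\<forall>M\<ge>N. a = (\<Sum>j=-int M..int M. c j * t powi j)"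
      and d: "\<forall>j. d j \<in> S" "\<forall>M\<ge>N'. b = (\<Sum>j=-int M..int M. d j * t powi j)" by blast
    have "a - b = (\<Sum>j=-int M..int M. (c j - d j) * t powi j)" if "M \<ge> max N N'" for M
      using c(2)[rule_format, of M] d(2)[rule_format, of M] that
      by (simp add: sum_subtractf left_diff_distrib)
    then show ?case
      using c(1) d(1) subring_diff[OF S]
      by (intro exI[of _ "\<lambda>j. c j - d j"] exI[of _ "max N N'"]) auto
  qed
  then show ?thesis using that by blast
qed

text \<open>
  This is transcendence of \<open>t\<close> over the fraction field of \<open>S\<close>, phrased through Laurent polynomials in
  order to compare the coefficients of two Laurent expansions directly.
\<close>

definition laurent_free :: "'f::field set \<Rightarrow> 'f \<Rightarrow> bool" where
  "laurent_free S t \<longleftrightarrow> (\<forall>(J::int set) c. finite J \<and> c ` J \<subseteq> S \<and> (\<Sum>j\<in>J. c j * t powi j) = 0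
     \<longrightarrow> (\<forall>j\<in>J. c j = 0))"

lemma laurent_free_subset: "laurent_free S t \<Longrightarrow> S' \<subseteq> S \<Longrightarrow> laurent_free S' t"
  unfolding laurent_free_def by (meson subset_trans)

text \<open>
  Write \<open>t' = P / t\<close>. A negative power of \<open>t\<close> is a positive power of \<open>t'\<close> divided by a power of \<open>P\<close>,
  so a Laurent polynomial in \<open>t\<close> is one in \<open>t'\<close> only if these denominators cancel. The proof expands \<open>y\<close>
  in \<open>t'\<close>, clears the denominators by a power of \<open>P\<close> and compares coefficients.
\<close>

lemma coeff_divisible:
  fixes t P :: "'f::field"
  assumes S: "is_subring S" and t: "t \<noteq> 0" and free: "laurent_free S t"
    and P: "P \<in> S" "P \<noteq> 0"
    and c: "\<And>j. c j \<in> S" "\<And>M. N \<le> M \<Longrightarrow> y = (\<Sum>j=-int M..int M. c j * t powi j)"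
    and y: "y \<in> laurent_ext S (P / t)"
  shows "\<exists>q\<in>S. c (- int m) = P ^ m * q"
proof -
  have "P / t \<noteq> 0" using t P by simp
  from laurent_expansion[OF S this y] obtain g N' where
    g: "\<And>j. g j \<in> S" "\<And>M. N' \<le> M \<Longrightarrow> y = (\<Sum>j=-int M..int M. g j * (P / t) powi j)" by metis
  define M where "M = max m (max N N')"
  have M: "m \<le> M" "N \<le> M" "N' \<le> M" by (auto simp: M_def)
  have "P ^ M * y = (\<Sum>j=-int M..int M. P ^ M * g j * (P / t) powi j)"
    using g(2)[OF M(3)] by (simp add: sum_distrib_left mult.assoc)
  also have "\<dots> = (\<Sum>j=-int M..int M. P ^ M * g (- j) * (P / t) powi (- j))"
    by (rule sum.reindex_bij_witness[of _ uminus uminus]) auto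
  also have "\<dots> = (\<Sum>j=-int M..int M. (P ^ nat (int M - j) * g (- j)) * t powi j)"
  proof (rule sum.cong[OF refl])
    fix j assume j: "j \<in> {- int M..int M}"
    have "P ^ nat (int M - j) = P powi (int M - j)"
      using j by (simp add: power_int_def)
    also have "\<dots> = P ^ M * P powi (- j)"
      using P power_int_add[of P "int M" "- j"] by simp
    finally show "P ^ M * g (- j) * (P / t) powi (- j) = (P ^ nat (int M - j) * g (- j)) * t powi j"
      using t by (simp add: power_int_divide_distrib power_int_minus field_simps)
  qed
  finally have "(\<Sum>j=-int M..int M. (P ^ M * c j - P ^ nat (int M - j) * g (- j)) * t powi j) = 0"
    using c(2)[OF M(2)] by (simp add: sum_subtractf left_diff_distrib sum_distrib_left mult.assoc)
  moreover have "(\<lambda>j. P ^ M * c j - P ^ nat (int M - j) * g (- j)) ` {-int M..int M} \<subseteq> S"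
    using c g P by (auto intro!: subring_intros[OF S])
  ultimately have "\<forall>j\<in>{-int M..int M}. P ^ M * c j - P ^ nat (int M - j) * g (- j) = 0"
    using free finite_atLeastAtMost_int unfolding laurent_free_def by blast
  then have "P ^ M * c (- int m) - P ^ nat (int M - - int m) * g (- (- int m)) = 0"
    by (rule bspec) (use M(1) in simp)
  moreover have "nat (int M - - int m) = M + m" by simp
  ultimately have "P ^ M * c (- int m) = P ^ M * (P ^ m * g (int m))"
    by (simp add: power_add mult.assoc)
  then have "c (- int m) = P ^ m * g (int m)" using P by simp
  then show ?thesis using g by auto
qed

lemma laurent_ext_base: "S \<subseteq> laurent_ext S t" "t \<in> laurent_ext S t" "inverse t \<in> laurent_ext S t"
  by (auto simp: laurent_ext_def intro: ring_hull.base)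

lemma laurent_ext_least:
  assumes "is_subring T" "S \<subseteq> T" "t \<in> T" "inverse t \<in> T"
  shows "laurent_ext S t \<subseteq> T"
  unfolding laurent_ext_def using assms by (intro ring_hull_least) auto

lemma laurent_ext_mono: "S \<subseteq> T \<Longrightarrow> laurent_ext S t \<subseteq> laurent_ext T t"
  using laurent_ext_base[where S=T] by (intro laurent_ext_least subring_laurent_ext) auto

lemma laurent_ext_commute: "laurent_ext (laurent_ext S s) t = laurent_ext (laurent_ext S t) s"
  unfolding laurent_ext_def ring_hull_absorb by (simp only: Un_ac)

text \<open>
  Converse of \<open>coeff_divisible\<close>: when \<open>c (- m) = P ^ m * q\<close>, the term \<open>c (- m) / t ^ m\<close> is
  \<open>q * (P / t) ^ m\<close>, so the expansion becomes a polynomial in \<open>t\<close> and \<open>P / t\<close>.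
\<close>

lemma laurent_expansion_in:
  fixes t P :: "'f::field"
  assumes T: "is_subring T" and t: "t \<in> T"
    and c: "\<And>j. c j \<in> T" and q: "\<And>m. q m \<in> T" "\<And>m. c (- int m) = P ^ m * q m"
    and P: "P / t \<in> T"
  shows "(\<Sum>j=-int M..int M. c j * t powi j) \<in> T"
proof (rule subring_sum[OF T])
  fix j
  show "c j * t powi j \<in> T"
  proof (cases "j \<ge> 0")
    case True
    then show ?thesis using c t by (auto simp: power_int_def intro!: subring_intros[OF T])
  next
    case False
    define m where "m = nat (- j)"
    have j: "j = - int m" using False by (simp add: m_def)
    have "c j * t powi j = q m * (P / t) ^ m"
      using q(2)[of m] by (simp add: j power_int_minus power_divide field_simps)
    then show ?thesis using q P by (auto intro!: subring_intros[OF T])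
  qed
qed

section \<open>The problem in two variables\<close>

text \<open>
  All cluster variables but two are inverted and collected in the coefficient ring \<open>R\<close>; the remaining
  two are \<open>x1\<close> and \<open>x2\<close>, with exchange polynomials \<open>P1\<close> (free of \<open>x1\<close>) and \<open>P2\<close> (free of \<open>x2\<close>).
\<close>

locale rank_two =
  fixes R :: "'f::field set" and x1 x2 P1 P2 :: 'f
  assumes R: "is_subring R"
    and nonzero: "x1 \<noteq> 0" "x2 \<noteq> 0" "P1 \<noteq> 0" "P2 \<noteq> 0"
    and free1: "laurent_free (laurent_ext R x2) x1"
    and free2: "laurent_free (laurent_ext R x1) x2"
    and P1: "P1 \<in> laurent_ext R x2" and P2: "P2 \<in> laurent_ext R x1"
begin

abbreviation "R1 \<equiv> laurent_ext R x1"
abbreviation "R2 \<equiv> laurent_ext R x2"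

lemma free2_R: "laurent_free R x2"
  using free2 laurent_ext_base(1) by (rule laurent_free_subset)

text \<open>
  When \<open>P1\<close> and \<open>P2\<close> involve neither variable, the hypothesis on \<open>y\<close> says that the coefficient of
  \<open>x1 ^ (- m) * x2 ^ (- n)\<close> is divisible by \<open>P1 ^ m\<close> and by \<open>P2 ^ n\<close>, while the conclusion asks for
  divisibility by the product. This is what \<open>euclid\<close> provides. The proof treats the variables one after
  the other: \<open>T = R[x2, x2']\<close> consists of the elements common to \<open>R[x2\<^sup>\<plusminus>]\<close> and \<open>R[x2'\<^sup>\<plusminus>]\<close>, the
  expansion of \<open>y\<close> in \<open>x1\<close> has coefficients in \<open>T\<close>, and dividing these by powers of \<open>P1\<close> stays in \<open>T\<close>.
\<close>

lemma upper_bound_disconnected: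
  assumes P: "P1 \<in> R" "P2 \<in> R"
    and euclid: "\<And>z q m j. z \<in> R \<Longrightarrow> q \<in> R \<Longrightarrow> P1 ^ m * z = P2 ^ j * q \<Longrightarrow> \<exists>q'\<in>R. z = P2 ^ j * q'"
    and y: "y \<in> laurent_ext R1 x2" "y \<in> laurent_ext R2 (P1 / x1)" "y \<in> laurent_ext R1 (P2 / x2)"
  shows "y \<in> laurent_ext (laurent_ext R (P1 / x1)) (P2 / x2)"
proof -
  note hull = subring_ring_hull
  define x2' where "x2' = P2 / x2"
  define T where "T = ring_hull (R \<union> {x2, x2'})"
  have sT: "is_subring T" by (simp add: T_def hull)
  have T: "R \<subseteq> T" "x2 \<in> T" "P2 / x2 \<in> T" by (auto simp: T_def x2'_def intro: ring_hull.base)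
  have T_R2: "T \<subseteq> R2"
    unfolding T_def x2'_def
  proof (rule ring_hull_least[OF subring_laurent_ext])
    have "P2 * inverse x2 \<in> R2"
      using P laurent_ext_base by (intro subring_mult[OF subring_laurent_ext]) auto
    then show "R \<union> {x2, P2 / x2} \<subseteq> R2"
      using laurent_ext_base by (auto simp: divide_inverse)
  qed
  have T_R2': "T \<subseteq> laurent_ext R x2'"
    unfolding T_def
  proof (rule ring_hull_least[OF subring_laurent_ext])
    have "P2 * inverse x2' \<in> laurent_ext R x2'"
      using P laurent_ext_base by (intro subring_mult[OF subring_laurent_ext]) auto
    moreover have "P2 * inverse x2' = x2" using nonzero by (simp add: x2'_def)
    ultimately show "R \<union> {x2, x2'} \<subseteq> laurent_ext R x2'"
      using laurent_ext_base by auto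
  qed
  have y_T: "y \<in> laurent_ext T x1"
  proof -
    obtain c N where c: "\<And>j. c j \<in> R1" "\<And>M. N \<le> M \<Longrightarrow> y = (\<Sum>j=-int M..int M. c j * x2 powi j)"
      using laurent_expansion[OF subring_laurent_ext nonzero(2) y(1)] by metis
    have "\<exists>q\<in>R1. c (- int m) = P2 ^ m * q" for m
      by (rule coeff_divisible[OF subring_laurent_ext nonzero(2) free2 P2 nonzero(4) c y(3)])
    then obtain q where q: "\<And>m. q m \<in> R1" "\<And>m. c (- int m) = P2 ^ m * q m" by metis
    have sub: "R1 \<subseteq> laurent_ext T x1" by (rule laurent_ext_mono[OF T(1)])
    show ?thesis
      unfolding c(2)[OF order_refl]
      by (rule laurent_expansion_in[OF subring_laurent_ext, where q=q and P=P2])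
         (use sub c q T laurent_ext_base[where S=T and t=x1] in auto)
  qed
  obtain f N where f: "\<And>j. f j \<in> T" "\<And>M. N \<le> M \<Longrightarrow> y = (\<Sum>j=-int M..int M. f j * x1 powi j)"
    using laurent_expansion[OF sT nonzero(1) y_T] by metis
  have f2: "f j \<in> R2" for j using f(1) T_R2 by auto
  have "\<exists>h\<in>T. f (- int m) = P1 ^ m * h" for m
  proof -
    obtain h where h: "h \<in> R2" "f (- int m) = P1 ^ m * h"
      using coeff_divisible[OF subring_laurent_ext nonzero(1) free1 P1 nonzero(3) f2 f(2) y(2)] by metis
    obtain c N where c: "\<And>j. c j \<in> R" "\<And>M. N \<le> M \<Longrightarrow> h = (\<Sum>j=-int M..int M. c j * x2 powi j)"
      using laurent_expansion[OF R nonzero(2) h(1)] by metis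
    have "\<exists>q\<in>R. c (- int j) = P2 ^ j * q" for j
    proof -
      have "\<exists>q\<in>R. P1 ^ m * c (- int j) = P2 ^ j * q"
      proof (rule coeff_divisible[OF R nonzero(2) free2_R P(2) nonzero(4)])
        show "P1 ^ m * c i \<in> R" for i using c P by (auto intro!: subring_intros[OF R])
        show "f (- int m) = (\<Sum>i=-int M..int M. P1 ^ m * c i * x2 powi i)" if "N \<le> M" for M
          using h(2) c(2)[OF that] by (simp add: sum_distrib_left mult.assoc)
        show "f (- int m) \<in> laurent_ext R (P2 / x2)"
          using f(1) T_R2' by (auto simp: x2'_def)
      qed
      then show ?thesis using euclid c(1) by metis
    qed
    then obtain q where q: "\<And>m. q m \<in> R" "\<And>m. c (- int m) = P2 ^ m * q m" by metis
    have "h \<in> T"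
      unfolding c(2)[OF order_refl]
      by (rule laurent_expansion_in[OF sT, where q=q and P=P2]) (use c q T in auto)
    then show ?thesis using h(2) by auto
  qed
  then obtain h where h: "\<And>m. h m \<in> T" "\<And>m. f (- int m) = P1 ^ m * h m" by metis
  define L where "L = laurent_ext (laurent_ext R (P1 / x1)) (P2 / x2)"
  have sL: "is_subring L" by (simp add: L_def subring_laurent_ext)
  have R_L: "R \<subseteq> L" and x': "P1 / x1 \<in> L" "inverse (P1 / x1) \<in> L" "P2 / x2 \<in> L" "inverse (P2 / x2) \<in> L"
    unfolding L_def using laurent_ext_base[where S=R and t="P1 / x1"]
      laurent_ext_base[where S="laurent_ext R (P1 / x1)" and t="P2 / x2"] by auto
  have x1: "x1 \<in> L"
  proof -
    have "x1 = P1 * inverse (P1 / x1)" using nonzero by simp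
    also have "\<dots> \<in> L" using R_L P x' by (intro subring_mult[OF sL]) auto
    finally show ?thesis .
  qed
  have T_L: "T \<subseteq> L"
    unfolding L_def using T_R2' laurent_ext_mono[OF laurent_ext_base(1), of R "P2 / x2" "P1 / x1"]
    by (auto simp: x2'_def)
  show ?thesis
    unfolding f(2)[OF order_refl] L_def[symmetric]
    by (rule laurent_expansion_in[OF sL x1, where q=h and P=P1]) (use f(1) h T_L x' in auto)
qed

end

text \<open>
  A polynomial with invertible constant term can be divided out without creating a pole at \<open>x = 0\<close>: from
  \<open>\<alpha> * q = (\<alpha> + x ^ b) * q - x ^ b * q\<close> a pole of order \<open>K + 1\<close> of \<open>q\<close> is in fact one of order at most \<open>K\<close>.
\<close>

lemma no_pole_after_division:
  fixes x :: "'f::field"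
  assumes R: "is_subring R" and x: "x \<noteq> 0"
    and \<alpha>: "\<alpha> \<in> R" "inverse \<alpha> \<in> R" "\<alpha> \<noteq> 0" and b: "b \<ge> 1"
    and q: "q \<in> laurent_ext R x" and prod: "(\<alpha> + x ^ b) * q \<in> ring_hull (R \<union> {x})"
  shows "q \<in> ring_hull (R \<union> {x})"
proof -
  define S where "S = ring_hull (R \<union> {x})"
  have S: "is_subring S" by (simp add: S_def subring_ring_hull)
  have S_base: "R \<subseteq> S" "x \<in> S" by (auto simp: S_def intro: ring_hull.base)
  have descend: "x ^ K * q \<in> S \<Longrightarrow> q \<in> S" for K
  proof (induction K)
    case (Suc K)
    have "x ^ K * (x ^ b * q) = x ^ (b - 1) * (x ^ Suc K * q)"
      using b by (cases b) (auto simp: algebra_simps)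
    also have "\<dots> \<in> S"
      by (rule subring_mult[OF S subring_power[OF S S_base(2)] Suc.prems])
    finally have "x ^ K * (x ^ b * q) \<in> S" .
    moreover have "x ^ K * q = inverse \<alpha> * (x ^ K * ((\<alpha> + x ^ b) * q) - x ^ K * (x ^ b * q))"
      using \<alpha> by (simp add: field_simps)
    moreover have "inverse \<alpha> * (x ^ K * ((\<alpha> + x ^ b) * q) - x ^ K * (x ^ b * q)) \<in> S"
      using prod \<alpha> S_base calculation(1) unfolding S_def[symmetric]
      by (intro subring_mult[OF S, of "inverse \<alpha>"] subring_diff[OF S]
          subring_mult[OF S subring_power[OF S], of x "(\<alpha> + x ^ b) * q"]) auto
    ultimately have "x ^ K * q \<in> S" by simp
    then show ?case by (rule Suc.IH)
  qed auto
  obtain c N where c: "\<And>j. c j \<in> R" "\<And>M. N \<le> M \<Longrightarrow> q = (\<Sum>j=-int M..int M. c j * x powi j)"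
    using laurent_expansion[OF R x q] by metis
  have "x ^ N * q = (\<Sum>j=-int N..int N. c j * x ^ nat (int N + j))"
    unfolding c(2)[OF order_refl] sum_distrib_left
  proof (rule sum.cong[OF refl])
    fix j assume "j \<in> {-int N..int N}"
    then have "x ^ nat (int N + j) = x powi (int N + j)" by (simp add: power_int_def)
    also have "\<dots> = x ^ N * x powi j" using x by (simp add: power_int_add)
    finally show "x ^ N * (c j * x powi j) = c j * x ^ nat (int N + j)" by simp
  qed
  also have "\<dots> \<in> S"
    using c S_base by (intro subring_sum[OF S] subring_mult[OF S] subring_power[OF S]) auto
  finally show ?thesis using descend by (simp add: S_def)
qed

lemma power_add_mult_remainder:
  assumes S: "is_subring S" and a: "a \<in> S" "z \<in> S"
  shows "\<exists>g\<in>S. (a + z) ^ n = a ^ n + z * (g :: 'f::comm_ring_1)"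
proof (induction n)
  case 0
  show ?case by (rule bexI[of _ 0]) (auto intro: subring_zero[OF S])
next
  case (Suc n)
  then obtain g where g: "g \<in> S" "(a + z) ^ n = a ^ n + z * g" by auto
  then have "(a + z) ^ Suc n = a ^ Suc n + z * (a ^ n + (a + z) * g)"
    by (simp add: algebra_simps)
  moreover have "a ^ n + (a + z) * g \<in> S"
    using a g by (auto intro!: subring_intros[OF S])
  ultimately show ?case by blast
qed

text \<open>
  Let \<open>W\<close> be the ring generated by the four variables and \<open>U = R[x1, x2\<^sup>\<plusminus>]\<close>. The element \<open>y\<close> is a
  combination of powers of \<open>x1\<close> and \<open>x1'\<close> with coefficients in \<open>R[x2\<^sup>\<plusminus>]\<close>. Because \<open>P2\<close> is invertible at
  \<open>x1 = 0\<close>, a pole in \<open>x2\<close> standing next to a power of \<open>x1'\<close> can be traded for a power of \<open>x2'\<close>, up to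
  terms with fewer factors \<open>x1'\<close>; hence \<open>y = w + u\<close> with \<open>w\<close> in \<open>W\<close> and \<open>u\<close> in \<open>U\<close>. Then \<open>u\<close> is also a
  Laurent polynomial in \<open>x1\<close> and \<open>x2'\<close>, so its poles in \<open>x2\<close> come with powers of \<open>P2\<close>; dividing these out
  creates no pole in \<open>x1\<close>, and \<open>u\<close> is a polynomial in \<open>x1\<close>, \<open>x2\<close> and \<open>x2'\<close>.
\<close>

lemma (in rank_two) generated_by_four:
  fixes \<alpha> m M N b c
  defines "x1' \<equiv> P1 / x1" and "x2' \<equiv> P2 / x2"
  assumes \<alpha>: "\<alpha> \<in> R" "inverse \<alpha> \<in> R" "\<alpha> \<noteq> 0"
    and m: "m \<in> R" "inverse m \<in> R" "m \<noteq> 0" and MN: "M \<in> R" "N \<in> R"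
    and b: "b \<ge> 1"
    and P1_eq: "P1 = N + M * x2 ^ c" and P2_eq: "P2 = m * (\<alpha> + x1 ^ b)"
    and y: "y \<in> laurent_ext R1 x2" "y \<in> laurent_ext R2 x1'" "y \<in> laurent_ext R1 x2'"
  shows "y \<in> ring_hull (R \<union> {x1, x2, x1', x2'})"
proof -
  define W where "W = ring_hull (R \<union> {x1, x2, x1', x2'})"
  define U where "U = ring_hull (R2 \<union> {x1})"
  have sW: "is_subring W" and sU: "is_subring U" by (auto simp: W_def U_def subring_ring_hull)
  have W: "R \<subseteq> W" "x1 \<in> W" "x2 \<in> W" "x1' \<in> W" "x2' \<in> W"
    by (auto simp: W_def intro: ring_hull.base)
  have U: "R2 \<subseteq> U" "x1 \<in> U" by (auto simp: U_def intro: ring_hull.base)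
  have R_U: "R \<subseteq> U" and x2_U: "x2 \<in> U" "inverse x2 \<in> U"
    using U laurent_ext_base[where S=R and t=x2] by auto
  have P1_U: "P1 \<in> U" using P1 U by auto
  have x11': "x1 * x1' = P1" and x22': "x2 * x2' = P2" using nonzero by (auto simp: x1'_def x2'_def)
  define V where "V = {w + u | w u. w \<in> W \<and> u \<in> U}"
  have VI: "w + u \<in> V" if "w \<in> W" "u \<in> U" for w u using that by (auto simp: V_def)
  have W_V: "w \<in> V" if "w \<in> W" for w using VI[OF that subring_zero[OF sU]] by simp
  have U_V: "u \<in> V" if "u \<in> U" for u using VI[OF subring_zero[OF sW] that] by simp
  have V_add: "v + v' \<in> V" if "v \<in> V" "v' \<in> V" for v v'
  proof -
    from that obtain w u w' u' where h: "w \<in> W" "w' \<in> W" "u \<in> U" "u' \<in> U" "v = w + u" "v' = w' + u'"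
      by (auto simp: V_def)
    have "(w + w') + (u + u') \<in> V"
      using h by (intro VI subring_add[OF sW] subring_add[OF sU])
    then show ?thesis using h by (simp add: algebra_simps)
  qed
  have V_sum: "sum f I \<in> V" if "\<And>i. i \<in> I \<Longrightarrow> f i \<in> V" for f and I :: "int set"
    using that by (induction I rule: infinite_finite_induct) (auto intro: V_add U_V subring_zero[OF sU])
  \<comment> \<open>at \<open>x1 = 0\<close>, \<open>x2'\<close> is an invertible multiple of \<open>1 / x2\<close>\<close>
  have x1'_R2: "x1' * h \<in> V" if "h \<in> R2" for h
  proof -
    obtain d K where d: "\<And>j. d j \<in> R" "\<And>L. K \<le> L \<Longrightarrow> h = (\<Sum>j=-int L..int L. d j * x2 powi j)"
      using laurent_expansion[OF R nonzero(2) \<open>h \<in> R2\<close>] by metis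
    have "x1' * (d j * x2 powi j) \<in> V" for j
    proof (cases "j \<ge> 0")
      case True
      then show ?thesis
        using W d(1)[of j] by (auto simp: power_int_def intro!: W_V subring_intros[OF sW])
    next
      case False
      define s where "s = nat (- j)"
      have j: "j = - int s" using False by (simp add: s_def)
      obtain g where g: "g \<in> ring_hull (R \<union> {x1})" "(\<alpha> + x1 ^ b) ^ s = \<alpha> ^ s + x1 ^ b * g"
        using power_add_mult_remainder[OF subring_ring_hull[of "R \<union> {x1}"], of \<alpha> "x1 ^ b" s] \<alpha>
        by (auto intro: ring_hull.base subring_power[OF subring_ring_hull])
      have gU: "g \<in> U"
        using g(1) ring_hull_least[OF sU, of "R \<union> {x1}"] R_U U by auto
      have "x2' ^ s = m ^ s * (\<alpha> ^ s + x1 ^ b * g) * inverse x2 ^ s"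
        using g(2) by (simp add: x2'_def P2_eq divide_inverse power_mult_distrib)
      then have "x1' * x2 powi j = inverse (m * \<alpha>) ^ s * x1' * x2' ^ s
          - inverse \<alpha> ^ s * (x1' * x1 ^ b) * g * inverse x2 ^ s"
        using m \<alpha> nonzero by (simp add: j power_int_minus power_mult_distrib field_simps)
      also have "x1' * x1 ^ b = P1 * x1 ^ (b - 1)"
        using b x11' by (cases b) (auto simp: algebra_simps)
      finally have e: "x1' * x2 powi j = inverse (m * \<alpha>) ^ s * x1' * x2' ^ s
          - inverse \<alpha> ^ s * (P1 * x1 ^ (b - 1)) * g * inverse x2 ^ s" .
      have "x1' * (d j * x2 powi j) = d j * (x1' * x2 powi j)" by simp
      also have "\<dots> = d j * (inverse m * inverse \<alpha>) ^ s * x1' * x2' ^ s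
          + - (d j * inverse \<alpha> ^ s * (P1 * x1 ^ (b - 1)) * g * inverse x2 ^ s)"
        unfolding e by (simp add: algebra_simps)
      also have "\<dots> \<in> V"
      proof (rule VI)
        have "d j \<in> W" "inverse m \<in> W" "inverse \<alpha> \<in> W" using d(1) m \<alpha> W by auto
        then show "d j * (inverse m * inverse \<alpha>) ^ s * x1' * x2' ^ s \<in> W"
          using W by (intro subring_intros[OF sW])
        have "d j \<in> U" "inverse \<alpha> \<in> U" using d(1) \<alpha> R_U by auto
        then show "- (d j * inverse \<alpha> ^ s * (P1 * x1 ^ (b - 1)) * g * inverse x2 ^ s) \<in> U"
          using gU P1_U U x2_U by (intro subring_intros[OF sU])
      qed
      finally show ?thesis .
    qed
    then show ?thesis
      unfolding d(2)[OF order_refl] sum_distrib_left by (intro V_sum)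
  qed
  have x1'_V: "x1' * v \<in> V" if "v \<in> V" for v
  proof -
    have "x1' * u \<in> V" if u: "u \<in> U" for u
    proof -
      have "u \<in> {h + x1 * g | h g. h \<in> R2 \<and> g \<in> U}" (is "_ \<in> ?Q")
      proof -
        have "is_subring ?Q"
        proof (rule is_subringI)
          show "1 \<in> ?Q"
            using subring_one[OF subring_laurent_ext, of R x2] subring_zero[OF sU] by force
          fix p q assume "p \<in> ?Q" "q \<in> ?Q"
          then obtain h g h' g' where e: "h \<in> R2" "h' \<in> R2" "g \<in> U" "g' \<in> U"
            "p = h + x1 * g" "q = h' + x1 * g'" by auto
          have "p - q = (h - h') + x1 * (g - g')" using e by (simp add: algebra_simps)
          moreover have "h - h' \<in> R2" "g - g' \<in> U"
            using e by (auto intro: subring_diff subring_laurent_ext sU)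
          ultimately show "p - q \<in> ?Q" by blast
          have "p * q = h * h' + x1 * (h * g' + g * h' + x1 * g * g')" using e by (simp add: algebra_simps)
          moreover have "h * h' \<in> R2" using e by (auto intro: subring_mult subring_laurent_ext)
          moreover have "h * g' + g * h' + x1 * g * g' \<in> U"
            using e U by (intro subring_intros[OF sU]) auto
          ultimately show "p * q \<in> ?Q" by blast
        qed
        moreover have "R2 \<union> {x1} \<subseteq> ?Q"
        proof -
          have "h \<in> ?Q" if "h \<in> R2" for h using that subring_zero[OF sU] by force
          moreover have "x1 \<in> ?Q"
            using subring_zero[OF subring_laurent_ext, of R x2] subring_one[OF sU] by force
          ultimately show ?thesis by blast
        qed
        ultimately show ?thesis using u ring_hull_least unfolding U_def by blast
      qed
      then obtain h g where e: "h \<in> R2" "g \<in> U" "u = h + x1 * g" by auto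
      then have "x1' * u = x1' * h + P1 * g" using x11' by (simp add: algebra_simps)
      moreover have "P1 * g \<in> V" using e P1_U by (intro U_V subring_mult[OF sU])
      ultimately show ?thesis using x1'_R2[OF e(1)] V_add by simp
    qed
    moreover have "x1' * w \<in> V" if "w \<in> W" for w
      using that W by (intro W_V subring_mult[OF sW])
    moreover obtain w u where "w \<in> W" "u \<in> U" "v = w + u" using \<open>v \<in> V\<close> by (auto simp: V_def)
    ultimately show ?thesis using V_add by (simp add: distrib_left)
  qed
  have y_V: "y \<in> V"
  proof -
    have "y \<in> laurent_ext R2 x1" using y(1) laurent_ext_commute by metis
    then obtain f K where f: "\<And>j. f j \<in> R2" "\<And>L. K \<le> L \<Longrightarrow> y = (\<Sum>j=-int L..int L. f j * x1 powi j)"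
      using laurent_expansion[OF subring_laurent_ext nonzero(1)] by metis
    have "f j * x1 powi j \<in> V" for j
    proof (cases "j \<ge> 0")
      case True
      then show ?thesis
        using U f(1)[of j] by (auto simp: power_int_def intro!: U_V subring_intros[OF sU])
    next
      case False
      define s where "s = nat (- j)"
      have j: "j = - int s" using False by (simp add: s_def)
      obtain h where h: "h \<in> R2" "f j = P1 ^ s * h"
        using coeff_divisible[OF subring_laurent_ext nonzero(1) free1 P1 nonzero(3) f y(2)[unfolded x1'_def]]
          j by metis
      have "x1' ^ n * h \<in> V" for n
        using h U by (induction n) (auto intro: U_V dest: x1'_V simp: mult.assoc)
      moreover have "f j * x1 powi j = x1' ^ s * h"
        using h by (simp add: j x1'_def power_int_minus power_divide field_simps)
      ultimately show ?thesis by simp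
    qed
    then show ?thesis unfolding f(2)[OF order_refl] by (intro V_sum)
  qed
  then obtain w u where wu: "w \<in> W" "u \<in> U" "y = w + u" by (auto simp: V_def)
  have "u \<in> W"
  proof -
    define S where "S = ring_hull (R \<union> {x1})"
    have sS: "is_subring S" by (simp add: S_def subring_ring_hull)
    have S_R1: "S \<subseteq> R1"
      unfolding S_def using laurent_ext_base by (intro ring_hull_least subring_laurent_ext) auto
    have S_W: "S \<subseteq> W"
      unfolding S_def using W by (intro ring_hull_least sW) auto
    have "U \<subseteq> laurent_ext S x2"
      unfolding U_def
    proof (rule ring_hull_least[OF subring_laurent_ext])
      have "R2 \<subseteq> laurent_ext S x2"
        by (rule laurent_ext_mono) (auto simp: S_def intro: ring_hull.base)
      moreover have "x1 \<in> laurent_ext S x2"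
        using laurent_ext_base(1)[of S x2] by (auto simp: S_def intro: ring_hull.base)
      ultimately show "R2 \<union> {x1} \<subseteq> laurent_ext S x2" by auto
    qed
    with wu(2) have "u \<in> laurent_ext S x2" by auto
    then obtain d K where d: "\<And>j. d j \<in> S" "\<And>L. K \<le> L \<Longrightarrow> u = (\<Sum>j=-int L..int L. d j * x2 powi j)"
      using laurent_expansion[OF sS nonzero(2)] by metis
    have "W \<subseteq> laurent_ext R1 x2'"
      unfolding W_def
    proof (rule ring_hull_least[OF subring_laurent_ext])
      let ?L = "laurent_ext R1 x2'"
      have sL: "is_subring ?L" by (rule subring_laurent_ext)
      have L: "R1 \<subseteq> ?L" "x2' \<in> ?L" "inverse x2' \<in> ?L" by (rule laurent_ext_base)+
      have R1: "R \<subseteq> R1" "x1 \<in> R1" "inverse x1 \<in> R1" by (rule laurent_ext_base)+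
      have "P2 * inverse x2' \<in> ?L" using P2 L by (intro subring_mult[OF sL]) auto
      moreover have "P2 * inverse x2' = x2" using nonzero by (simp add: x2'_def)
      ultimately have x2: "x2 \<in> ?L" by simp
      have "(N + M * x2 ^ c) * inverse x1 \<in> ?L"
        using MN R1 L x2 by (intro subring_intros[OF sL]) auto
      then have "x1' \<in> ?L" by (simp add: x1'_def P1_eq divide_inverse)
      then show "R \<union> {x1, x2, x1', x2'} \<subseteq> ?L" using x2 L R1 by auto
    qed
    then have u': "u \<in> laurent_ext R1 x2'"
      using subring_diff[OF subring_laurent_ext y(3), of w] wu by auto
    have "\<exists>q\<in>S. d (- int n) = P2 ^ n * q" for n
    proof -
      have d1: "d j \<in> R1" for j using d(1) S_R1 by auto
      obtain q where q: "q \<in> R1" "d (- int n) = P2 ^ n * q"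
        using coeff_divisible[OF subring_laurent_ext nonzero(2) free2 P2 nonzero(4) d1 d(2) u'[unfolded x2'_def]]
        by metis
      have "P2 ^ i * q \<in> S \<Longrightarrow> q \<in> S" for i
      proof (induction i)
        case (Suc i)
        have "inverse m * (P2 ^ Suc i * q) \<in> S"
          using m by (intro subring_mult[OF sS _ Suc.prems]) (auto simp: S_def intro: ring_hull.base)
        moreover have "inverse m * (P2 ^ Suc i * q) = (\<alpha> + x1 ^ b) * (P2 ^ i * q)"
          using m by (simp add: P2_eq)
        ultimately have "(\<alpha> + x1 ^ b) * (P2 ^ i * q) \<in> S" by (simp only:)
        moreover have "P2 ^ i * q \<in> R1"
          using P2 q by (intro subring_mult[OF subring_laurent_ext] subring_power[OF subring_laurent_ext])
        ultimately have "P2 ^ i * q \<in> S"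
          using no_pole_after_division[OF R nonzero(1) \<alpha> b] by (simp add: S_def)
        then show ?case by (rule Suc.IH)
      qed auto
      then show ?thesis using q d(1) by metis
    qed
    then obtain q where q: "\<And>m. q m \<in> S" "\<And>m. d (- int m) = P2 ^ m * q m" by metis
    show ?thesis
      unfolding d(2)[OF order_refl]
      by (rule laurent_expansion_in[OF sW, where q=q and P=P2])
         (use d(1) q S_W W in \<open>auto simp: x2'_def\<close>)
  qed
  then show ?thesis using wu subring_add[OF sW] by (simp add: W_def)
qed

text \<open>
  The formula for \<open>P2'\<close> is the one produced by a mutation at \<open>x1\<close>. It remains to express the four
  generators through \<open>x1'\<close> and \<open>x2'' = P2' / x2\<close>. Only \<open>P2 / x2\<close> is not immediate: modulo \<open>x2\<close>, the
  variable \<open>x1\<close> is \<open>N / x1'\<close>, which turns \<open>P2\<close> into a unit times \<open>P2'\<close>; so \<open>P2 / x2\<close> is a unit times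
  \<open>x2''\<close> plus a remainder \<open>x2 ^ c / x2 * \<dots>\<close>, which has no pole because \<open>c \<ge> 1\<close>.
\<close>

lemma (in rank_two) upper_bound_connected:
  fixes \<alpha> m m' M N b c
  defines "x1' \<equiv> P1 / x1"
  defines "P2' \<equiv> m' * (1 + \<alpha> * inverse N ^ b * x1' ^ b)"
  assumes \<alpha>: "\<alpha> \<in> R" "inverse \<alpha> \<in> R" "\<alpha> \<noteq> 0"
    and m: "m \<in> R" "inverse m \<in> R" "m \<noteq> 0" and m': "m' \<in> R" "inverse m' \<in> R" "m' \<noteq> 0"
    and MN: "M \<in> R" "N \<in> R" "inverse N \<in> R" "N \<noteq> 0"
    and bc: "b \<ge> 1" "c \<ge> 1"
    and P1_eq: "P1 = N + M * x2 ^ c" and P2_eq: "P2 = m * (\<alpha> + x1 ^ b)"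
    and y: "y \<in> laurent_ext R1 x2" "y \<in> laurent_ext R2 x1'" "y \<in> laurent_ext R1 (P2 / x2)"
    and P2'_nz: "P2' \<noteq> 0"
  shows "y \<in> laurent_ext (laurent_ext R x1') (P2' / x2)"
proof -
  define x2'' where "x2'' = P2' / x2"
  define L where "L = laurent_ext (laurent_ext R x1') x2''"
  have sL: "is_subring L" by (simp add: L_def subring_laurent_ext)
  have L: "R \<subseteq> L" "x1' \<in> L" "inverse x1' \<in> L" "x2'' \<in> L" "inverse x2'' \<in> L"
    unfolding L_def using laurent_ext_base[where S=R and t=x1']
      laurent_ext_base[where S="laurent_ext R x1'" and t=x2''] by auto
  have x1': "x1' \<noteq> 0" "x1 = P1 * inverse x1'" using nonzero by (auto simp: x1'_def)
  have "P2' * inverse x2'' \<in> L"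
    unfolding P2'_def using m' \<alpha> MN L by (intro subring_intros[OF sL]) auto
  moreover have "x2 = P2' * inverse x2''" using nonzero P2'_nz by (simp add: x2''_def)
  ultimately have x2: "x2 \<in> L" by simp
  have "x1 \<in> L"
    unfolding x1'(2) P1_eq using MN x2 L by (intro subring_intros[OF sL]) auto
  moreover have "P2 / x2 \<in> L"
  proof -
    obtain g where g: "g \<in> L" "(N + M * x2 ^ c) ^ b = N ^ b + M * x2 ^ c * g"
      using power_add_mult_remainder[OF sL, of N "M * x2 ^ c" b] MN L x2
      by (auto intro!: subring_intros[OF sL])
    define u where "u = inverse x1' ^ b"
    have x1b: "x1 ^ b = (N ^ b + M * x2 ^ c * g) * u"
      unfolding u_def using x1'(2) g(2) P1_eq by (simp add: power_mult_distrib)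
    have c: "x2 ^ c = x2 ^ (c - 1) * x2" using bc by (cases c) auto
    have ux: "u * x1' ^ b = 1" using x1' by (simp add: u_def power_inverse)
    have "m * inverse m' * N ^ b * u * P2' = m * (N ^ b * u + \<alpha> * (u * x1' ^ b))"
      unfolding P2'_def using m' MN by (simp add: field_simps)
    then have "P2 = m * inverse m' * N ^ b * u * P2' + m * M * x2 ^ (c - 1) * x2 * g * u"
      unfolding P2_eq x1b c ux by (simp add: algebra_simps)
    then have "P2 / x2 = m * inverse m' * N ^ b * u * x2'' + m * M * x2 ^ (c - 1) * g * u"
      using nonzero by (simp add: x2''_def field_simps)
    also have "\<dots> \<in> L"
      unfolding u_def using m m' MN L g(1) x2 by (intro subring_intros[OF sL]) auto
    finally show ?thesis .
  qed
  ultimately have "ring_hull (R \<union> {x1, x2, x1', P2 / x2}) \<subseteq> L"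
    using x2 L by (intro ring_hull_least[OF sL]) auto
  moreover have "y \<in> ring_hull (R \<union> {x1, x2, P1 / x1, P2 / x2})"
    using y[unfolded x1'_def] by (intro generated_by_four[OF \<alpha> m MN(1,2) bc(1) P1_eq P2_eq])
  ultimately show ?thesis unfolding L_def x2''_def x1'_def by blast
qed

section \<open>Division by binomials in integer group rings\<close>

definition int_multiple :: "int \<Rightarrow> 'g::ab_group_add \<Rightarrow> 'g" where
  "int_multiple m g = (\<Sum>i<nat m. g) - (\<Sum>i<nat (- m). g)"

lemma nat_multiple_add: "(\<Sum>i<m + (n::nat). g) = (\<Sum>i<m. g) + (\<Sum>i<n. (g::'g::ab_group_add))"
  by (induction n) (auto simp: algebra_simps)

lemma int_multiple_diff_of_nat: "int_multiple (int a - int b) g = (\<Sum>i<a. g) - (\<Sum>i<b. g)"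
proof -
  have "nat (int a - int b) + b = a + nat (- (int a - int b))" by linarith
  then have "(\<Sum>i<nat (int a - int b) + b. g) = (\<Sum>i<a + nat (- (int a - int b)). g)" by simp
  then show ?thesis
    unfolding nat_multiple_add int_multiple_def by (simp add: algebra_simps)
qed

lemma int_multiple_add: "int_multiple (m + n) g = int_multiple m g + int_multiple n g"
proof -
  obtain a b c d where "m = int a - int b" "n = int c - int d"
    by (metis int_diff_cases)
  moreover have "int a - int b + (int c - int d) = int (a + c) - int (b + d)" for a b c d by simp
  ultimately show ?thesis
    by (simp only: int_multiple_diff_of_nat nat_multiple_add) (simp add: algebra_simps)
qed

lemma int_multiple_0: "int_multiple 0 g = 0" and int_multiple_1: "int_multiple 1 g = g"
  by (auto simp: int_multiple_def)

lemma int_multiple_minus: "int_multiple (- m) g = - int_multiple m g"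
  by (simp add: int_multiple_def)

lemma int_multiple_diff: "int_multiple (m - n) g = int_multiple m g - int_multiple n g"
  using int_multiple_add[of m "- n" g] by (simp add: int_multiple_minus)

lemma int_multiple_add_right: "int_multiple m (g + h) = int_multiple m g + int_multiple m h"
  by (simp add: int_multiple_def sum.distrib algebra_simps)

lemma int_multiple_0_right: "int_multiple m 0 = 0"
  by (simp add: int_multiple_def)

lemma int_multiple_int_multiple: "int_multiple m (int_multiple n g) = int_multiple (m * n) g"
proof -
  have nat: "(\<Sum>i<k. int_multiple n g) = int_multiple (int k * n) g" for k :: nat
    by (induction k) (auto simp: int_multiple_0 int_multiple_add algebra_simps)
  obtain a b where m: "m = int a - int b" by (rule int_diff_cases)
  show ?thesis
    unfolding m int_multiple_diff_of_nat nat by (simp add: int_multiple_diff algebra_simps)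
qed

lemma int_multiple_diff_right: "int_multiple m (g - h) = int_multiple m g - int_multiple m h"
  using int_multiple_add_right[of m "g - h" h] by (simp add: algebra_simps)

text \<open>
  The extension of \<open>\<phi>\<close> to the integer group ring by linearity. It is used with characters of the
  group, where it is a ring homomorphism, and with arbitrary functions, as a linear form.
\<close>

definition int_eval :: "('g \<Rightarrow> 'r::comm_ring_1) \<Rightarrow> ('g \<Rightarrow>\<^sub>0 int) \<Rightarrow> 'r" where
  "int_eval \<phi> F = (\<Sum>g\<in>Poly_Mapping.keys F. of_int (Poly_Mapping.lookup F g) * \<phi> g)"

lemma int_eval_superset:
  assumes "finite K" "Poly_Mapping.keys F \<subseteq> K"
  shows "int_eval \<phi> F = (\<Sum>g\<in>K. of_int (Poly_Mapping.lookup F g) * \<phi> g)"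
  unfolding int_eval_def using assms by (intro sum.mono_neutral_left) (auto simp: in_keys_iff)

lemma int_eval_zero: "int_eval \<phi> 0 = 0"
  by (simp add: int_eval_def)

lemma int_eval_single: "int_eval \<phi> (Poly_Mapping.single g n) = of_int n * \<phi> g"
  by (simp add: int_eval_superset[of "{g}"])

lemma int_eval_add: "int_eval \<phi> (F + G) = int_eval \<phi> F + int_eval \<phi> G"
proof -
  let ?K = "Poly_Mapping.keys F \<union> Poly_Mapping.keys G"
  have "Poly_Mapping.keys (F + G) \<subseteq> ?K" by (rule Poly_Mapping.keys_add)
  then show ?thesis
    by (simp add: int_eval_superset[of ?K] lookup_add sum.distrib distrib_right)
qed

lemma int_eval_uminus: "int_eval \<phi> (- F) = - int_eval \<phi> F"
  using int_eval_add[of \<phi> F "- F"] by (simp add: int_eval_zero add_eq_0_iff)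

lemma int_eval_diff: "int_eval \<phi> (F - G) = int_eval \<phi> F - int_eval \<phi> G"
  using int_eval_add[of \<phi> F "- G"] by (simp add: int_eval_uminus)

lemma poly_mapping_single_induct [case_names zero add]:
  assumes zero: "P 0" and add: "\<And>F g n. P F \<Longrightarrow> P (F + Poly_Mapping.single g n)"
  shows "P (F :: 'g \<Rightarrow>\<^sub>0 'b::comm_monoid_add)"
proof -
  have sum: "P (\<Sum>g\<in>K. Poly_Mapping.single g (Poly_Mapping.lookup F g))" if "finite K" for K
    using that
  proof induction
    case (insert g K)
    then show ?case using add[OF insert.IH, of g] by (simp add: add.commute)
  qed (simp add: zero)
  have "F = (\<Sum>g\<in>Poly_Mapping.keys F. Poly_Mapping.single g (Poly_Mapping.lookup F g))"
    by (rule poly_mapping_eqI) (auto simp: lookup_sum lookup_single when_def sum.delta in_keys_iff)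
  then show ?thesis using sum[OF finite_keys, of F] by simp
qed

lemma int_eval_mult:
  assumes "\<And>g h. \<phi> (g + h) = \<phi> g * \<phi> h"
  shows "int_eval \<phi> (F * G) = int_eval \<phi> F * int_eval \<phi> (G :: 'g::comm_monoid_add \<Rightarrow>\<^sub>0 int)"
proof (induction F rule: poly_mapping_single_induct)
  case zero
  show ?case by (simp add: int_eval_zero)
next
  case (add F g n)
  have "int_eval \<phi> (Poly_Mapping.single g n * G) = of_int n * \<phi> g * int_eval \<phi> G"
  proof (induction G rule: poly_mapping_single_induct)
    case (add G h m)
    then show ?case
      by (simp add: distrib_left int_eval_add mult_single int_eval_single assms algebra_simps)
  qed (simp add: int_eval_zero)
  then show ?case by (simp add: distrib_right int_eval_add int_eval_single add)
qed

lemma int_eval_single_mult: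
  "int_eval \<phi> (Poly_Mapping.single g 1 * F) = int_eval (\<lambda>h. \<phi> (g + h)) F"
  by (induction F rule: poly_mapping_single_induct)
     (simp_all add: int_eval_zero distrib_left int_eval_add mult_single int_eval_single)

definition torsion_free_type :: "'g::ab_group_add itself \<Rightarrow> bool" where
  "torsion_free_type _ \<longleftrightarrow> (\<forall>m (g::'g). int_multiple m g = 0 \<longrightarrow> m = 0 \<or> g = 0)"

lemma int_multiple_eq_0:
  "torsion_free_type TYPE('g::ab_group_add) \<Longrightarrow> int_multiple m (g::'g) = 0 \<longleftrightarrow> m = 0 \<or> g = 0"
  by (auto simp: torsion_free_type_def int_multiple_0 int_multiple_0_right)

lemma int_multiple_inj:
  assumes "torsion_free_type TYPE('g::ab_group_add)" "(u::'g) \<noteq> 0"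
  shows "int_multiple m u = int_multiple n u \<longleftrightarrow> m = n"
  using int_multiple_eq_0[OF assms(1), of "m - n" u] assms(2) by (auto simp: int_multiple_diff)

abbreviation mon :: "'g \<Rightarrow> 'g \<Rightarrow>\<^sub>0 int" where
  "mon g \<equiv> Poly_Mapping.single g 1"

lemma lookup_mon_mult:
  fixes f :: "'g::ab_group_add \<Rightarrow>\<^sub>0 int"
  shows "Poly_Mapping.lookup (mon v * f) g = Poly_Mapping.lookup f (g - v)"
proof (induction f rule: poly_mapping_single_induct)
  case (add f h n)
  have "v + h = g \<longleftrightarrow> h = g - v" by (auto simp: algebra_simps)
  then show ?case using add
    by (simp add: distrib_left lookup_add mult_single lookup_single when_def)
qed simp

text \<open>
  For \<open>u\<close> of infinite order, \<open>alt_sum u f g\<close> is the sum of \<open>(- 1) ^ m * f (g + m u)\<close> over all integers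
  \<open>m\<close>, written with the function \<open>alt_sign u\<close> that is \<open>(- 1) ^ m\<close> at \<open>m u\<close> and \<open>0\<close> off the cyclic group
  generated by \<open>u\<close>.
\<close>

definition alt_sign :: "'g::ab_group_add \<Rightarrow> 'g \<Rightarrow> int" where
  "alt_sign u h = (if \<exists>m. h = int_multiple (2 * m) u then 1 else if \<exists>m. h = int_multiple (2 * m + 1) u then -1 else 0)"

definition alt_sum :: "'g::ab_group_add \<Rightarrow> ('g \<Rightarrow>\<^sub>0 int) \<Rightarrow> 'g \<Rightarrow> int" where
  "alt_sum u f g = int_eval (\<lambda>h. alt_sign u (h - g)) f"

context
  fixes u :: "'g::ab_group_add"
  assumes tf: "torsion_free_type TYPE('g)" and u: "u \<noteq> 0"
begin

lemma alt_sign_int_multiple: "alt_sign u (int_multiple m u) = (if even m then 1 else -1)"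
proof (cases "even m")
  case True
  then show ?thesis by (auto simp: alt_sign_def elim!: evenE)
next
  case False
  then have "\<nexists>n. m = 2 * n" by auto
  then show ?thesis
    using False int_multiple_inj[OF tf u] by (auto simp: alt_sign_def elim!: oddE)
qed

lemma alt_sign_nonzero: "alt_sign u h \<noteq> 0 \<Longrightarrow> \<exists>m. h = int_multiple m u"
  by (auto simp: alt_sign_def split: if_splits)

lemma alt_sign_add: "alt_sign u (h + int_multiple m u) = (if even m then 1 else -1) * alt_sign u h"
proof (cases "\<exists>n. h = int_multiple n u")
  case True
  then obtain n where n: "h = int_multiple n u" by auto
  show ?thesis unfolding n int_multiple_add[symmetric] alt_sign_int_multiple by auto
next
  case False
  have "\<nexists>n. h + int_multiple m u = int_multiple n u"
  proof
    assume "\<exists>n. h + int_multiple m u = int_multiple n u"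
    then obtain n where "h + int_multiple m u = int_multiple n u" by auto
    then have "h = int_multiple (n - m) u" by (simp add: int_multiple_diff algebra_simps)
    then show False using False by auto
  qed
  then have "alt_sign u h = 0" "alt_sign u (h + int_multiple m u) = 0"
    using False alt_sign_nonzero by blast+
  then show ?thesis by simp
qed

lemma alt_sum_add: "alt_sum u (f + f') g = alt_sum u f g + alt_sum u f' g"
  and alt_sum_diff: "alt_sum u (f - f') g = alt_sum u f g - alt_sum u f' g"
  by (simp_all add: alt_sum_def int_eval_add int_eval_diff)

lemma alt_sum_mon_mult: "alt_sum u (mon v * f) g = alt_sum u f (g - v)"
  unfolding alt_sum_def int_eval_single_mult by (simp add: algebra_simps)

lemma alt_sum_shift: "alt_sum u f (g + int_multiple m u) = (if even m then 1 else -1) * alt_sum u f g"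
proof -
  have "alt_sign u (h - (g + int_multiple m u)) = (if even m then 1 else -1) * alt_sign u (h - g)" for h
    using alt_sign_add[of "h - g" "- m"] by (simp add: int_multiple_minus algebra_simps)
  then show ?thesis by (auto simp: alt_sum_def int_eval_def sum_negf)
qed

lemma mon_power_diff_dvd:
  "1 + mon u dvd mon (g + int_multiple m u) - (if even m then 1 else -1) * mon g"
proof -
  have nat: "1 + mon u dvd mon (g + int_multiple (int n) u) - (-1) ^ n * mon g" for n g
  proof (induction n)
    case 0
    show ?case by (simp add: int_multiple_0)
  next
    case (Suc n)
    have "mon (g + int_multiple (int (Suc n)) u) - (-1) ^ Suc n * mon g
        = (1 + mon u) * mon (g + int_multiple (int n) u) - (mon (g + int_multiple (int n) u) - (-1) ^ n * mon g)"
      by (simp add: int_multiple_add int_multiple_1 distrib_right mult_single algebra_simps)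
    also have "1 + mon u dvd \<dots>" by (rule dvd_diff[OF dvd_triv_left Suc])
    finally show ?case .
  qed
  show ?thesis
  proof (cases "m \<ge> 0")
    case True
    have "(-1) ^ nat m = (if even m then 1 else -1 :: 'g \<Rightarrow>\<^sub>0 int)" using True by (simp add: even_nat_iff)
    then show ?thesis using nat[of g "nat m"] True by simp
  next
    case False
    have e: "(-1) ^ nat (- m) = (if even m then 1 else -1 :: 'g \<Rightarrow>\<^sub>0 int)" using False by (simp add: even_nat_iff)
    have "1 + mon u dvd mon g - (if even m then 1 else -1) * mon (g + int_multiple m u)"
      using nat[of "g + int_multiple m u" "nat (- m)"] False e by (simp add: int_multiple_minus)
    then have "1 + mon u dvd (if even m then -1 else 1) * (mon g - (if even m then 1 else -1) * mon (g + int_multiple m u))"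
      by (rule dvd_mult)
    also have "\<dots> = mon (g + int_multiple m u) - (if even m then 1 else -1) * mon g" by auto
    finally show ?thesis .
  qed
qed

text \<open>
  Modulo \<open>1 + u\<close> a basis element may be moved along its coset of the cyclic group generated by \<open>u\<close> at
  the cost of a sign. Each coset can therefore be contracted to one basis element, whose coefficient is
  the alternating sum over the coset. The induction contracts one element of the support at a time.
\<close>

lemma dvd_iff_alt_sum: "1 + mon u dvd f \<longleftrightarrow> (\<forall>g. alt_sum u f g = 0)"
proof
  assume "1 + mon u dvd f"
  then obtain q where q: "f = (1 + mon u) * q" by auto
  show "\<forall>g. alt_sum u f g = 0"
  proof
    fix g
    have "alt_sum u f g = alt_sum u q g + alt_sum u q (g - u)"
      unfolding q distrib_right by (simp add: alt_sum_add alt_sum_mon_mult)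
    also have "alt_sum u q (g - u) = - alt_sum u q g"
      using alt_sum_shift[of q g "-1"] by (simp add: int_multiple_minus int_multiple_1)
    finally show "alt_sum u f g = 0" by simp
  qed
next
  assume "\<forall>g. alt_sum u f g = 0"
  then show "1 + mon u dvd f"
  proof (induction "card (Poly_Mapping.keys f)" arbitrary: f rule: less_induct)
    case less
    show ?case
    proof (cases "f = 0")
      case False
      then obtain g where g: "g \<in> Poly_Mapping.keys f" by (metis all_not_in_conv keys_eq_empty)
      have "\<exists>h\<in>Poly_Mapping.keys f. h \<noteq> g \<and> alt_sign u (h - g) \<noteq> 0"
      proof (rule ccontr)
        assume *: "\<not> ?thesis"
        have "alt_sum u f g = (\<Sum>h\<in>Poly_Mapping.keys f. if h = g then Poly_Mapping.lookup f g else 0)"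
          unfolding alt_sum_def int_eval_def
          by (rule sum.cong[OF refl]) (use * alt_sign_int_multiple[of 0] in \<open>auto simp: int_multiple_0\<close>)
        then have "alt_sum u f g = Poly_Mapping.lookup f g" using g by simp
        then show False using less.prems g by (simp add: in_keys_iff)
      qed
      then obtain h where h_key: "h \<in> Poly_Mapping.keys f" "h \<noteq> g" and "alt_sign u (h - g) \<noteq> 0"
        by blast
      from alt_sign_nonzero[OF this(3)] obtain m where "h - g = int_multiple m u" by blast
      then have h: "h \<in> Poly_Mapping.keys f" "h \<noteq> g" "h = g + int_multiple m u"
        using h_key by (auto simp: algebra_simps)
      define c where "c = Poly_Mapping.lookup f h"
      define s :: int where "s = (if even m then 1 else -1)"
      define r where "r = Poly_Mapping.single h c - Poly_Mapping.single g (s * c)"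
      have "r = Poly_Mapping.single 0 c * (mon (g + int_multiple m u) - (if even m then 1 else -1) * mon g)"
        by (simp add: r_def s_def h(3) mult_single right_diff_distrib single_uminus)
      then have r: "1 + mon u dvd r" using mon_power_diff_dvd by simp
      have "Poly_Mapping.keys (f - r) \<subseteq> Poly_Mapping.keys f - {h}"
      proof
        fix k assume "k \<in> Poly_Mapping.keys (f - r)"
        then have "Poly_Mapping.lookup f k - Poly_Mapping.lookup r k \<noteq> 0"
          by (simp add: in_keys_iff lookup_minus)
        then show "k \<in> Poly_Mapping.keys f - {h}"
          using g h by (auto simp: r_def c_def in_keys_iff lookup_minus lookup_single when_def split: if_splits)
      qed
      then have "card (Poly_Mapping.keys (f - r)) < card (Poly_Mapping.keys f)"
        using h(1) by (intro psubset_card_mono) auto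
      moreover have "\<forall>g. alt_sum u r g = 0"
      proof -
        obtain q where q: "r = (1 + mon u) * q" using r by auto
        have "alt_sum u q (g - u) = - alt_sum u q g" for g
          using alt_sum_shift[of q g "-1"] by (simp add: int_multiple_minus int_multiple_1)
        then show ?thesis
          unfolding q distrib_right by (simp add: alt_sum_add alt_sum_mon_mult)
      qed
      ultimately have "1 + mon u dvd f - r" using less.hyps less.prems by (simp add: alt_sum_diff)
      then show ?thesis using r dvd_add[of "1 + mon u" "f - r" r] by simp
    qed simp
  qed
qed

end

text \<open>
  If \<open>b t + a s = 1\<close>, the common root is \<open>b u + a v\<close>.
\<close>

lemma common_odd_root:
  assumes tf: "torsion_free_type TYPE('g::ab_group_add)"
    and "odd s" "odd t" and coprime: "coprime s t" and eq: "int_multiple t (v::'g) = int_multiple s u"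
  shows "\<exists>w. u = int_multiple t w \<and> v = int_multiple s w"
proof -
  obtain a b where "a * s + b * t = 1" using bezout_int[of s t] coprime by auto
  then have ab: "b * t + a * s = 1" by simp
  define w where "w = int_multiple b u + int_multiple a v"
  have "int_multiple t w = int_multiple b (int_multiple t u) + int_multiple a (int_multiple t v)"
    by (simp add: w_def int_multiple_add_right int_multiple_int_multiple mult.commute)
  also have "\<dots> = int_multiple (b * t + a * s) u"
    unfolding eq by (simp add: int_multiple_int_multiple int_multiple_add)
  also have "\<dots> = u" by (simp add: ab int_multiple_1)
  finally have "u = int_multiple t w" ..
  have "int_multiple s w = int_multiple b (int_multiple s u) + int_multiple a (int_multiple s v)"
    by (simp add: w_def int_multiple_add_right int_multiple_int_multiple mult.commute)
  also have "\<dots> = int_multiple (b * t + a * s) v"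
    unfolding eq[symmetric] by (simp add: int_multiple_int_multiple int_multiple_add)
  also have "\<dots> = v" by (simp add: ab int_multiple_1)
  finally show ?thesis using \<open>u = int_multiple t w\<close> by auto
qed

text \<open>
  Divisibility by \<open>1 + u\<close> of \<open>(1 + v) * f\<close> makes the alternating sums of \<open>f\<close> change sign under translation
  by \<open>v\<close>, as they do under translation by \<open>u\<close>. If one of them is nonzero, finiteness of the support forces
  a relation \<open>t v = s u\<close> with coprime \<open>s\<close> and \<open>t\<close>; translating by both sides shows that \<open>s\<close> and \<open>t\<close> have
  the same parity, hence are odd, and \<open>u\<close>, \<open>v\<close> are odd multiples of a common element. For \<open>u = 0\<close> the
  divisor is \<open>2\<close>, and the same argument works with parities of coefficients.
\<close>

lemma binomial_euclid:
  fixes u v :: "'g::ab_group_add"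
  assumes tf: "torsion_free_type TYPE('g)"
    and no_root: "\<nexists>w s t. odd s \<and> odd t \<and> u = int_multiple s w \<and> v = int_multiple t w"
    and dvd: "1 + mon u dvd (1 + mon v) * f"
  shows "1 + mon u dvd f"
proof (cases "u = 0")
  case True
  \<comment> \<open>otherwise both elements would be odd multiples of \<open>0\<close>\<close>
  have v: "v \<noteq> 0"
  proof
    assume "v = 0"
    then have "odd (1::int) \<and> odd (1::int) \<and> u = int_multiple 1 0 \<and> v = int_multiple 1 0" using True by (simp add: int_multiple_1)
    then show False using no_root by blast
  qed
  have two: "1 + mon u = 2" using True by simp
  have two_mult: "Poly_Mapping.lookup (2 * q) g = 2 * Poly_Mapping.lookup q g"
    for q :: "'g \<Rightarrow>\<^sub>0 int" and g
    unfolding mult_2 lookup_add by simp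
  obtain q where q: "(1 + mon v) * f = 2 * q" using dvd two by auto
  have even: "even (Poly_Mapping.lookup f g + Poly_Mapping.lookup f (g - v))" for g
    using two_mult[of q g] unfolding q[symmetric] by (simp add: distrib_right lookup_add lookup_mon_mult)
  have "even (Poly_Mapping.lookup f g)" for g
  proof (rule ccontr)
    assume "odd (Poly_Mapping.lookup f g)"
    then have "odd (Poly_Mapping.lookup f (g - int_multiple (int n) v))" for n
    proof (induction n)
      case (Suc n)
      have e: "g - int_multiple (int (Suc n)) v = g - int_multiple (int n) v - v"
        by (simp add: int_multiple_add int_multiple_1 algebra_simps)
      show ?case unfolding e using Suc even[of "g - int_multiple (int n) v"] by simp
    qed (simp add: int_multiple_0)
    then have "Poly_Mapping.lookup f (g - int_multiple (int n) v) \<noteq> 0" for n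
      by (metis even_zero)
    then have "range (\<lambda>n. g - int_multiple (int n) v) \<subseteq> Poly_Mapping.keys f"
      by (intro image_subsetI) (simp add: in_keys_iff)
    then have "finite (range (\<lambda>n. g - int_multiple (int n) v))"
      by (rule finite_subset) simp
    moreover have "inj (\<lambda>n. g - int_multiple (int n) v)"
      by (rule injI) (simp add: int_multiple_inj[OF tf v])
    ultimately have "finite (UNIV :: nat set)" by (rule finite_imageD)
    then show False by simp
  qed
  then have "f = 2 * Poly_Mapping.map (\<lambda>n. n div 2) f"
    by (intro poly_mapping_eqI) (auto simp: two_mult Poly_Mapping.map.rep_eq when_def)
  then show ?thesis unfolding two by (rule dvdI)
next
  case False
  note alt = alt_sum_add[OF tf False] alt_sum_mon_mult[OF tf False] alt_sum_shift[OF tf False]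
  have step: "alt_sum u f (g - v) = - alt_sum u f g" for g
  proof -
    have "alt_sum u ((1 + mon v) * f) g = 0" using dvd dvd_iff_alt_sum[OF tf False] by blast
    then have "alt_sum u f g + alt_sum u f (g - v) = 0"
      unfolding distrib_right alt by simp
    then show ?thesis by linarith
  qed
  have steps: "alt_sum u f (g - int_multiple (int n) v) = (-1) ^ n * alt_sum u f g" for g n
  proof (induction n)
    case (Suc n)
    have e: "g - int_multiple (int (Suc n)) v = g - int_multiple (int n) v - v"
      by (simp add: int_multiple_add int_multiple_1 algebra_simps)
    show ?case unfolding e using Suc step[of "g - int_multiple (int n) v"] by simp
  qed (simp add: int_multiple_0)
  have "alt_sum u f g = 0" for g
  proof (rule ccontr)
    assume nz: "alt_sum u f g \<noteq> 0"
    have "\<exists>h\<in>Poly_Mapping.keys f. \<exists>m. h = g - int_multiple (int n) v + int_multiple m u" for n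
    proof -
      have "alt_sum u f (g - int_multiple (int n) v) \<noteq> 0" using nz by (simp add: steps)
      then obtain h where "h \<in> Poly_Mapping.keys f" "alt_sign u (h - (g - int_multiple (int n) v)) \<noteq> 0"
        unfolding alt_sum_def int_eval_def by (auto elim!: sum.not_neutral_contains_not_neutral)
      then obtain m where "h - (g - int_multiple (int n) v) = int_multiple m u"
        using alt_sign_nonzero[OF tf False] by blast
      then have "h = g - int_multiple (int n) v + int_multiple m u" by (simp add: algebra_simps)
      then show ?thesis using \<open>h \<in> _\<close> by blast
    qed
    then obtain h m where h: "\<And>n. h n \<in> Poly_Mapping.keys f" "\<And>n. h n = g - int_multiple (int n) v + int_multiple (m n) u"
      by metis
    have "range h \<subseteq> Poly_Mapping.keys f" using h(1) by auto
    then have "finite (range h)" by (rule finite_subset) simp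
    then have "\<not> inj h" using finite_imageD[of h UNIV] by auto
    then obtain i0 j0 where ij: "i0 \<noteq> j0" "h i0 = h j0" by (auto simp: inj_def)
    obtain i j where "i < j" "h i = h j"
      using ij that[of i0 j0] that[of j0 i0] by (cases "i0 < j0") auto
    define T where "T = int j - int i"
    define S where "S = m j - m i"
    have T: "T > 0" using \<open>i < j\<close> by (simp add: T_def)
    have TS: "int_multiple T v = int_multiple S u"
      using \<open>h i = h j\<close> unfolding h(2) T_def S_def int_multiple_diff by (simp add: algebra_simps)
    define d where "d = gcd S T"
    have d: "d > 0" using T by (simp add: d_def)
    have "gcd S T \<noteq> 0" using d by (simp add: d_def)
    then obtain s t where st: "S = s * d" "T = t * d" "coprime s t"
      unfolding d_def using gcd_coprime_exists by blast
    have "int_multiple d (int_multiple t v - int_multiple s u) = 0"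
      using TS by (simp add: int_multiple_diff_right int_multiple_int_multiple st mult.commute)
    then have eq: "int_multiple t v = int_multiple s u" using int_multiple_eq_0[OF tf] d by auto
    have t: "t > 0" using T d st(2) by (simp add: zero_less_mult_iff)
    have "(-1) ^ nat t * alt_sum u f g = alt_sum u f (g - int_multiple t v)"
      using steps[of g "nat t"] t by simp
    also have "\<dots> = alt_sum u f (g + int_multiple (- s) u)" by (simp add: eq int_multiple_minus)
    also have "\<dots> = (if even s then 1 else -1) * alt_sum u f g" by (simp add: alt)
    finally have "(-1::int) ^ nat t = (if even s then 1 else -1)" using nz by simp
    then have "even t \<longleftrightarrow> even s"
      using t by (cases "even t") (auto simp: even_nat_iff split: if_splits)
    then have "odd s" "odd t" using st(3) by auto
    then show False using common_odd_root[OF tf _ _ st(3) eq] no_root by blast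
  qed
  then show ?thesis unfolding dvd_iff_alt_sum[OF tf False] by simp
qed

section \<open>Laurent rings as group rings\<close>

text \<open>
  Sums over distinct monomials \<open>\<mu> e\<close> are closed under subtraction: extend the coefficient functions by
  \<open>0\<close> to a common finite set of exponents.
\<close>

lemma finite_sums_subring:
  assumes A: "is_subring A" and y: "y \<in> add_span {a * \<mu> e | a e. a \<in> A}"
  shows "y \<in> {\<Sum>e\<in>E. c e * \<mu> e | (E :: 'e set) c. finite E \<and> c ` E \<subseteq> A}"
  using y
proof induction
  case (base y)
  then obtain a e where "y = a * \<mu> e" "a \<in> A" by auto
  then show ?case by (auto intro!: exI[of _ "{e}"] exI[of _ "\<lambda>_. a"])
next
  case zero
  show ?case by (auto intro!: exI[of _ "{}"])
next
  case (diff y z)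
  then obtain E c E' c' where y: "y = (\<Sum>e\<in>E. c e * \<mu> e)" "finite E" "c ` E \<subseteq> A"
    and z: "z = (\<Sum>e\<in>E'. c' e * \<mu> e)" "finite E'" "c' ` E' \<subseteq> A" by blast
  define d where "d e = (if e \<in> E then c e else 0) - (if e \<in> E' then c' e else 0)" for e
  have "y = (\<Sum>e\<in>E \<union> E'. (if e \<in> E then c e else 0) * \<mu> e)"
    unfolding y(1) using y z by (intro sum.mono_neutral_cong_left) auto
  moreover have "z = (\<Sum>e\<in>E \<union> E'. (if e \<in> E' then c' e else 0) * \<mu> e)"
    unfolding z(1) using y z by (intro sum.mono_neutral_cong_left) auto
  ultimately have "y - z = (\<Sum>e\<in>E \<union> E'. d e * \<mu> e)"
    by (simp add: d_def left_diff_distrib sum_subtractf)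
  moreover have "d ` (E \<union> E') \<subseteq> A"
    using y(3) z(3) subring_zero[OF A]
    by (auto simp: d_def image_subset_iff intro!: subring_diff[OF A] subring_minus[OF A])
  ultimately show ?case using y z by blast
qed

text \<open>
  The ring of Laurent polynomials in the variables whose index lies outside \<open>J\<close>; with one or two indices in
  \<open>J\<close> it serves as the coefficient ring for the remaining variables.
\<close>

definition laurent_off :: "('a \<Rightarrow> 'f::field) \<Rightarrow> ('n \<Rightarrow> 'f) \<Rightarrow> 'n set \<Rightarrow> 'f set" where
  "laurent_off \<iota> x J = ring_hull (range \<iota> \<union> (\<Union>i\<in>- J. {x i, inverse (x i)}))"

lemma subring_laurent_off: "is_subring (laurent_off \<iota> x J)"
  by (simp add: laurent_off_def subring_ring_hull)

lemma laurent_off_base: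
  "\<iota> a \<in> laurent_off \<iota> x J" "i \<notin> J \<Longrightarrow> x i \<in> laurent_off \<iota> x J" "i \<notin> J \<Longrightarrow> inverse (x i) \<in> laurent_off \<iota> x J"
  by (auto simp: laurent_off_def intro!: ring_hull.base)

lemma laurent_off_least:
  assumes "is_subring S" "range \<iota> \<subseteq> S" "\<And>i. i \<notin> J \<Longrightarrow> x i \<in> S \<and> inverse (x i) \<in> S"
  shows "laurent_off \<iota> x J \<subseteq> S"
  unfolding laurent_off_def using assms by (intro ring_hull_least) auto

lemma laurent_off_cong:
  assumes "\<And>i. i \<notin> J \<Longrightarrow> x i = x' i"
  shows "laurent_off \<iota> x J = laurent_off \<iota> x' J"
  unfolding laurent_off_def using assms by simp

lemma laurent_off_Diff:
  assumes "k \<in> J"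
  shows "laurent_off \<iota> x (J - {k}) = laurent_ext (laurent_off \<iota> x J) (x k)"
proof -
  have "- (J - {k}) = insert k (- J)" using assms by auto
  then show ?thesis
    unfolding laurent_off_def laurent_ext_def ring_hull_absorb by (simp add: Un_ac)
qed

definition monomial :: "(('p::ab_group_add \<Rightarrow>\<^sub>0 int) \<Rightarrow> 'f::field) \<Rightarrow> ('n::finite \<Rightarrow> 'f) \<Rightarrow> 'p \<times> ('n \<Rightarrow> int) \<Rightarrow> 'f"
  where "monomial \<iota> x g = grp \<iota> (fst g) * (\<Prod>i\<in>UNIV. x i powi snd g i)"

text \<open>
  Laurent monomials with coefficient in the group form the group \<open>'p \<times> ('n \<Rightarrow> int)\<close>; those free of the
  variables indexed by \<open>J\<close> form a subgroup.
\<close>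

definition vanishing :: "'n set \<Rightarrow> ('p \<times> ('n \<Rightarrow> int)) set" where
  "vanishing J = {g. \<forall>i\<in>J. snd g i = 0}"

lemma vanishing_group:
  "0 \<in> vanishing J"
  "g \<in> vanishing J \<Longrightarrow> h \<in> vanishing J \<Longrightarrow> g + h \<in> vanishing J"
  "g \<in> vanishing J \<Longrightarrow> h \<in> vanishing J \<Longrightarrow> g - h \<in> vanishing J"
  "g \<in> vanishing J \<Longrightarrow> - g \<in> vanishing J"
  for g :: "'p::ab_group_add \<times> ('n \<Rightarrow> int)"
  by (auto simp: vanishing_def)

lemma subring_int_eval_image:
  fixes H :: "'g::ab_group_add set"
  assumes hom: "\<And>g h. \<phi> (g + h) = \<phi> g * \<phi> h" "\<phi> 0 = 1"
    and H: "0 \<in> H" "\<And>g h. g \<in> H \<Longrightarrow> h \<in> H \<Longrightarrow> g + h \<in> H"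
  shows "is_subring (int_eval \<phi> ` {F. Poly_Mapping.keys F \<subseteq> H})"
proof (rule is_subringI)
  have "int_eval \<phi> (mon 0) = 1" by (simp only: int_eval_single hom) simp
  then show "1 \<in> int_eval \<phi> ` {F. Poly_Mapping.keys F \<subseteq> H}" using H(1)
    by (intro image_eqI[of _ _ "mon 0"]) auto
  fix a b assume "a \<in> int_eval \<phi> ` {F. Poly_Mapping.keys F \<subseteq> H}" "b \<in> int_eval \<phi> ` {F. Poly_Mapping.keys F \<subseteq> H}"
  then obtain F G where F: "Poly_Mapping.keys F \<subseteq> H" "a = int_eval \<phi> F"
    and G: "Poly_Mapping.keys G \<subseteq> H" "b = int_eval \<phi> G" by auto
  have "Poly_Mapping.keys (F - G) \<subseteq> H"
    using F(1) G(1) keys_diff[of F G] by auto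
  then show "a - b \<in> int_eval \<phi> ` {F. Poly_Mapping.keys F \<subseteq> H}"
    using F(2) G(2) by (intro image_eqI[of _ _ "F - G"]) (auto simp: int_eval_diff)
  have "Poly_Mapping.keys (F * G) \<subseteq> H"
    using F(1) G(1) H(2) keys_mult[of F G] by blast
  then show "a * b \<in> int_eval \<phi> ` {F. Poly_Mapping.keys F \<subseteq> H}"
    using F(2) G(2) by (intro image_eqI[of _ _ "F * G"]) (auto simp: int_eval_mult hom)
qed

locale group_ring_embedding =
  fixes \<iota> :: "('p::ab_group_add \<Rightarrow>\<^sub>0 int) \<Rightarrow> 'f::field"
  assumes embedding: "ring_embedding \<iota>"
begin

lemma \<iota>_one: "\<iota> 1 = 1" and \<iota>_add: "\<iota> (a + b) = \<iota> a + \<iota> b" and \<iota>_mult: "\<iota> (a * b) = \<iota> a * \<iota> b"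
  and \<iota>_inj: "inj \<iota>"
  using embedding by (auto simp: ring_embedding_def)

lemma \<iota>_zero: "\<iota> 0 = 0" using \<iota>_add[of 0 0] by (metis add.right_neutral add_left_cancel)

lemma \<iota>_diff: "\<iota> (a - b) = \<iota> a - \<iota> b"
  using \<iota>_add[of "a - b" b] by (simp add: algebra_simps)

lemma subring_range: "is_subring (range \<iota>)"
  by (rule is_subringI) (auto simp flip: \<iota>_one \<iota>_diff \<iota>_mult)

lemma \<iota>_single: "\<iota> (Poly_Mapping.single p n) = of_int n * grp \<iota> p"
proof -
  have nat: "\<iota> (Poly_Mapping.single p (int k)) = of_nat k * grp \<iota> p" for k
    by (induction k) (simp_all add: \<iota>_zero single_add \<iota>_add grp_def algebra_simps)
  obtain a b where n: "n = int a - int b" by (rule int_diff_cases)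
  show ?thesis unfolding n single_diff \<iota>_diff nat by (simp add: algebra_simps)
qed

lemma grp_add: "grp \<iota> (p + q) = grp \<iota> p * grp \<iota> q"
  by (simp add: grp_def mult_single flip: \<iota>_mult)

lemma grp_zero: "grp \<iota> 0 = 1"
  by (simp add: grp_def \<iota>_one)

lemma grp_nonzero: "grp \<iota> p \<noteq> 0"
  using grp_add[of p "- p"] grp_zero by auto

lemma grp_minus: "grp \<iota> (- p) = inverse (grp \<iota> p)"
  using grp_add[of p "- p"] grp_zero grp_nonzero[of p] by (simp add: field_simps)

lemma grp_diff: "grp \<iota> (p - q) = grp \<iota> p / grp \<iota> q"
  using grp_add[of p "- q"] by (simp add: grp_minus divide_inverse)

lemma grp_in_range: "grp \<iota> p \<in> range \<iota>"
  by (simp add: grp_def)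

context
  fixes x :: "'n::finite \<Rightarrow> 'f"
  assumes x_nonzero: "\<And>i. x i \<noteq> 0"
begin

lemma monomial_add: "monomial \<iota> x (g + h) = monomial \<iota> x g * monomial \<iota> x h"
  by (simp add: monomial_def grp_add power_int_add x_nonzero prod.distrib)

lemma monomial_zero: "monomial \<iota> x 0 = 1"
  by (simp add: monomial_def grp_zero)

lemma monomial_nonzero: "monomial \<iota> x g \<noteq> 0"
  by (simp add: monomial_def grp_nonzero x_nonzero)

lemma monomial_minus: "monomial \<iota> x (- g) = inverse (monomial \<iota> x g)"
  using monomial_add[of g "- g"] monomial_zero monomial_nonzero[of g] by (simp add: field_simps)

lemma monomial_int_multiple_nat: "monomial \<iota> x (int_multiple (int n) g) = monomial \<iota> x g ^ n"
  by (induction n) (simp_all add: int_multiple_0 int_multiple_add int_multiple_1 monomial_zero monomial_add)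

lemma monomial_laurent_off:
  assumes "g \<in> vanishing J"
  shows "monomial \<iota> x g \<in> laurent_off \<iota> x J"
proof -
  have "x i powi snd g i \<in> laurent_off \<iota> x J" for i
    using assms laurent_off_base[where \<iota>=\<iota> and x=x and J=J] subring_laurent_off[of \<iota> x J]
    by (cases "i \<in> J") (auto simp: vanishing_def intro: subring_powi subring_one)
  then show ?thesis
    unfolding monomial_def grp_def
    by (intro subring_mult subring_prod subring_laurent_off laurent_off_base)
qed

text \<open>
  The Laurent rings are images of group rings. This makes the results on binomials in group rings
  applicable to exchange polynomials.
\<close>

lemma laurent_off_eq_int_eval:
  "laurent_off \<iota> x J = int_eval (monomial \<iota> x) ` {F. Poly_Mapping.keys F \<subseteq> vanishing J}"
proof
  let ?I = "int_eval (monomial \<iota> x) ` {F. Poly_Mapping.keys F \<subseteq> vanishing J}"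
  have sub: "is_subring ?I"
    by (rule subring_int_eval_image) (auto simp: monomial_add monomial_zero vanishing_group)
  have mon: "monomial \<iota> x g \<in> ?I" if "g \<in> vanishing J" for g
    using that by (intro image_eqI[of _ _ "mon g"]) (auto simp: int_eval_single)
  show "laurent_off \<iota> x J \<subseteq> ?I"
  proof (rule laurent_off_least[OF sub])
    show "range \<iota> \<subseteq> ?I"
    proof
      fix y assume "y \<in> range \<iota>"
      then obtain a where "y = \<iota> a" by auto
      moreover have "\<iota> a \<in> ?I"
      proof (induction a rule: poly_mapping_single_induct)
        case zero
        show ?case using subring_zero[OF sub] by (simp add: \<iota>_zero)
      next
        case (add F p n)
        have "monomial \<iota> x (p, 0) \<in> ?I" by (rule mon) (simp add: vanishing_def)
        then have "of_int n * grp \<iota> p \<in> ?I"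
          using subring_mult[OF sub subring_of_int[OF sub, of n]] by (simp add: monomial_def)
        then show ?case using add subring_add[OF sub] by (simp add: \<iota>_add \<iota>_single)
      qed
      ultimately show "y \<in> ?I" by simp
    qed
    fix i assume i: "i \<notin> J"
    have pow: "monomial \<iota> x (0, (\<lambda>_. 0)(i := s)) = x i powi s" for s
    proof -
      have "(\<Prod>l\<in>UNIV. x l powi ((\<lambda>_. 0)(i := s)) l) = (\<Prod>l\<in>UNIV. if l = i then x i powi s else 1)"
        by (intro prod.cong) auto
      then show ?thesis by (simp add: monomial_def grp_zero)
    qed
    have "monomial \<iota> x (0, (\<lambda>_. 0)(i := s)) \<in> ?I" for s
      using i by (intro mon) (auto simp: vanishing_def)
    from this[of 1] this[of "-1"] show "x i \<in> ?I \<and> inverse (x i) \<in> ?I"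
      unfolding pow by (simp add: power_int_minus)
  qed
  have "int_eval (monomial \<iota> x) F \<in> laurent_off \<iota> x J" if "Poly_Mapping.keys F \<subseteq> vanishing J" for F
    unfolding int_eval_def using that
    by (intro subring_sum subring_mult subring_of_int subring_laurent_off monomial_laurent_off) auto
  then show "?I \<subseteq> laurent_off \<iota> x J" by auto
qed

lemma laurent_polynomials_eq: "laurent_polynomials (range \<iota>) x = laurent_off \<iota> x {}"
proof
  let ?\<mu> = "\<lambda>e. \<Prod>i\<in>UNIV. x i powi e i"
  let ?L = "laurent_off \<iota> x {}"
  have "?\<mu> e \<in> ?L" for e
    using laurent_off_base[where \<iota>=\<iota> and x=x and J="{}"] by (intro subring_prod subring_powi subring_laurent_off) auto
  moreover have "range \<iota> \<subseteq> ?L" using laurent_off_base(1) by auto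
  ultimately show "laurent_polynomials (range \<iota>) x \<subseteq> ?L"
    unfolding laurent_polynomials_def
    by (auto simp: image_subset_iff intro!: subring_sum[OF subring_laurent_off] subring_mult[OF subring_laurent_off])
  have "?L \<subseteq> add_span {a * ?\<mu> e | a e. a \<in> range \<iota>}"
    unfolding laurent_off_def
  proof (rule ring_hull_subset_add_span)
    let ?X = "{a * ?\<mu> e | a e. a \<in> range \<iota>}"
    have one: "1 \<in> range \<iota>" by (metis \<iota>_one rangeI)
    show "1 \<in> ?X" using one by (intro CollectI exI[of _ 1] exI[of _ "\<lambda>_. 0"]) auto
    fix a b assume "a \<in> ?X" "b \<in> ?X"
    then obtain r e s f where "r \<in> range \<iota>" "s \<in> range \<iota>" "a = r * ?\<mu> e" "b = s * ?\<mu> f" by blast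
    moreover have "?\<mu> e * ?\<mu> f = ?\<mu> (\<lambda>i. e i + f i)"
      by (simp add: power_int_add x_nonzero prod.distrib)
    ultimately have "a * b = (r * s) * ?\<mu> (\<lambda>i. e i + f i)" "r * s \<in> range \<iota>"
      using subring_mult[OF subring_range] by (auto simp: algebra_simps)
    then show "a * b \<in> ?X"
      by (intro CollectI exI[of _ "r * s"] exI[of _ "\<lambda>i. e i + f i"] conjI)
  next
    let ?X = "{a * ?\<mu> e | a e. a \<in> range \<iota>}"
    have one: "1 \<in> range \<iota>" by (metis \<iota>_one rangeI)
    have "\<iota> a \<in> ?X" for a by (intro CollectI exI[of _ "\<iota> a"] exI[of _ "\<lambda>_. 0"]) auto
    moreover have "x i powi s \<in> ?X" for i s
    proof -
      have "?\<mu> ((\<lambda>_. 0)(i := s)) = (\<Prod>l\<in>UNIV. if l = i then x i powi s else 1)"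
        by (intro prod.cong) auto
      then show ?thesis using one by (intro CollectI exI[of _ 1] exI[of _ "(\<lambda>_. 0)(i := s)"]) auto
    qed
    from this[of _ 1] this[of _ "-1"] have "x i \<in> ?X" "inverse (x i) \<in> ?X" for i
      by (auto simp only: power_int_1_right power_int_minus)
    ultimately show "range \<iota> \<union> (\<Union>i\<in>- {}. {x i, inverse (x i)}) \<subseteq> ?X" by blast
  qed
  then show "?L \<subseteq> laurent_polynomials (range \<iota>) x"
    using finite_sums_subring[OF subring_range, of _ ?\<mu>] unfolding laurent_polynomials_def by blast
qed

end

lemma ring_hull_subset_polynomials: "ring_hull (range \<iota> \<union> range x) \<subseteq> polynomials (range \<iota>) x"
  for x :: "'n::finite \<Rightarrow> 'f"
proof -
  let ?\<mu> = "\<lambda>e :: 'n \<Rightarrow> nat. \<Prod>i\<in>UNIV. x i ^ e i"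
  let ?X = "{a * ?\<mu> e | a e. a \<in> range \<iota>}"
  have one: "1 \<in> range \<iota>" by (metis \<iota>_one rangeI)
  have "ring_hull (range \<iota> \<union> range x) \<subseteq> add_span ?X"
  proof (rule ring_hull_subset_add_span)
    show "1 \<in> ?X" using one by (intro CollectI exI[of _ 1] exI[of _ "\<lambda>_. 0"]) auto
    fix a b assume "a \<in> ?X" "b \<in> ?X"
    then obtain r e s f where "r \<in> range \<iota>" "s \<in> range \<iota>" "a = r * ?\<mu> e" "b = s * ?\<mu> f" by blast
    moreover have "?\<mu> e * ?\<mu> f = ?\<mu> (\<lambda>i. e i + f i)"
      by (simp add: power_add prod.distrib)
    ultimately have "a * b = (r * s) * ?\<mu> (\<lambda>i. e i + f i)" "r * s \<in> range \<iota>"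
      using subring_mult[OF subring_range] by (auto simp: algebra_simps)
    then show "a * b \<in> ?X"
      by (intro CollectI exI[of _ "r * s"] exI[of _ "\<lambda>i. e i + f i"] conjI)
  next
    have "\<iota> a \<in> ?X" for a by (intro CollectI exI[of _ "\<iota> a"] exI[of _ "\<lambda>_. 0"]) auto
    moreover have "x i \<in> ?X" for i
    proof -
      have "?\<mu> ((\<lambda>_. 0)(i := 1)) = (\<Prod>l\<in>UNIV. if l = i then x i else 1)"
        by (intro prod.cong) auto
      then show ?thesis using one by (intro CollectI exI[of _ 1] exI[of _ "(\<lambda>_. 0)(i := 1)"]) auto
    qed
    ultimately show "range \<iota> \<union> range x \<subseteq> ?X" by blast
  qed
  then show ?thesis
    using finite_sums_subring[OF subring_range, of _ ?\<mu>] unfolding polynomials_def by blast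
qed

end

lemma sum_dvd_odd_power_sum:
  assumes S: "is_subring S" and XY: "X \<in> S" "Y \<in> S" and n: "odd n"
  shows "\<exists>q\<in>S. X ^ n + Y ^ n = (X + Y) * (q :: 'f::comm_ring_1)"
proof -
  obtain k where "n = 2 * k + 1" using n by (auto elim: oddE)
  moreover have "\<exists>q\<in>S. X ^ (2 * k + 1) + Y ^ (2 * k + 1) = (X + Y) * q"
  proof (induction k)
    case 0
    show ?case using subring_one[OF S] by (intro bexI[of _ 1]) auto
  next
    case (Suc k)
    then obtain q where q: "q \<in> S" "X ^ (2 * k + 1) + Y ^ (2 * k + 1) = (X + Y) * q" by auto
    have "X ^ (2 * Suc k + 1) + Y ^ (2 * Suc k + 1)
        = X ^ 2 * (X ^ (2 * k + 1) + Y ^ (2 * k + 1)) + Y ^ (2 * k + 1) * (Y - X) * (X + Y)"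
      by (simp add: power2_eq_square algebra_simps)
    also have "\<dots> = (X + Y) * (X ^ 2 * q + Y ^ (2 * k + 1) * (Y - X))"
      unfolding q(2) by (simp add: algebra_simps)
    finally show ?case
      using XY q(1) by (intro bexI[of _ "X ^ 2 * q + Y ^ (2 * k + 1) * (Y - X)"])
        (auto intro!: subring_intros[OF S])
  qed
  ultimately show ?thesis by simp
qed

lemma fst_int_multiple: "fst (int_multiple m g) = int_multiple m (fst g)"
  and snd_int_multiple: "snd (int_multiple m g) = int_multiple m (snd g)"
  by (simp_all add: int_multiple_def fst_sum snd_sum)

lemma int_multiple_fun: "int_multiple m f i = int_multiple m (f i)"
proof -
  have "(\<Sum>l<k. f) i = (\<Sum>l<k. f i)" for k :: nat by (induction k) auto
  then show ?thesis by (simp add: int_multiple_def)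
qed

lemma int_multiple_int: "int_multiple m (n::int) = m * n"
  by (cases "m \<ge> 0") (auto simp: int_multiple_def)

lemma int_multiple_exponents: "int_multiple m (f :: 'n \<Rightarrow> int) = (\<lambda>i. m * f i)"
  by (rule ext) (simp add: int_multiple_fun int_multiple_int)

lemma torsion_free_exponents:
  assumes "torsion_free TYPE('p::ab_group_add)"
  shows "torsion_free_type TYPE('p \<times> ('n \<Rightarrow> int))"
  unfolding torsion_free_type_def
proof (intro allI impI)
  fix m and g :: "'p \<times> ('n \<Rightarrow> int)"
  assume z: "int_multiple m g = 0"
  show "m = 0 \<or> g = 0"
  proof (rule disjCI)
    assume "g \<noteq> 0"
    show "m = 0"
    proof (rule ccontr)
      assume m: "m \<noteq> 0"
      have "int_multiple m (fst g) = 0" using z by (metis fst_int_multiple fst_zero)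
      then have "(\<Sum>i<nat \<bar>m\<bar>. fst g) = 0" using m by (cases "m > 0") (auto simp: int_multiple_def)
      then have "fst g = 0"
        using assms m unfolding torsion_free_def by (metis zero_less_abs_iff zero_less_nat_eq)
      moreover have "int_multiple m (snd g) = 0" using z by (metis snd_int_multiple snd_zero)
      then have "m * snd g i = 0" for i by (auto simp: int_multiple_exponents fun_eq_iff)
      then have "snd g = 0" using m by (simp add: fun_eq_iff)
      ultimately show False using \<open>g \<noteq> 0\<close> by (simp add: prod_eq_iff)
    qed
  qed
qed

locale cluster_embedding = group_ring_embedding \<iota>
  for \<iota> :: "('p::ab_group_add \<Rightarrow>\<^sub>0 int) \<Rightarrow> 'f::field" +
  fixes x :: "'n::finite \<Rightarrow> 'f"
  assumes generators: "free_generators (frac_subfield \<iota>) x"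
begin

lemma algebraically_independent:
  assumes "finite E" "c ` E \<subseteq> frac_subfield \<iota>" "(\<Sum>e\<in>E. c e * (\<Prod>i\<in>UNIV. x i ^ e i)) = 0" "e \<in> E"
  shows "c e = 0"
  using generators assms unfolding free_generators_def alg_independent_def by blast

lemma \<iota>_frac: "\<iota> a \<in> frac_subfield \<iota>"
  unfolding frac_subfield_def by (intro CollectI exI[of _ a] exI[of _ 1]) (simp add: \<iota>_one)

lemma x_nonzero: "x k \<noteq> 0"
proof
  assume "x k = 0"
  moreover have "(\<Prod>i\<in>UNIV. x i ^ ((\<lambda>_. 0)(k := 1)) i) = (\<Prod>i\<in>UNIV. if i = k then x k else 1)"
    by (intro prod.cong) auto
  ultimately show False
    using algebraically_independent[of "{(\<lambda>_. 0)(k := 1)}" "\<lambda>_. 1"] \<iota>_frac[of 1] by (simp add: \<iota>_one)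
qed

abbreviation "\<phi> \<equiv> monomial \<iota> x"
abbreviation "\<Phi> \<equiv> int_eval \<phi>"
abbreviation "L \<equiv> laurent_off \<iota> x"

lemmas \<phi>_add = monomial_add[of x, OF x_nonzero]
  and \<phi>_zero = monomial_zero[of x, OF x_nonzero]
  and \<phi>_minus = monomial_minus[of x, OF x_nonzero]
  and \<phi>_nonzero = monomial_nonzero[of x, OF x_nonzero]
  and \<phi>_int_multiple_nat = monomial_int_multiple_nat[of x, OF x_nonzero]
  and \<phi>_L = monomial_laurent_off[of x, OF x_nonzero]
  and L_eq = laurent_off_eq_int_eval[of x, OF x_nonzero]

lemma \<Phi>_mult: "\<Phi> (F * G) = \<Phi> F * \<Phi> G"
  by (rule int_eval_mult) (rule \<phi>_add)

lemma \<Phi>_mon: "\<Phi> (mon g) = \<phi> g"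
  by (simp add: int_eval_single)

lemma \<Phi>_one: "\<Phi> 1 = 1"
  using \<Phi>_mon[of 0] \<phi>_zero by simp

text \<open>
  Algebraic independence of the cluster over the fraction field of \<open>\<int>P\<close> means linear independence of all
  monomials over \<open>\<int>\<close>. To apply it, the exponents are made nonnegative and the terms of \<open>F\<close> are grouped by
  their exponents into elements \<open>C f\<close> of the coefficient ring.
\<close>

lemma \<Phi>_eq_0:
  assumes "\<Phi> F = 0"
  shows "F = 0"
proof (rule ccontr)
  assume "F \<noteq> 0"
  then obtain g0 where g0: "g0 \<in> Poly_Mapping.keys F" by (metis all_not_in_conv keys_eq_empty)
  define K where "K = Poly_Mapping.keys F"
  define N where "N = Max ((\<lambda>(g, i). nat \<bar>snd g i\<bar>) ` (K \<times> UNIV))"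
  have N: "nat \<bar>snd g i\<bar> \<le> N" if "g \<in> K" for g i
    unfolding N_def using that by (intro Max_ge) (auto simp: K_def intro!: rev_image_eqI[of "(g, i)"])
  \<comment> \<open>multiplying by a large monomial makes all exponents natural numbers\<close>
  define e where "e g = (\<lambda>i. nat (snd g i + int N))" for g :: "'p \<times> ('n \<Rightarrow> int)"
  have e: "int (e g i) = snd g i + int N" if "g \<in> K" for g i
    using N[OF that, of i] by (auto simp: e_def)
  define C where "C f = (\<Sum>g\<in>{g\<in>K. e g = f}. Poly_Mapping.single (fst g) (Poly_Mapping.lookup F g))" for f
  have \<iota>_sum: "\<iota> (sum h A) = (\<Sum>a\<in>A. \<iota> (h a))" for h and A :: "('p \<times> ('n \<Rightarrow> int)) set"
    by (induction A rule: infinite_finite_induct) (auto simp: \<iota>_zero \<iota>_add)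
  have "(\<Sum>f\<in>e ` K. \<iota> (C f) * (\<Prod>i\<in>UNIV. x i ^ f i))
      = (\<Sum>f\<in>e ` K. \<Sum>g\<in>{g\<in>K. e g = f}. of_int (Poly_Mapping.lookup F g) * grp \<iota> (fst g) * (\<Prod>i\<in>UNIV. x i ^ e g i))"
    unfolding C_def \<iota>_sum sum_distrib_right by (intro sum.cong) (auto simp: \<iota>_single)
  also have "\<dots> = (\<Sum>g\<in>K. of_int (Poly_Mapping.lookup F g) * grp \<iota> (fst g) * (\<Prod>i\<in>UNIV. x i ^ e g i))"
    by (rule sum.group) (auto simp: K_def)
  also have "\<dots> = (\<Sum>g\<in>K. of_int (Poly_Mapping.lookup F g) * \<phi> g * (\<Prod>i\<in>UNIV. x i ^ N))"
  proof (rule sum.cong[OF refl])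
    fix g assume g: "g \<in> K"
    have "x i ^ e g i = x i powi snd g i * x i ^ N" for i
      using e[OF g, of i] x_nonzero[of i] power_int_of_nat[of "x i" "e g i"]
      by (simp add: power_int_add)
    then show "of_int (Poly_Mapping.lookup F g) * grp \<iota> (fst g) * (\<Prod>i\<in>UNIV. x i ^ e g i)
        = of_int (Poly_Mapping.lookup F g) * \<phi> g * (\<Prod>i\<in>UNIV. x i ^ N)"
      by (simp add: monomial_def prod.distrib)
  qed
  also have "\<dots> = \<Phi> F * (\<Prod>i\<in>UNIV. x i ^ N)"
    by (simp add: int_eval_def K_def sum_distrib_right)
  finally have "(\<Sum>f\<in>e ` K. \<iota> (C f) * (\<Prod>i\<in>UNIV. x i ^ f i)) = 0" using assms by simp
  then have "\<iota> (C (e g0)) = 0"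
    using g0 \<iota>_frac
    by (intro algebraically_independent[of "e ` K" "\<lambda>f. \<iota> (C f)" "e g0"]) (auto simp: K_def)
  then have "C (e g0) = 0" using \<iota>_inj \<iota>_zero by (metis injD)
  moreover have "Poly_Mapping.lookup (C (e g0)) (fst g0)
      = (\<Sum>g\<in>{g\<in>K. e g = e g0}. if g = g0 then Poly_Mapping.lookup F g0 else 0)"
    unfolding C_def lookup_sum
  proof (rule sum.cong[OF refl])
    fix g assume "g \<in> {g \<in> K. e g = e g0}"
    then have g: "g \<in> K" "e g = e g0" by auto
    have "snd g i = snd g0 i" for i
      using e[OF g(1), of i] e[of g0 i] g(2) g0 by (simp add: K_def)
    then have "fst g = fst g0 \<longleftrightarrow> g = g0" by (auto simp: prod_eq_iff)
    then show "Poly_Mapping.lookup (Poly_Mapping.single (fst g) (Poly_Mapping.lookup F g)) (fst g0)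
        = (if g = g0 then Poly_Mapping.lookup F g0 else 0)"
      by (auto simp: lookup_single when_def)
  qed
  moreover have "\<dots> = Poly_Mapping.lookup F g0" using g0 by (simp add: K_def)
  ultimately show False using g0 by (simp add: in_keys_iff)
qed

lemma \<Phi>_inj: "\<Phi> F = \<Phi> G \<Longrightarrow> F = G"
  using \<Phi>_eq_0[of "F - G"] by (simp add: int_eval_diff)

text \<open>
  The sum of the coefficients is \<open>2\<close> on one side and \<open>1\<close>, \<open>-1\<close> or \<open>0\<close> on the other.
\<close>

lemma monomial_sum_not_unit:
  assumes "\<phi> g + \<phi> h = \<phi> k \<or> \<phi> g + \<phi> h = - \<phi> k \<or> \<phi> g + \<phi> h = 0"
  shows False
proof -
  let ?n = "int_eval (\<lambda>_ :: 'p \<times> ('n \<Rightarrow> int). 1 :: int)"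
  have "mon g + mon h = mon k \<or> mon g + mon h = - mon k \<or> mon g + mon h = 0"
    using assms \<Phi>_inj[of "mon g + mon h" "mon k"] \<Phi>_inj[of "mon g + mon h" "- mon k"]
      \<Phi>_inj[of "mon g + mon h" 0]
    by (auto simp: int_eval_add int_eval_uminus int_eval_zero \<Phi>_mon)
  then have "?n (mon g + mon h) = ?n (mon k) \<or> ?n (mon g + mon h) = ?n (- mon k) \<or> ?n (mon g + mon h) = ?n 0"
    by (elim disjE) simp_all
  then show False
    by (simp add: int_eval_add int_eval_uminus int_eval_zero int_eval_single)
qed

lemma \<phi>_variable: "\<phi> (0, (\<lambda>_. 0)(k := j)) = x k powi j"
proof -
  have "(\<Prod>l\<in>UNIV. x l powi ((\<lambda>_. 0)(k := j)) l) = (\<Prod>l\<in>UNIV. if l = k then x k powi j else 1)"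
    by (intro prod.cong) auto
  then show ?thesis by (simp add: monomial_def grp_zero)
qed

lemma laurent_free_variable: "laurent_free (L {k}) (x k)"
  unfolding laurent_free_def
proof (intro allI impI ballI)
  fix J :: "int set" and c j0
  assume "finite J \<and> c ` J \<subseteq> L {k} \<and> (\<Sum>j\<in>J. c j * x k powi j) = 0" and j0: "j0 \<in> J"
  then have J: "finite J" "\<And>j. j \<in> J \<Longrightarrow> c j \<in> L {k}" "(\<Sum>j\<in>J. c j * x k powi j) = 0" by auto
  have "\<exists>C. Poly_Mapping.keys C \<subseteq> vanishing {k} \<and> c j = \<Phi> C" if "j \<in> J" for j
    using J(2)[OF that] unfolding L_eq by auto
  then obtain C where C: "\<And>j. j \<in> J \<Longrightarrow> Poly_Mapping.keys (C j) \<subseteq> vanishing {k}" "\<And>j. j \<in> J \<Longrightarrow> c j = \<Phi> (C j)"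
    by metis
  define \<delta> where "\<delta> j = (0 :: 'p, (\<lambda>_. 0 :: int)(k := j))" for j
  have \<Phi>_sum: "\<Phi> (sum h A) = (\<Sum>a\<in>A. \<Phi> (h a))" for h and A :: "int set"
    by (induction A rule: infinite_finite_induct) (auto simp: int_eval_zero int_eval_add)
  have "\<Phi> (\<Sum>j\<in>J. mon (\<delta> j) * C j) = 0"
    using J(3) C(2) by (simp add: \<Phi>_sum \<Phi>_mult \<Phi>_mon \<delta>_def \<phi>_variable mult.commute)
  then have zero: "(\<Sum>j\<in>J. mon (\<delta> j) * C j) = 0" by (rule \<Phi>_eq_0)
  have "C j0 = 0"
  proof (rule ccontr)
    assume "C j0 \<noteq> 0"
    then obtain g where g: "g \<in> Poly_Mapping.keys (C j0)" by (metis all_not_in_conv keys_eq_empty)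
    have "Poly_Mapping.lookup (mon (\<delta> j) * C j) (g + \<delta> j0) = (if j = j0 then Poly_Mapping.lookup (C j0) g else 0)"
      if "j \<in> J" for j
    proof (cases "j = j0")
      case False
      have "snd g k = 0" using g C(1)[OF j0] by (auto simp: vanishing_def)
      then have "snd (g + \<delta> j0 - \<delta> j) k \<noteq> 0" using False by (simp add: \<delta>_def)
      then have "g + \<delta> j0 - \<delta> j \<notin> Poly_Mapping.keys (C j)" using C(1)[OF that] by (auto simp: vanishing_def)
      then show ?thesis using False by (simp add: lookup_mon_mult in_keys_iff)
    qed (simp add: lookup_mon_mult)
    then have "Poly_Mapping.lookup (\<Sum>j\<in>J. mon (\<delta> j) * C j) (g + \<delta> j0) = Poly_Mapping.lookup (C j0) g"
      using J(1) j0 by (simp add: lookup_sum)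
    then show False using g zero by (simp add: in_keys_iff)
  qed
  then show "c j0 = 0" using C(2)[OF j0] by (simp add: int_eval_zero)
qed

text \<open>
  The division takes place in the full group ring; the quotient is then restricted to the subgroup of
  monomials free of the variables indexed by \<open>J\<close>.
\<close>

lemma binomial_euclid_L:
  assumes tf: "torsion_free TYPE('p)"
    and no_root: "\<nexists>w s t. odd s \<and> odd t \<and> u = int_multiple s w \<and> v = int_multiple t w"
    and J: "u \<in> vanishing J" "v \<in> vanishing J" "a \<in> vanishing J" "b \<in> vanishing J"
    and z: "z \<in> L J" "q \<in> L J" and eq: "\<phi> a * (1 + \<phi> u) * z = \<phi> b * (1 + \<phi> v) * q"
  shows "\<exists>q'\<in>L J. z = \<phi> b * (1 + \<phi> v) * q'"
proof -
  obtain Z Q where Z: "Poly_Mapping.keys Z \<subseteq> vanishing J" "z = \<Phi> Z" and Q: "q = \<Phi> Q"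
    using z unfolding L_eq by auto
  have "\<phi> a * ((1 + \<phi> u) * z) = \<phi> a * ((1 + \<phi> v) * (\<phi> (b - a) * q))"
    using eq \<phi>_add[of "b - a" a] by (simp add: algebra_simps)
  then have "(1 + \<phi> u) * z = (1 + \<phi> v) * (\<phi> (b - a) * q)"
    using \<phi>_nonzero[of a] by (simp only: mult_cancel_left simp_thms)
  then have "\<Phi> ((1 + mon u) * Z) = \<Phi> ((1 + mon v) * (mon (b - a) * Q))"
    unfolding \<Phi>_mult int_eval_add \<Phi>_one \<Phi>_mon Z(2) Q .
  then have "(1 + mon u) * Z = (1 + mon v) * (mon (b - a) * Q)" by (rule \<Phi>_inj)
  then have "1 + mon v dvd (1 + mon u) * Z" by (rule dvdI)
  moreover have "\<nexists>w s t. odd s \<and> odd t \<and> v = int_multiple s w \<and> u = int_multiple t w" using no_root by blast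
  ultimately have "1 + mon v dvd Z" using binomial_euclid[OF torsion_free_exponents[OF tf]] by blast
  then obtain Y where Y: "Z = (1 + mon v) * Y" by auto
  \<comment> \<open>discarding the terms of the quotient outside the subgroup does no harm, as \<open>v\<close> lies in it\<close>
  define Y' where "Y' = (\<Sum>g\<in>Poly_Mapping.keys Y \<inter> vanishing J. Poly_Mapping.single g (Poly_Mapping.lookup Y g))"
  have Y': "Poly_Mapping.lookup Y' g = (if g \<in> vanishing J then Poly_Mapping.lookup Y g else 0)" for g
    by (auto simp: Y'_def lookup_sum lookup_single when_def in_keys_iff)
  have "Z = (1 + mon v) * Y'"
  proof (rule poly_mapping_eqI)
    fix g
    have *: "Poly_Mapping.lookup ((1 + mon v) * W) g = Poly_Mapping.lookup W g + Poly_Mapping.lookup W (g - v)" for W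
      by (simp add: distrib_right lookup_add lookup_mon_mult)
    have "g - v \<in> vanishing J \<longleftrightarrow> g \<in> vanishing J" using J(2) by (auto simp: vanishing_def)
    moreover have "g \<notin> vanishing J \<Longrightarrow> Poly_Mapping.lookup Z g = 0"
      using Z(1) by (meson in_keys_iff subsetD)
    ultimately show "Poly_Mapping.lookup Z g = Poly_Mapping.lookup ((1 + mon v) * Y') g"
      unfolding * Y' using *[of Y] Y by auto
  qed
  then have "z = (1 + \<phi> v) * \<Phi> Y'"
    unfolding Z(2) by (simp add: \<Phi>_mult int_eval_add \<Phi>_one \<Phi>_mon del: single_one)
  then have "z = \<phi> b * (1 + \<phi> v) * (\<phi> (- b) * \<Phi> Y')"
    using \<phi>_nonzero[of b] by (simp add: \<phi>_minus)
  moreover have "\<Phi> Y' \<in> L J"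
    unfolding L_eq using Y' by (intro image_eqI[of _ _ Y']) (auto simp: in_keys_iff split: if_splits)
  then have "\<phi> (- b) * \<Phi> Y' \<in> L J"
    using J by (intro subring_mult[OF subring_laurent_off] \<phi>_L vanishing_group)
  ultimately show ?thesis by blast
qed

end

lemma euclid_power:
  fixes P1 P2 :: "'f::field"
  assumes R: "is_subring R" and P: "P1 \<in> R" "P2 \<in> R" "P2 \<noteq> 0"
    and euclid: "\<And>z q. z \<in> R \<Longrightarrow> q \<in> R \<Longrightarrow> P1 * z = P2 * q \<Longrightarrow> \<exists>q'\<in>R. z = P2 * q'"
    and "z \<in> R" "q \<in> R" "P1 ^ m * z = P2 ^ j * q"
  shows "\<exists>q'\<in>R. z = P2 ^ j * q'"
proof -
  have one: "\<exists>q'\<in>R. z = P2 * q'" if "z \<in> R" "q \<in> R" "P1 ^ m * z = P2 * q" for z q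
    using that
  proof (induction m arbitrary: q)
    case (Suc m)
    have "P1 ^ m * z \<in> R" using Suc.prems P by (auto intro!: subring_intros[OF R])
    then obtain q' where "q' \<in> R" "P1 ^ m * z = P2 * q'"
      using euclid[of "P1 ^ m * z" q] Suc.prems by (auto simp: mult.assoc)
    then show ?case using Suc by blast
  qed auto
  show ?thesis
    using assms(6-8)
  proof (induction j arbitrary: z)
    case (Suc j)
    have "P2 ^ j * q \<in> R" using Suc.prems P by (auto intro!: subring_intros[OF R])
    then obtain q' where q': "q' \<in> R" "z = P2 * q'"
      using one[of z "P2 ^ j * q"] Suc.prems by (auto simp: mult.assoc)
    then have "P1 ^ m * q' = P2 ^ j * q" using Suc.prems(3) P(3) by simp
    then show ?case using Suc.IH[OF q'(1) Suc.prems(2)] q' by (auto simp: mult.assoc)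
  qed auto
qed

section \<open>Exchange polynomials and mutations\<close>

lemma sign_skew_symmetric_diagonal: "sign_skew_symmetric B \<Longrightarrow> B $ k $ k = 0"
  unfolding sign_skew_symmetric_def by (metis not_square_less_zero)

lemma mutation_term:
  "(\<bar>a\<bar> * c + a * \<bar>c\<bar>) div 2 = (if 0 < a \<and> 0 < c then a * c else if a < 0 \<and> c < 0 then - (a * c) else 0)"
  for a c :: int
  by (auto simp: abs_if)

lemma matrix_mutation_nth:
  "matrix_mutation k B $ i $ j = (if i = k \<or> j = k then - (B $ i $ j)
     else B $ i $ j + (if 0 < B $ i $ k \<and> 0 < B $ k $ j then B $ i $ k * B $ k $ j
       else if B $ i $ k < 0 \<and> B $ k $ j < 0 then - (B $ i $ k * B $ k $ j) else 0))"
  by (simp add: matrix_mutation_def mutation_term)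

lemma matrix_mutation_involutive: "matrix_mutation k (matrix_mutation k B) = B"
  by (simp add: vec_eq_iff matrix_mutation_nth)

lemma matrix_mutation_uminus: "matrix_mutation k (- B) = - matrix_mutation k B"
  by (simp add: vec_eq_iff matrix_mutation_nth)

text \<open>
  The \<open>j\<close>-th exchange polynomial is, up to a monomial, \<open>1 + u\<close>, where \<open>u\<close> is the monomial with these
  exponents and coefficient \<open>p\<^sub>j\<^sup>+ / p\<^sub>j\<^sup>-\<close>.
\<close>

definition exponents :: "int^'n^'n \<Rightarrow> 'n \<Rightarrow> 'n \<Rightarrow> int" where
  "exponents B j = (\<lambda>i. B $ i $ j)"

definition pos_part :: "('n \<Rightarrow> int) \<Rightarrow> 'n \<Rightarrow> int" where
  "pos_part e = (\<lambda>i. max 0 (e i))"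

definition neg_part :: "('n \<Rightarrow> int) \<Rightarrow> 'n \<Rightarrow> int" where
  "neg_part e = (\<lambda>i. max 0 (- e i))"

lemma max_0_mult: "0 \<le> n \<Longrightarrow> max 0 (n * c) = n * max 0 (c::int)"
  by (cases "c \<ge> 0") (auto simp: max_def mult_le_0_iff zero_le_mult_iff)

lemma monomial_cong:
  assumes "\<And>i. x i = x' i \<or> snd g i = 0"
  shows "monomial \<iota> x g = monomial \<iota> x' g"
proof -
  have "x i powi snd g i = x' i powi snd g i" for i using assms[of i] by auto
  then show ?thesis by (simp add: monomial_def)
qed

context group_ring_embedding
begin

lemma grp_inj: "grp \<iota> p = grp \<iota> q \<Longrightarrow> p = q"
proof -
  assume "grp \<iota> p = grp \<iota> q"
  then have "mon p = mon q" using \<iota>_inj by (simp add: grp_def inj_eq)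
  then have "Poly_Mapping.keys (mon p) = Poly_Mapping.keys (mon q)" by simp
  then show "p = q" by simp
qed

lemma grp_int_multiple_nat: "grp \<iota> (int_multiple (int n) p) = grp \<iota> p ^ n"
  by (induction n) (simp_all add: int_multiple_0 int_multiple_add int_multiple_1 grp_zero grp_add)

lemma exchange_poly_monomials:
  assumes "\<And>i. cluster \<Sigma> i \<noteq> 0"
  shows "exchange_poly \<iota> \<Sigma> j
    = monomial \<iota> (cluster \<Sigma>) (coeff_plus \<Sigma> j, pos_part (exponents (exchange_matrix \<Sigma>) j))
      + monomial \<iota> (cluster \<Sigma>) (coeff_minus \<Sigma> j, neg_part (exponents (exchange_matrix \<Sigma>) j))"
proof -
  have prod: "(\<Prod>i\<in>{i. 0 < e i}. cluster \<Sigma> i ^ nat (e i)) = (\<Prod>i\<in>UNIV. cluster \<Sigma> i powi max 0 (e i))" for e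
    by (rule prod.mono_neutral_cong_left) (auto simp: power_int_def max_def)
  show ?thesis
    using prod[of "exponents (exchange_matrix \<Sigma>) j"] prod[of "\<lambda>i. - exponents (exchange_matrix \<Sigma>) j i"]
    by (simp add: exchange_poly_def Let_def monomial_def pos_part_def neg_part_def exponents_def)
qed

lemma laurent_polynomials_two_variables:
  assumes z: "\<And>i. z i \<noteq> 0" and eq: "\<And>i. i \<noteq> k \<Longrightarrow> i \<noteq> j \<Longrightarrow> z i = x i" and "k \<noteq> j"
  shows "laurent_polynomials (range \<iota>) z = laurent_ext (laurent_ext (laurent_off \<iota> x {k, j}) (z k)) (z j)"
proof -
  have "laurent_off \<iota> x {k, j} = laurent_off \<iota> z {k, j}"
    by (rule laurent_off_cong) (use eq in auto)
  then have "laurent_ext (laurent_off \<iota> x {k, j}) (z k) = laurent_off \<iota> z ({k, j} - {k})"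
    using laurent_off_Diff[of k "{k, j}" \<iota> z] by simp
  also have "{k, j} - {k} = {j}" using \<open>k \<noteq> j\<close> by auto
  finally show ?thesis
    using laurent_off_Diff[of j "{j}" \<iota> z] by (simp add: laurent_polynomials_eq[OF z])
qed

end

context cluster_embedding
begin

lemma rank_two_L:
  assumes "k \<noteq> j" "P1 \<in> L {k}" "P2 \<in> L {j}" "P1 \<noteq> 0" "P2 \<noteq> 0"
  shows "rank_two (L {k, j}) (x k) (x j) P1 P2"
proof -
  have "{k, j} - {j} = {k}" "{k, j} - {k} = {j}" using \<open>k \<noteq> j\<close> by auto
  then have "laurent_ext (L {k, j}) (x j) = L {k}" "laurent_ext (L {k, j}) (x k) = L {j}"
    using laurent_off_Diff[of j "{k, j}" \<iota> x] laurent_off_Diff[of k "{k, j}" \<iota> x] by auto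
  then show ?thesis
    using assms by unfold_locales (auto simp: subring_laurent_off x_nonzero laurent_free_variable)
qed

lemma \<phi>_polynomial:
  assumes "\<And>i. snd g i \<ge> 0"
  shows "\<phi> g \<in> ring_hull (range \<iota> \<union> range x)"
proof -
  have "x i powi snd g i \<in> ring_hull (range \<iota> \<union> range x)" for i
    using assms[of i] by (auto simp: power_int_def intro!: subring_power[OF subring_ring_hull] intro: ring_hull.base)
  then show ?thesis
    unfolding monomial_def using grp_in_range
    by (intro subring_mult subring_prod subring_ring_hull) (auto intro: ring_hull.base)
qed

text \<open>
  With \<open>X\<close> and \<open>Y\<close> the two monomials whose quotient is the root, the binomial on the left is a
  coefficient times \<open>X ^ n + Y ^ n\<close>, where \<open>n = \<bar>s\<bar>\<close> is odd. The sign of \<open>s\<close> only decides which of its two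
  terms is which power. Splitting into positive and negative parts keeps everything polynomial.
\<close>

lemma odd_root_divides:
  assumes "odd s" and root: "(p - q, e) = int_multiple s (\<omega>, c)"
  shows "\<exists>r\<in>polynomials (range \<iota>) x. \<phi> (p, pos_part e) + \<phi> (q, neg_part e)
    = (\<phi> (0, neg_part c) + \<phi> (\<omega>, pos_part c)) * r"
proof -
  let ?S = "ring_hull (range \<iota> \<union> range x)"
  define n where "n = nat \<bar>s\<bar>"
  have n: "odd n" using \<open>odd s\<close> by (simp add: n_def even_nat_iff)
  have p: "p = q + int_multiple s \<omega>" using arg_cong[OF root, of fst] by (simp add: fst_int_multiple algebra_simps)
  have e: "e i = s * c i" for i using arg_cong[OF root, of snd] by (simp add: snd_int_multiple int_multiple_exponents)
  have XY: "\<phi> (0, neg_part c) \<in> ?S" "\<phi> (\<omega>, pos_part c) \<in> ?S"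
    by (auto intro!: \<phi>_polynomial simp: neg_part_def pos_part_def)
  obtain r where r: "r \<in> ?S" "\<phi> (0, neg_part c) ^ n + \<phi> (\<omega>, pos_part c) ^ n
      = (\<phi> (0, neg_part c) + \<phi> (\<omega>, pos_part c)) * r"
    using sum_dvd_odd_power_sum[OF subring_ring_hull XY n] by auto
  have power: "\<phi> (t, 0) * \<phi> g ^ n = \<phi> (t + int_multiple (int n) (fst g), \<lambda>i. int n * snd g i)" for t g
    unfolding \<phi>_int_multiple_nat[symmetric] \<phi>_add[symmetric]
    by (rule arg_cong[of _ _ \<phi>]) (auto simp: prod_eq_iff fst_int_multiple snd_int_multiple int_multiple_exponents)
  have "\<exists>t. \<phi> (p, pos_part e) + \<phi> (q, neg_part e)
      = \<phi> (t, 0) * (\<phi> (0, neg_part c) ^ n + \<phi> (\<omega>, pos_part c) ^ n)"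
  proof (cases "s \<ge> 0")
    case True
    then have s: "s = int n" by (simp add: n_def)
    have "pos_part e = (\<lambda>i. int n * pos_part c i)" "neg_part e = (\<lambda>i. int n * neg_part c i)"
      using max_0_mult[of "int n" "- c _"] by (auto simp: pos_part_def neg_part_def e s max_0_mult)
    then show ?thesis
      by (intro exI[of _ q]) (simp add: distrib_left power p s int_multiple_0_right add.commute)
  next
    case False
    then have s: "s = - int n" by (simp add: n_def)
    have "pos_part e = (\<lambda>i. int n * neg_part c i)" "neg_part e = (\<lambda>i. int n * pos_part c i)"
      using max_0_mult[of "int n" "- c _"] by (auto simp: pos_part_def neg_part_def e s max_0_mult)
    moreover have "q = p + int_multiple (int n) \<omega>" by (simp add: p s int_multiple_minus)
    ultimately show ?thesis
      by (intro exI[of _ p]) (simp add: distrib_left power int_multiple_0_right)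
  qed
  then obtain t where "\<phi> (p, pos_part e) + \<phi> (q, neg_part e)
      = (\<phi> (0, neg_part c) + \<phi> (\<omega>, pos_part c)) * (\<phi> (t, 0) * r)"
    unfolding r(2) by (auto simp: algebra_simps)
  moreover have "\<phi> (t, 0) * r \<in> ?S"
    using r(1) by (intro subring_mult[OF subring_ring_hull] \<phi>_polynomial) auto
  ultimately show ?thesis using ring_hull_subset_polynomials[of x] by blast
qed

text \<open>
  A common odd root would give the common divisor \<open>X + Y\<close> of the two exchange polynomials, and a sum of
  two monomials is never a coefficient up to sign.
\<close>

lemma coprime_no_common_odd_root:
  assumes coprime: "coprime_seed \<iota> \<Sigma>" and x: "cluster \<Sigma> = x" and "k \<noteq> j"
  shows "\<nexists>w s t. odd s \<and> odd t
    \<and> (coeff_plus \<Sigma> k - coeff_minus \<Sigma> k, exponents (exchange_matrix \<Sigma>) k) = int_multiple s w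
    \<and> (coeff_plus \<Sigma> j - coeff_minus \<Sigma> j, exponents (exchange_matrix \<Sigma>) j) = int_multiple t w"
proof
  assume "\<exists>w s t. odd s \<and> odd t
    \<and> (coeff_plus \<Sigma> k - coeff_minus \<Sigma> k, exponents (exchange_matrix \<Sigma>) k) = int_multiple s w
    \<and> (coeff_plus \<Sigma> j - coeff_minus \<Sigma> j, exponents (exchange_matrix \<Sigma>) j) = int_multiple t w"
  then obtain \<omega> c s t where st: "odd s" "odd t"
    and k: "(coeff_plus \<Sigma> k - coeff_minus \<Sigma> k, exponents (exchange_matrix \<Sigma>) k) = int_multiple s (\<omega>, c)"
    and j: "(coeff_plus \<Sigma> j - coeff_minus \<Sigma> j, exponents (exchange_matrix \<Sigma>) j) = int_multiple t (\<omega>, c)"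
    by (metis surj_pair)
  define d where "d = \<phi> (0, neg_part c) + \<phi> (\<omega>, pos_part c)"
  have x': "cluster \<Sigma> i \<noteq> 0" for i by (simp add: x x_nonzero)
  have "d \<in> ring_hull (range \<iota> \<union> range x)"
    unfolding d_def by (intro subring_add[OF subring_ring_hull] \<phi>_polynomial) (auto simp: neg_part_def pos_part_def)
  then have "d \<in> polynomials (range \<iota>) x" using ring_hull_subset_polynomials[of x] by blast
  moreover have "\<exists>q\<in>polynomials (range \<iota>) x. exchange_poly \<iota> \<Sigma> k = d * q"
    unfolding exchange_poly_monomials[OF x'] x d_def by (rule odd_root_divides[OF st(1) k])
  moreover have "\<exists>q\<in>polynomials (range \<iota>) x. exchange_poly \<iota> \<Sigma> j = d * q"
    unfolding exchange_poly_monomials[OF x'] x d_def by (rule odd_root_divides[OF st(2) j])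
  ultimately obtain p where "d = grp \<iota> p \<or> d = - grp \<iota> p"
    using coprime \<open>k \<noteq> j\<close> unfolding coprime_seed_def Let_def x by blast
  moreover have "grp \<iota> p = \<phi> (p, 0)" by (simp add: monomial_def)
  ultimately show False unfolding d_def using monomial_sum_not_unit by metis
qed

end

lemma laurent_ext_unit_multiple:
  assumes "c \<in> S" "inverse c \<in> S" "c \<noteq> 0"
  shows "laurent_ext S t \<subseteq> laurent_ext S (c * (t :: 'f::field))"
proof (rule laurent_ext_least[OF subring_laurent_ext])
  let ?L = "laurent_ext S (c * t)"
  show S: "S \<subseteq> ?L" by (rule laurent_ext_base)
  have "inverse c * (c * t) \<in> ?L" "c * inverse (c * t) \<in> ?L"
    using assms S laurent_ext_base(2,3)[of "c * t" S] by (auto intro!: subring_mult[OF subring_laurent_ext])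
  then show "t \<in> ?L" "inverse t \<in> ?L" using assms(3) by (auto simp: mult.assoc[symmetric])
qed

lemma ratio_inverse:
  assumes "A' / B' = c powi b * (A / B)"
  shows "B' / A' = c powi (- b) * (B / (A :: 'f::field))"
  using assms by (metis inverse_divide inverse_mult_distrib power_int_minus)

lemma seed_mutation_ratio:
  assumes "seed_mutation \<iota> k \<Sigma> \<Sigma>'" "i \<noteq> k"
  shows "exchange_matrix \<Sigma> $ k $ i \<ge> 0 \<Longrightarrow> grp \<iota> (coeff_plus \<Sigma>' i) / grp \<iota> (coeff_minus \<Sigma>' i)
      = grp \<iota> (coeff_plus \<Sigma> k) powi (exchange_matrix \<Sigma> $ k $ i)
        * (grp \<iota> (coeff_plus \<Sigma> i) / grp \<iota> (coeff_minus \<Sigma> i))"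
    and "exchange_matrix \<Sigma> $ k $ i \<le> 0 \<Longrightarrow> grp \<iota> (coeff_plus \<Sigma>' i) / grp \<iota> (coeff_minus \<Sigma>' i)
      = grp \<iota> (coeff_minus \<Sigma> k) powi (exchange_matrix \<Sigma> $ k $ i)
        * (grp \<iota> (coeff_plus \<Sigma> i) / grp \<iota> (coeff_minus \<Sigma> i))"
  using assms by (auto simp: seed_mutation_def Let_def)

lemma mutation_ne_zero:
  assumes "seed_mutation \<iota> k \<Sigma> \<Sigma>'" "ring_embedding \<iota>"
  shows "cluster \<Sigma> i \<noteq> 0" "cluster \<Sigma>' i \<noteq> 0"
proof -
  interpret S: cluster_embedding \<iota> "cluster \<Sigma>"
    using assms by unfold_locales (auto simp: seed_mutation_def is_seed_def)
  interpret S': cluster_embedding \<iota> "cluster \<Sigma>'"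
    using assms by unfold_locales (auto simp: seed_mutation_def is_seed_def)
  show "cluster \<Sigma> i \<noteq> 0" "cluster \<Sigma>' i \<noteq> 0" by (rule S.x_nonzero S'.x_nonzero)+
qed

text \<open>
  Since \<open>b\<^sub>k\<^sub>k = 0\<close>, the \<open>k\<close>-th exchange polynomial does not involve the exchanged variable, and the mutation
  merely swaps its two terms.
\<close>

lemma adjacent_cluster_mutation:
  assumes emb: "ring_embedding \<iota>" and mut: "seed_mutation \<iota> k \<Sigma> \<Sigma>'"
  shows "adjacent_cluster \<iota> \<Sigma>' k = cluster \<Sigma>"
proof -
  interpret group_ring_embedding \<iota> by unfold_locales (rule emb)
  note nz = mutation_ne_zero[OF mut emb]
  let ?B = "exchange_matrix \<Sigma>"
  have x': "cluster \<Sigma>' = (cluster \<Sigma>)(k := exchange_poly \<iota> \<Sigma> k / cluster \<Sigma> k)"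
    and B': "exchange_matrix \<Sigma>' = matrix_mutation k ?B"
    and coeff: "coeff_plus \<Sigma>' k = coeff_minus \<Sigma> k" "coeff_minus \<Sigma>' k = coeff_plus \<Sigma> k"
    and Bkk: "?B $ k $ k = 0"
    using mut sign_skew_symmetric_diagonal[of ?B k]
    by (auto simp: seed_mutation_def adjacent_cluster_def is_seed_def)
  have col: "pos_part (exponents (exchange_matrix \<Sigma>') k) = neg_part (exponents ?B k)"
    "neg_part (exponents (exchange_matrix \<Sigma>') k) = pos_part (exponents ?B k)"
    by (auto simp: pos_part_def neg_part_def exponents_def B' matrix_mutation_nth)
  have mono: "monomial \<iota> (cluster \<Sigma>') (p, pos_part (exponents ?B k)) = monomial \<iota> (cluster \<Sigma>) (p, pos_part (exponents ?B k))"
    "monomial \<iota> (cluster \<Sigma>') (p, neg_part (exponents ?B k)) = monomial \<iota> (cluster \<Sigma>) (p, neg_part (exponents ?B k))" for p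
    by (rule monomial_cong; simp add: x' pos_part_def neg_part_def exponents_def Bkk)+
  have "exchange_poly \<iota> \<Sigma>' k = exchange_poly \<iota> \<Sigma> k"
    unfolding exchange_poly_monomials[of \<Sigma>', OF nz(2)] exchange_poly_monomials[of \<Sigma>, OF nz(1)] col coeff mono
    by (rule add.commute)
  moreover have "exchange_poly \<iota> \<Sigma> k \<noteq> 0" using nz(2)[of k] by (auto simp: x')
  ultimately show ?thesis
    by (auto simp: adjacent_cluster_def fun_eq_iff x')
qed

lemma seed_mutation_symmetric:
  fixes \<iota> :: "('p::ab_group_add \<Rightarrow>\<^sub>0 int) \<Rightarrow> 'f::field"
  assumes emb: "ring_embedding \<iota>" and mut: "seed_mutation \<iota> k \<Sigma> \<Sigma>'"
  shows "seed_mutation \<iota> k \<Sigma>' \<Sigma>"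
proof -
  interpret group_ring_embedding \<iota> by unfold_locales (rule emb)
  have invert: "A = c powi (- b) * A'" if "A' = c powi b * A" "c \<noteq> 0" for A A' c :: 'f and b
    using that by (simp add: power_int_minus)
  have entry: "exchange_matrix \<Sigma>' $ k $ i = - (exchange_matrix \<Sigma> $ k $ i)" for i
    using mut by (simp add: seed_mutation_def matrix_mutation_nth)
  have coeff: "coeff_plus \<Sigma>' k = coeff_minus \<Sigma> k" "coeff_minus \<Sigma>' k = coeff_plus \<Sigma> k"
    using mut by (auto simp: seed_mutation_def)
  show ?thesis
    unfolding seed_mutation_def Let_def entry coeff
    using mut adjacent_cluster_mutation[OF emb mut]
    by (intro conjI allI impI invert[OF _ grp_nonzero] seed_mutation_ratio[OF mut])
       (auto simp: seed_mutation_def matrix_mutation_involutive)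
qed

text \<open>
  Exchanging \<open>p\<^sup>+\<close> with \<open>p\<^sup>-\<close> and replacing \<open>B\<close> by \<open>- B\<close> changes neither exchange polynomials nor upper bounds
  and commutes with mutation. This symmetry reduces the case \<open>b\<^sub>k\<^sub>j > 0\<close> to \<open>b\<^sub>k\<^sub>j < 0\<close>.
\<close>

definition opposite :: "('p, 'f, 'n::finite) seed \<Rightarrow> ('p, 'f, 'n) seed" where
  "opposite \<Sigma> = \<lparr>cluster = cluster \<Sigma>, coeff_plus = coeff_minus \<Sigma>, coeff_minus = coeff_plus \<Sigma>,
     exchange_matrix = - exchange_matrix \<Sigma>\<rparr>"

lemma opposite_simps [simp]:
  "cluster (opposite \<Sigma>) = cluster \<Sigma>"
  "coeff_plus (opposite \<Sigma>) = coeff_minus \<Sigma>"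
  "coeff_minus (opposite \<Sigma>) = coeff_plus \<Sigma>"
  "exchange_matrix (opposite \<Sigma>) = - exchange_matrix \<Sigma>"
  by (simp_all add: opposite_def)

lemma exchange_poly_opposite: "exchange_poly \<iota> (opposite \<Sigma>) = exchange_poly \<iota> \<Sigma>"
  by (rule ext) (simp add: exchange_poly_def Let_def add.commute)

lemma adjacent_cluster_opposite: "adjacent_cluster \<iota> (opposite \<Sigma>) = adjacent_cluster \<iota> \<Sigma>"
  by (rule ext) (simp add: adjacent_cluster_def exchange_poly_opposite)

lemma upper_bound_opposite: "upper_bound \<iota> (opposite \<Sigma>) = upper_bound \<iota> \<Sigma>"
  by (simp add: upper_bound_def adjacent_cluster_opposite)

lemma seed_mutation_opposite:
  assumes mut: "seed_mutation \<iota> k \<Sigma> \<Sigma>'"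
  shows "seed_mutation \<iota> k (opposite \<Sigma>) (opposite \<Sigma>')"
proof -
  have seed: "is_seed \<iota> (opposite S)" if "is_seed \<iota> S" for S
    using that by (simp add: is_seed_def sign_skew_symmetric_def)
  have "let b = - (exchange_matrix \<Sigma> $ k $ i);
          ratio = grp \<iota> (coeff_minus \<Sigma> i) / grp \<iota> (coeff_plus \<Sigma> i);
          ratio' = grp \<iota> (coeff_minus \<Sigma>' i) / grp \<iota> (coeff_plus \<Sigma>' i)
        in (b \<ge> 0 \<longrightarrow> ratio' = grp \<iota> (coeff_minus \<Sigma> k) powi b * ratio)
          \<and> (b \<le> 0 \<longrightarrow> ratio' = grp \<iota> (coeff_plus \<Sigma> k) powi b * ratio)" if "i \<noteq> k" for i
    unfolding Let_def
    by (intro conjI impI ratio_inverse seed_mutation_ratio[OF mut that]) auto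
  then show ?thesis
    using mut seed[of \<Sigma>] seed[of \<Sigma>'] unfolding seed_mutation_def adjacent_cluster_opposite
    by (simp add: matrix_mutation_uminus)
qed

section \<open>Invariance of the upper bound\<close>

text \<open>
  Here the exchange polynomials have the shape required by the two-variable result: \<open>x\<^sub>j\<close> occurs in one term
  of \<open>P\<^sub>k\<close>, with exponent \<open>c = b\<^sub>j\<^sub>k\<close>, and \<open>x\<^sub>k\<close> in one term of \<open>P\<^sub>j\<close>, with exponent \<open>b = - b\<^sub>k\<^sub>j\<close>. The mutation
  rules for the matrix and for the coefficients together say that the ratio of the two terms of the new
  \<open>P\<^sub>j\<close> arises from the old one by replacing \<open>x\<^sub>k\<close> with \<open>N / x\<^sub>k'\<close>, where \<open>N\<close> is the term of \<open>P\<^sub>k\<close> free of \<open>x\<^sub>j\<close>.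
\<close>

lemma connected_step:
  fixes \<Sigma> \<Sigma>' :: "('p::ab_group_add, 'f::field, 'n::finite) seed"
  assumes emb: "ring_embedding \<iota>" and mut: "seed_mutation \<iota> k \<Sigma> \<Sigma>'" and "k \<noteq> j"
    and neg: "exchange_matrix \<Sigma> $ k $ j < 0"
    and y: "y \<in> upper_bound \<iota> \<Sigma>"
  shows "y \<in> laurent_polynomials (range \<iota>) (adjacent_cluster \<iota> \<Sigma>' j)"
proof -
  define x where "x = cluster \<Sigma>"
  define x' where "x' = cluster \<Sigma>'"
  define B where "B = exchange_matrix \<Sigma>"
  define B' where "B' = exchange_matrix \<Sigma>'"
  interpret cluster_embedding \<iota> x
    using emb mut by unfold_locales (auto simp: seed_mutation_def is_seed_def x_def)
  interpret S': cluster_embedding \<iota> x'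
    using emb mut by unfold_locales (auto simp: seed_mutation_def is_seed_def x'_def)
  have skew: "sign_skew_symmetric B" and skew': "sign_skew_symmetric B'"
    and B': "B' = matrix_mutation k B"
    and x'_eq: "x' = x(k := exchange_poly \<iota> \<Sigma> k / x k)"
    using mut by (auto simp: seed_mutation_def is_seed_def adjacent_cluster_def B_def B'_def x_def x'_def)
  have diag: "B $ k $ k = 0" "B $ j $ j = 0" "B' $ j $ j = 0"
    using skew skew' by (auto intro: sign_skew_symmetric_diagonal)
  have Bkj: "B $ k $ j < 0" using neg by (simp add: B_def)
  then have Bjk: "B $ j $ k > 0"
    using skew unfolding sign_skew_symmetric_def by (metis less_irrefl mult_less_0_iff not_less_iff_gr_or_eq)
  have B'kj: "B' $ k $ j = - B $ k $ j" by (simp add: B' matrix_mutation_nth)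
  define R where "R = L {k, j}"
  define P1 where "P1 = exchange_poly \<iota> \<Sigma> k"
  define P2 where "P2 = exchange_poly \<iota> \<Sigma> j"
  define P2' where "P2' = exchange_poly \<iota> \<Sigma>' j"
  define x1' where "x1' = P1 / x k"
  have P1_sum: "P1 = \<phi> (coeff_plus \<Sigma> k, pos_part (exponents B k)) + \<phi> (coeff_minus \<Sigma> k, neg_part (exponents B k))"
    and P2_sum: "P2 = \<phi> (coeff_plus \<Sigma> j, pos_part (exponents B j)) + \<phi> (coeff_minus \<Sigma> j, neg_part (exponents B j))"
    and P2'_sum: "P2' = S'.\<phi> (coeff_plus \<Sigma>' j, pos_part (exponents B' j)) + S'.\<phi> (coeff_minus \<Sigma>' j, neg_part (exponents B' j))"
    using exchange_poly_monomials[of \<Sigma> k] exchange_poly_monomials[of \<Sigma> j] exchange_poly_monomials[of \<Sigma>' j]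
      x_nonzero S'.x_nonzero
    by (auto simp: P1_def P2_def P2'_def x_def x'_def B_def B'_def)
  have nz: "P1 \<noteq> 0" "P2 \<noteq> 0" "P2' \<noteq> 0"
    unfolding P1_sum P2_sum P2'_sum using monomial_sum_not_unit S'.monomial_sum_not_unit by blast+
  have x1': "x1' \<noteq> 0" using nz x_nonzero by (simp add: x1'_def)
  have L_mem: "P1 \<in> L {k}" "P2 \<in> L {j}"
    unfolding P1_sum P2_sum using diag
    by (auto intro!: subring_add[OF subring_laurent_off] \<phi>_L simp: vanishing_def pos_part_def neg_part_def exponents_def)
  interpret rank_two R "x k" "x j" P1 P2
    unfolding R_def by (rule rank_two_L[OF \<open>k \<noteq> j\<close> L_mem nz(1,2)])
  define b where "b = nat (- B $ k $ j)"
  define c where "c = nat (B $ j $ k)"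
  have bc: "b \<ge> 1" "c \<ge> 1" using Bkj Bjk by (auto simp: b_def c_def)
  have b: "int b = - B $ k $ j" using Bkj by (simp add: b_def)
  define M where "M = \<phi> (coeff_plus \<Sigma> k, (pos_part (exponents B k))(j := 0))"
  define N where "N = \<phi> (coeff_minus \<Sigma> k, neg_part (exponents B k))"
  define m where "m = \<phi> (coeff_minus \<Sigma> j, (neg_part (exponents B j))(k := 0))"
  define \<alpha> where "\<alpha> = \<phi> (coeff_plus \<Sigma> j - coeff_minus \<Sigma> j, (exponents B j)(k := 0))"
  define m' where "m' = \<phi> (coeff_minus \<Sigma>' j, neg_part (exponents B' j))"
  have R_unit: "\<phi> g \<in> R" "inverse (\<phi> g) \<in> R" if "g \<in> vanishing {k, j}" for g
    unfolding R_def \<phi>_minus[symmetric] using that by (auto intro!: \<phi>_L vanishing_group)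
  have unit: "M \<in> R" "N \<in> R" "inverse N \<in> R" "m \<in> R" "inverse m \<in> R" "\<alpha> \<in> R" "inverse \<alpha> \<in> R"
      "m' \<in> R" "inverse m' \<in> R"
    unfolding M_def N_def m_def \<alpha>_def m'_def
    using diag Bkj Bjk B'kj \<open>k \<noteq> j\<close>
    by (auto intro!: R_unit simp: vanishing_def pos_part_def neg_part_def exponents_def)
  have unit_nz: "N \<noteq> 0" "m \<noteq> 0" "\<alpha> \<noteq> 0" "m' \<noteq> 0"
    unfolding N_def m_def \<alpha>_def m'_def by (rule \<phi>_nonzero)+
  have P1_eq: "P1 = N + M * x j ^ c"
  proof -
    have "x j ^ c = \<phi> (0, (\<lambda>_. 0)(j := B $ j $ k))"
      unfolding \<phi>_variable using Bjk by (simp add: c_def power_int_def)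
    then have "M * x j ^ c = \<phi> ((coeff_plus \<Sigma> k, (pos_part (exponents B k))(j := 0)) + (0, (\<lambda>_. 0)(j := B $ j $ k)))"
      unfolding \<phi>_add by (simp add: M_def)
    also have "(coeff_plus \<Sigma> k, (pos_part (exponents B k))(j := 0)) + (0, (\<lambda>_. 0)(j := B $ j $ k))
        = (coeff_plus \<Sigma> k, pos_part (exponents B k))"
      using Bjk by (auto simp: prod_eq_iff fun_eq_iff pos_part_def exponents_def)
    finally show ?thesis by (simp add: P1_sum N_def add.commute)
  qed
  have P2_eq: "P2 = m * (\<alpha> + x k ^ b)"
  proof -
    have "x k ^ b = \<phi> (0, (\<lambda>_. 0)(k := - B $ k $ j))"
      unfolding \<phi>_variable using Bkj by (simp add: b_def power_int_def)
    then have "m * x k ^ b = \<phi> ((coeff_minus \<Sigma> j, (neg_part (exponents B j))(k := 0)) + (0, (\<lambda>_. 0)(k := - B $ k $ j)))"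
      unfolding \<phi>_add by (simp add: m_def)
    also have "(coeff_minus \<Sigma> j, (neg_part (exponents B j))(k := 0)) + (0, (\<lambda>_. 0)(k := - B $ k $ j))
        = (coeff_minus \<Sigma> j, neg_part (exponents B j))"
      using Bkj by (auto simp: prod_eq_iff fun_eq_iff neg_part_def exponents_def)
    finally have "m * x k ^ b = \<phi> (coeff_minus \<Sigma> j, neg_part (exponents B j))" .
    moreover have "m * \<alpha> = \<phi> (coeff_plus \<Sigma> j, pos_part (exponents B j))"
      unfolding m_def \<alpha>_def \<phi>_add[symmetric] using Bkj
      by (intro arg_cong[of _ _ \<phi>]) (auto simp: prod_eq_iff fun_eq_iff pos_part_def neg_part_def exponents_def)
    ultimately show ?thesis by (simp add: P2_sum distrib_left)
  qed
  have P2'_eq: "P2' = m' * (1 + \<alpha> * inverse N ^ b * x1' ^ b)"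
  proof -
    define u where "u = (coeff_plus \<Sigma>' j - coeff_minus \<Sigma>' j, (exponents B' j)(k := 0))"
    have agree: "S'.\<phi> g = \<phi> g" if "snd g k = 0" for g
      using that by (intro monomial_cong) (auto simp: x'_eq)
    have m'_eq: "m' = S'.\<phi> (coeff_minus \<Sigma>' j, neg_part (exponents B' j))"
      unfolding m'_def using Bkj B'kj by (intro agree[symmetric]) (simp add: neg_part_def exponents_def)
    have "grp \<iota> (coeff_plus \<Sigma>' j - coeff_minus \<Sigma>' j)
        = grp \<iota> (coeff_minus \<Sigma> k) powi (- int b) * grp \<iota> (coeff_plus \<Sigma> j - coeff_minus \<Sigma> j)"
      using seed_mutation_ratio(2)[OF mut, of j] \<open>k \<noteq> j\<close> neg b by (simp add: grp_diff B_def)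
    also have "\<dots> = grp \<iota> (coeff_plus \<Sigma> j - coeff_minus \<Sigma> j - int_multiple (int b) (coeff_minus \<Sigma> k))"
      by (simp add: grp_diff[of "_ - _"] grp_int_multiple_nat power_int_minus divide_inverse mult.commute)
    finally have coeff: "coeff_plus \<Sigma>' j - coeff_minus \<Sigma>' j
        = coeff_plus \<Sigma> j - coeff_minus \<Sigma> j - int_multiple (int b) (coeff_minus \<Sigma> k)" by (rule grp_inj)
    have "(exponents B' j)(k := 0) = (\<lambda>i. ((exponents B j)(k := 0)) i - int b * neg_part (exponents B k) i)"
      using Bkj b diag by (auto simp: fun_eq_iff exponents_def neg_part_def B' matrix_mutation_nth max_def)
    then have "u = (coeff_plus \<Sigma> j - coeff_minus \<Sigma> j, (exponents B j)(k := 0))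
        + - int_multiple (int b) (coeff_minus \<Sigma> k, neg_part (exponents B k))"
      unfolding u_def coeff by (auto simp: prod_eq_iff fst_int_multiple snd_int_multiple int_multiple_exponents)
    then have "\<phi> u = \<alpha> * inverse N ^ b"
      by (simp only: \<phi>_add \<phi>_minus \<phi>_int_multiple_nat \<alpha>_def N_def power_inverse)
    moreover have "S'.\<phi> u = \<phi> u" by (rule agree) (simp add: u_def)
    moreover have "x' k powi int b = S'.\<phi> (0, (\<lambda>_. 0)(k := int b))" by (simp only: S'.\<phi>_variable)
    then have "x1' ^ b = S'.\<phi> (0, (\<lambda>_. 0)(k := int b))"
      by (simp add: x'_eq x1'_def P1_def)
    ultimately have "m' * (\<alpha> * inverse N ^ b * x1' ^ b)
        = S'.\<phi> ((coeff_minus \<Sigma>' j, neg_part (exponents B' j)) + u + (0, (\<lambda>_. 0)(k := int b)))"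
      by (simp only: m'_eq S'.\<phi>_add mult.assoc)
    also have "(coeff_minus \<Sigma>' j, neg_part (exponents B' j)) + u + (0, (\<lambda>_. 0)(k := int b))
        = (coeff_plus \<Sigma>' j, pos_part (exponents B' j))"
      using b B'kj Bkj by (auto simp: u_def prod_eq_iff fun_eq_iff pos_part_def neg_part_def exponents_def)
    finally show ?thesis by (simp add: P2'_sum m'_eq distrib_left)
  qed
  have mem: "y \<in> laurent_polynomials (range \<iota>) x" "\<And>i. y \<in> laurent_polynomials (range \<iota>) (adjacent_cluster \<iota> \<Sigma> i)"
    using y by (auto simp: upper_bound_def x_def)
  have "y \<in> laurent_ext (laurent_ext R (x k)) (x j)"
    using mem(1) laurent_polynomials_two_variables[of x k j x] x_nonzero \<open>k \<noteq> j\<close> by (simp add: R_def)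
  moreover have "y \<in> laurent_ext (laurent_ext R (x j)) x1'"
    using mem(2)[of k] laurent_polynomials_two_variables[of "x(k := x1')" j k x] x_nonzero x1' \<open>k \<noteq> j\<close>
    by (simp add: R_def adjacent_cluster_def x1'_def P1_def x_def[symmetric] insert_commute)
  moreover have "y \<in> laurent_ext (laurent_ext R (x k)) (P2 / x j)"
    using mem(2)[of j] laurent_polynomials_two_variables[of "x(j := P2 / x j)" k j x] x_nonzero nz \<open>k \<noteq> j\<close>
    by (simp add: R_def adjacent_cluster_def P2_def x_def[symmetric])
  ultimately have "y \<in> laurent_ext (laurent_ext R x1') (P2' / x j)"
    using upper_bound_connected[of \<alpha> m m' M N b c y, folded x1'_def, folded P2'_eq] unit unit_nz bc P1_eq P2_eq nz
    by blast
  moreover have "adjacent_cluster \<iota> \<Sigma>' j = x(k := x1', j := P2' / x j)"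
    using \<open>k \<noteq> j\<close> by (auto simp: adjacent_cluster_def P2'_def x'_def[symmetric] x'_eq x1'_def P1_def)
  ultimately show ?thesis
    using laurent_polynomials_two_variables[of "x(k := x1', j := P2' / x j)" k j x] x_nonzero x1' nz \<open>k \<noteq> j\<close>
    by (simp add: R_def)
qed

text \<open>
  When \<open>b\<^sub>k\<^sub>j = 0\<close>, neither \<open>P\<^sub>k\<close> nor \<open>P\<^sub>j\<close> involves \<open>x\<^sub>k\<close> or \<open>x\<^sub>j\<close>. This is the step that uses coprimality: it
  excludes a common odd root of the two binomials, so that divisibility by one can be tested after
  multiplication by the other.
\<close>

lemma disconnected_step:
  fixes \<Sigma> \<Sigma>' :: "('p::ab_group_add, 'f::field, 'n::finite) seed"
  assumes emb: "ring_embedding \<iota>" and tf: "torsion_free TYPE('p)"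
    and mut: "seed_mutation \<iota> k \<Sigma> \<Sigma>'" and coprime: "coprime_seed \<iota> \<Sigma>" and "k \<noteq> j"
    and zero: "exchange_matrix \<Sigma> $ k $ j = 0"
    and y: "y \<in> upper_bound \<iota> \<Sigma>"
  shows "y \<in> laurent_polynomials (range \<iota>) (adjacent_cluster \<iota> \<Sigma>' j)"
proof -
  define x where "x = cluster \<Sigma>"
  define x' where "x' = cluster \<Sigma>'"
  define B where "B = exchange_matrix \<Sigma>"
  define B' where "B' = exchange_matrix \<Sigma>'"
  interpret cluster_embedding \<iota> x
    using emb mut by unfold_locales (auto simp: seed_mutation_def is_seed_def x_def)
  interpret S': cluster_embedding \<iota> x'
    using emb mut by unfold_locales (auto simp: seed_mutation_def is_seed_def x'_def)
  have skew: "sign_skew_symmetric B"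
    and B': "B' = matrix_mutation k B"
    and x'_eq: "x' = x(k := exchange_poly \<iota> \<Sigma> k / x k)"
    using mut by (auto simp: seed_mutation_def is_seed_def adjacent_cluster_def B_def B'_def x_def x'_def)
  have entries: "B $ k $ k = 0" "B $ j $ j = 0" "B $ k $ j = 0"
    using skew zero by (auto intro: sign_skew_symmetric_diagonal simp: B_def)
  then have "B $ j $ k = 0"
    using skew unfolding sign_skew_symmetric_def by (metis less_irrefl mult_zero_left)
  note entries = entries this
  have col: "exponents B' j = exponents B j"
    using entries \<open>k \<noteq> j\<close> by (auto simp: fun_eq_iff exponents_def B' matrix_mutation_nth)
  define R where "R = L {k, j}"
  have sR: "is_subring R" by (simp add: R_def subring_laurent_off)
  define P1 where "P1 = exchange_poly \<iota> \<Sigma> k"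
  define P2 where "P2 = exchange_poly \<iota> \<Sigma> j"
  define P2' where "P2' = exchange_poly \<iota> \<Sigma>' j"
  define x1' where "x1' = P1 / x k"
  have P1_sum: "P1 = \<phi> (coeff_plus \<Sigma> k, pos_part (exponents B k)) + \<phi> (coeff_minus \<Sigma> k, neg_part (exponents B k))"
    and P2_sum: "P2 = \<phi> (coeff_plus \<Sigma> j, pos_part (exponents B j)) + \<phi> (coeff_minus \<Sigma> j, neg_part (exponents B j))"
    and P2'_sum: "P2' = S'.\<phi> (coeff_plus \<Sigma>' j, pos_part (exponents B j)) + S'.\<phi> (coeff_minus \<Sigma>' j, neg_part (exponents B j))"
    using exchange_poly_monomials[of \<Sigma> k] exchange_poly_monomials[of \<Sigma> j] exchange_poly_monomials[of \<Sigma>' j]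
      x_nonzero S'.x_nonzero col
    by (auto simp: P1_def P2_def P2'_def x_def x'_def B_def B'_def)
  have nz: "P1 \<noteq> 0" "P2 \<noteq> 0"
    unfolding P1_sum P2_sum using monomial_sum_not_unit by blast+
  have P_R: "P1 \<in> R" "P2 \<in> R"
    unfolding P1_sum P2_sum R_def using entries
    by (auto intro!: subring_add[OF subring_laurent_off] \<phi>_L simp: vanishing_def pos_part_def neg_part_def exponents_def)
  have R_L: "R \<subseteq> L {k}" "R \<subseteq> L {j}"
    unfolding R_def by (rule laurent_off_least[OF subring_laurent_off]; auto intro: laurent_off_base)+
  interpret rank_two R "x k" "x j" P1 P2
    unfolding R_def using P_R R_L by (intro rank_two_L[OF \<open>k \<noteq> j\<close> _ _ nz]) auto
  \<comment> \<open>up to a coefficient, the exchange polynomial in direction \<open>j\<close> does not change\<close>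
  define c where "c = grp \<iota> (coeff_minus \<Sigma>' j) / grp \<iota> (coeff_minus \<Sigma> j)"
  have c: "c \<noteq> 0" "c = grp \<iota> (coeff_minus \<Sigma>' j - coeff_minus \<Sigma> j)"
    by (auto simp: c_def grp_nonzero grp_diff)
  have P2'_eq: "P2' = c * P2"
  proof -
    have agree: "S'.\<phi> g = \<phi> g" if "snd g k = 0" for g
      using that by (intro monomial_cong) (auto simp: x'_eq)
    have split: "\<phi> (p, e) = grp \<iota> p * \<phi> (0, e)" for p e by (simp add: monomial_def grp_zero)
    have "grp \<iota> (coeff_plus \<Sigma>' j) / grp \<iota> (coeff_minus \<Sigma>' j) = grp \<iota> (coeff_plus \<Sigma> j) / grp \<iota> (coeff_minus \<Sigma> j)"
      using seed_mutation_ratio(1)[OF mut, of j] \<open>k \<noteq> j\<close> zero by simp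
    then have "grp \<iota> (coeff_plus \<Sigma>' j) = c * grp \<iota> (coeff_plus \<Sigma> j)"
      by (simp add: c_def grp_nonzero field_simps)
    moreover have "grp \<iota> (coeff_minus \<Sigma>' j) = c * grp \<iota> (coeff_minus \<Sigma> j)"
      by (simp add: c_def grp_nonzero)
    moreover have "P2' = \<phi> (coeff_plus \<Sigma>' j, pos_part (exponents B j)) + \<phi> (coeff_minus \<Sigma>' j, neg_part (exponents B j))"
      unfolding P2'_sum using entries
      by (intro arg_cong2[of _ _ _ _ "(+)"] agree) (auto simp: pos_part_def neg_part_def exponents_def)
    ultimately show ?thesis
      unfolding P2_sum
      by (simp add: split[of "coeff_plus _ _"] split[of "coeff_minus _ _"] algebra_simps)
  qed
  have euclid: "\<exists>q'\<in>R. z = P2 ^ n * q'" if "z \<in> R" "q \<in> R" "P1 ^ m * z = P2 ^ n * q" for z q m n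
  proof (rule euclid_power[OF sR P_R nz(2) _ that])
    fix z q assume zq: "z \<in> R" "q \<in> R" "P1 * z = P2 * q"
    define u where "u i = (coeff_plus \<Sigma> i - coeff_minus \<Sigma> i, exponents B i)" for i
    define a where "a i = (coeff_minus \<Sigma> i, neg_part (exponents B i))" for i
    have "a i + u i = (coeff_plus \<Sigma> i, pos_part (exponents B i))" for i
      by (auto simp: a_def u_def prod_eq_iff fun_eq_iff pos_part_def neg_part_def)
    then have fac: "\<phi> (coeff_plus \<Sigma> i, pos_part (exponents B i)) + \<phi> (a i) = \<phi> (a i) * (1 + \<phi> (u i))" for i
      by (simp add: \<phi>_add[symmetric] distrib_left add.commute)
    have P: "P1 = \<phi> (a k) * (1 + \<phi> (u k))" "P2 = \<phi> (a j) * (1 + \<phi> (u j))"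
      unfolding fac[symmetric] by (simp_all add: P1_sum P2_sum a_def)
    have "u k \<in> vanishing {k, j}" "u j \<in> vanishing {k, j}" "a k \<in> vanishing {k, j}" "a j \<in> vanishing {k, j}"
      using entries by (auto simp: u_def a_def vanishing_def neg_part_def exponents_def)
    moreover have "\<nexists>w s t. odd s \<and> odd t \<and> u k = int_multiple s w \<and> u j = int_multiple t w"
      using coprime_no_common_odd_root[OF coprime x_def[symmetric] \<open>k \<noteq> j\<close>] by (simp add: u_def B_def)
    ultimately show "\<exists>q'\<in>R. z = P2 * q'"
      using zq binomial_euclid_L[OF tf, of "u k" "u j" "{k, j}" "a k" "a j" z q]
      unfolding P R_def by blast
  qed
  have mem: "y \<in> laurent_polynomials (range \<iota>) x" "\<And>i. y \<in> laurent_polynomials (range \<iota>) (adjacent_cluster \<iota> \<Sigma> i)"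
    using y by (auto simp: upper_bound_def x_def)
  have x1': "x1' \<noteq> 0" using nz x_nonzero by (simp add: x1'_def)
  have "y \<in> laurent_ext (laurent_ext R (x k)) (x j)"
    using mem(1) laurent_polynomials_two_variables[of x k j x] x_nonzero \<open>k \<noteq> j\<close> by (simp add: R_def)
  moreover have "y \<in> laurent_ext (laurent_ext R (x j)) (P1 / x k)"
    using mem(2)[of k] laurent_polynomials_two_variables[of "x(k := x1')" j k x] x_nonzero x1' \<open>k \<noteq> j\<close>
    by (simp add: R_def adjacent_cluster_def x1'_def P1_def x_def[symmetric] insert_commute)
  moreover have "y \<in> laurent_ext (laurent_ext R (x k)) (P2 / x j)"
    using mem(2)[of j] laurent_polynomials_two_variables[of "x(j := P2 / x j)" k j x] x_nonzero nz \<open>k \<noteq> j\<close>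
    by (simp add: R_def adjacent_cluster_def P2_def x_def[symmetric])
  ultimately have "y \<in> laurent_ext (laurent_ext R x1') (P2 / x j)"
    unfolding x1'_def using P_R by (intro upper_bound_disconnected euclid)
  also have "\<dots> \<subseteq> laurent_ext (laurent_ext R x1') (c * (P2 / x j))"
  proof (rule laurent_ext_unit_multiple[OF _ _ c(1)])
    have "R \<subseteq> laurent_ext R x1'" by (rule laurent_ext_base)
    moreover have "c \<in> R" "inverse c \<in> R"
      unfolding c(2) grp_minus[symmetric] R_def by (simp_all add: grp_def laurent_off_base)
    ultimately show "c \<in> laurent_ext R x1'" "inverse c \<in> laurent_ext R x1'" by auto
  qed
  also have "c * (P2 / x j) = P2' / x j" by (simp add: P2'_eq)
  finally have "y \<in> laurent_ext (laurent_ext R x1') (P2' / x j)" .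
  moreover have "adjacent_cluster \<iota> \<Sigma>' j = x(k := x1', j := P2' / x j)"
    using \<open>k \<noteq> j\<close> by (auto simp: adjacent_cluster_def P2'_def x'_def[symmetric] x'_eq x1'_def P1_def)
  ultimately show ?thesis
    using laurent_polynomials_two_variables[of "x(k := x1', j := P2' / x j)" k j x]
      x_nonzero x1' nz c(1) P2'_eq \<open>k \<noteq> j\<close>
    by (simp add: R_def)
qed

text \<open>
  The cluster of \<open>\<Sigma>'\<close> is adjacent to \<open>\<Sigma>\<close>, and the cluster adjacent to \<open>\<Sigma>'\<close> in direction \<open>k\<close> is that of \<open>\<Sigma>\<close>;
  only the clusters adjacent in the other directions require work.
\<close>

lemma upper_bound_mutation_subset:
  fixes \<Sigma> \<Sigma>' :: "('p::ab_group_add, 'f::field, 'n::finite) seed"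
  assumes emb: "ring_embedding \<iota>" and tf: "torsion_free TYPE('p)"
    and mut: "seed_mutation \<iota> k \<Sigma> \<Sigma>'" and coprime: "coprime_seed \<iota> \<Sigma>"
  shows "upper_bound \<iota> \<Sigma> \<subseteq> upper_bound \<iota> \<Sigma>'"
proof
  fix y assume y: "y \<in> upper_bound \<iota> \<Sigma>"
  have "y \<in> laurent_polynomials (range \<iota>) (cluster \<Sigma>')"
    using y mut by (auto simp: upper_bound_def seed_mutation_def)
  moreover have "y \<in> laurent_polynomials (range \<iota>) (adjacent_cluster \<iota> \<Sigma>' j)" for j
  proof -
    consider "k = j" | "k \<noteq> j" "exchange_matrix \<Sigma> $ k $ j < 0" | "k \<noteq> j" "exchange_matrix \<Sigma> $ k $ j = 0"
      | "k \<noteq> j" "exchange_matrix (opposite \<Sigma>) $ k $ j < 0"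
      by (cases "exchange_matrix \<Sigma> $ k $ j" "0 :: int" rule: linorder_cases) auto
    then show ?thesis
    proof cases
      case 1
      then show ?thesis
        using y adjacent_cluster_mutation[OF emb mut] by (auto simp: upper_bound_def)
    next
      case 2
      then show ?thesis using connected_step[OF emb mut] y by blast
    next
      case 3
      then show ?thesis using disconnected_step[OF emb tf mut coprime] y by blast
    next
      case 4
      then show ?thesis
        using connected_step[OF emb seed_mutation_opposite[OF mut]] y
        unfolding upper_bound_opposite adjacent_cluster_opposite by blast
    qed
  qed
  ultimately show "y \<in> upper_bound \<iota> \<Sigma>'" by (auto simp: upper_bound_def)
qed

lemma laurent_polynomials_relabel:
  fixes x :: "'n::finite \<Rightarrow> 'f::field" and \<pi> :: "'n \<Rightarrow> 'n"
  assumes \<pi>: "bij \<pi>"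
  shows "laurent_polynomials A (x \<circ> \<pi>) = laurent_polynomials A x"
proof -
  have sub: "laurent_polynomials A (x \<circ> \<pi>) \<subseteq> laurent_polynomials A x" if \<pi>: "bij \<pi>" for \<pi> :: "'n \<Rightarrow> 'n" and x :: "'n \<Rightarrow> 'f"
  proof
    fix y assume "y \<in> laurent_polynomials A (x \<circ> \<pi>)"
    then obtain E :: "('n \<Rightarrow> int) set" and c where E: "finite E" "c ` E \<subseteq> A"
      and y: "y = (\<Sum>e\<in>E. c e * (\<Prod>i\<in>UNIV. x (\<pi> i) powi e i))"
      by (auto simp: laurent_polynomials_def)
    let ?r = "\<lambda>e :: 'n \<Rightarrow> int. e \<circ> inv \<pi>"
    have r: "?r e \<circ> \<pi> = e" for e using \<pi> by (simp add: fun_eq_iff bij_is_inj)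
    have "inj ?r" by (metis (no_types, lifting) injI r)
    then have "(\<Sum>e\<in>?r ` E. c (e \<circ> \<pi>) * (\<Prod>i\<in>UNIV. x i powi e i)) = (\<Sum>e\<in>E. c (?r e \<circ> \<pi>) * (\<Prod>i\<in>UNIV. x i powi ?r e i))"
      by (subst sum.reindex) (auto intro: inj_on_subset)
    also have "\<dots> = y"
      unfolding y r
    proof (rule sum.cong[OF refl])
      fix e
      have "(\<Prod>i\<in>UNIV. x i powi ?r e i) = (\<Prod>i\<in>UNIV. x (\<pi> i) powi ?r e (\<pi> i))"
        using prod.reindex_bij_betw[OF \<pi>, of "\<lambda>i. x i powi ?r e i"] by simp
      then show "c e * (\<Prod>i\<in>UNIV. x i powi ?r e i) = c e * (\<Prod>i\<in>UNIV. x (\<pi> i) powi e i)"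
        using \<pi> by (simp add: bij_is_inj)
    qed
    finally have "y = (\<Sum>e\<in>?r ` E. c (e \<circ> \<pi>) * (\<Prod>i\<in>UNIV. x i powi e i))" ..
    moreover have "finite (?r ` E)" "(\<lambda>e. c (e \<circ> \<pi>)) ` ?r ` E \<subseteq> A"
      using E by (auto simp: r image_image)
    ultimately show "y \<in> laurent_polynomials A x"
      unfolding laurent_polynomials_def
      by (intro CollectI exI[of _ "?r ` E"] exI[of _ "\<lambda>e. c (e \<circ> \<pi>)"] conjI)
  qed
  have "x = (x \<circ> \<pi>) \<circ> inv \<pi>" using \<pi> by (simp add: fun_eq_iff bij_is_surj surj_f_inv_f)
  then show ?thesis using sub[OF \<pi>, of x] sub[OF bij_imp_bij_inv[OF \<pi>], of "x \<circ> \<pi>"] by auto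
qed

lemma exchange_poly_relabel:
  fixes \<Sigma> :: "('p::ab_group_add, 'f::field, 'n::finite) seed"
  assumes \<pi>: "bij \<pi>"
  shows "exchange_poly \<iota> (relabel \<pi> \<Sigma>) j = exchange_poly \<iota> \<Sigma> (\<pi> j)"
proof -
  have prod: "(\<Prod>i\<in>{i. Q (\<pi> i)}. h (\<pi> i)) = (\<Prod>i\<in>{i. Q i}. h i)" for Q :: "'n \<Rightarrow> bool" and h :: "'n \<Rightarrow> 'f"
  proof (rule prod.reindex_bij_betw)
    have "\<pi> ` {i. Q (\<pi> i)} = {i. Q i}"
      using surj_image_vimage_eq[OF bij_is_surj[OF \<pi>], of "{i. Q i}"] by (simp add: vimage_def)
    then show "bij_betw \<pi> {i. Q (\<pi> i)} {i. Q i}"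
      using bij_betw_subset[OF \<pi>] by blast
  qed
  show ?thesis
    using prod[where Q="\<lambda>i. exchange_matrix \<Sigma> $ i $ \<pi> j > 0"
        and h="\<lambda>i. cluster \<Sigma> i ^ nat (exchange_matrix \<Sigma> $ i $ \<pi> j)"]
      prod[where Q="\<lambda>i. exchange_matrix \<Sigma> $ i $ \<pi> j < 0"
        and h="\<lambda>i. cluster \<Sigma> i ^ nat (- exchange_matrix \<Sigma> $ i $ \<pi> j)"]
    by (simp add: exchange_poly_def relabel_def Let_def)
qed

lemma upper_bound_relabel:
  assumes \<pi>: "bij \<pi>"
  shows "upper_bound \<iota> (relabel \<pi> \<Sigma>) = upper_bound \<iota> \<Sigma>"
proof -
  have "adjacent_cluster \<iota> (relabel \<pi> \<Sigma>) j = adjacent_cluster \<iota> \<Sigma> (\<pi> j) \<circ> \<pi>" for j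
    using bij_is_inj[OF \<pi>]
    by (auto simp: fun_eq_iff adjacent_cluster_def exchange_poly_relabel[OF \<pi>] inj_eq) (simp_all add: relabel_def)
  then have "upper_bound \<iota> (relabel \<pi> \<Sigma>) = laurent_polynomials (range \<iota>) (cluster \<Sigma>)
      \<inter> (\<Inter>j. laurent_polynomials (range \<iota>) (adjacent_cluster \<iota> \<Sigma> (\<pi> j)))"
    unfolding upper_bound_def by (simp add: laurent_polynomials_relabel[OF \<pi>]) (simp add: relabel_def laurent_polynomials_relabel[OF \<pi>])
  also have "(\<Inter>j. laurent_polynomials (range \<iota>) (adjacent_cluster \<iota> \<Sigma> (\<pi> j)))
      = (\<Inter>j\<in>range \<pi>. laurent_polynomials (range \<iota>) (adjacent_cluster \<iota> \<Sigma> j))"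
    by simp
  also have "range \<pi> = UNIV" by (rule bij_is_surj[OF \<pi>])
  finally show ?thesis by (simp add: upper_bound_def)
qed

theorem corollary1p7:
  fixes \<iota> :: "('p::ab_group_add \<Rightarrow>\<^sub>0 int) \<Rightarrow> 'f::field"
    and \<Sigma>\<^sub>0 :: "('p, 'f, 'n::finite) seed"
  assumes "torsion_free TYPE('p)"
    and "ambient_field \<iota> TYPE('n)"
    and "is_seed \<iota> \<Sigma>\<^sub>0"
    and "totally_mutable \<Sigma>\<^sub>0"
    and "\<And>\<Sigma>. mutation_equiv \<iota> \<Sigma> \<Sigma>\<^sub>0 \<Longrightarrow> coprime_seed \<iota> \<Sigma>"
  shows "(\<forall>\<Sigma> \<Sigma>'. mutation_equiv \<iota> \<Sigma> \<Sigma>\<^sub>0 \<and> mutation_equiv \<iota> \<Sigma>' \<Sigma>\<^sub>0 \<longrightarrow>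
            upper_bound \<iota> \<Sigma> = upper_bound \<iota> \<Sigma>') \<and>
         (\<forall>\<Sigma>. mutation_equiv \<iota> \<Sigma> \<Sigma>\<^sub>0 \<longrightarrow>
            upper_bound \<iota> \<Sigma> = upper_cluster_algebra \<iota> \<Sigma>\<^sub>0)"
proof -
  have emb: "ring_embedding \<iota>" using assms(2) by (simp add: ambient_field_def)
  have mutation: "upper_bound \<iota> \<Sigma> = upper_bound \<iota> \<Sigma>'"
    if "seed_mutation \<iota> k \<Sigma> \<Sigma>'" "mutation_equiv \<iota> \<Sigma> \<Sigma>\<^sub>0" "mutation_equiv \<iota> \<Sigma>' \<Sigma>\<^sub>0" for k \<Sigma> \<Sigma>'
    using upper_bound_mutation_subset[OF emb assms(1) that(1) assms(5)[OF that(2)]]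
      upper_bound_mutation_subset[OF emb assms(1) seed_mutation_symmetric[OF emb that(1)] assms(5)[OF that(3)]]
    by blast
  have from_start: "upper_bound \<iota> \<Sigma> = upper_bound \<iota> \<Sigma>\<^sub>0" if "mutation_equiv \<iota> \<Sigma>\<^sub>0 \<Sigma>" for \<Sigma>
    using that unfolding mutation_equiv_def
  proof (induction rule: equivclp_induct)
    case (step \<Sigma> \<Sigma>')
    have \<Sigma>: "mutation_equiv \<iota> \<Sigma> \<Sigma>\<^sub>0" and \<Sigma>': "mutation_equiv \<iota> \<Sigma>' \<Sigma>\<^sub>0"
      unfolding mutation_equiv_def
      using step.hyps equivclp_into_equivclp[OF step.hyps] by (auto intro: equivclp_sym)
    have "upper_bound \<iota> \<Sigma> = upper_bound \<iota> \<Sigma>'"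
      using step.hyps(2)
      by (elim disjE exE conjE)
         (auto simp: upper_bound_relabel dest: mutation[OF _ \<Sigma> \<Sigma>'] mutation[OF _ \<Sigma>' \<Sigma>])
    then show ?case using step.IH by simp
  qed simp
  have eq: "upper_bound \<iota> \<Sigma> = upper_bound \<iota> \<Sigma>\<^sub>0" if "mutation_equiv \<iota> \<Sigma> \<Sigma>\<^sub>0" for \<Sigma>
    by (rule from_start) (use that in \<open>auto simp: mutation_equiv_def intro: equivclp_sym\<close>)
  have "upper_cluster_algebra \<iota> \<Sigma>\<^sub>0 = upper_bound \<iota> \<Sigma>\<^sub>0"
    unfolding upper_cluster_algebra_def
  proof (rule antisym)
    show "(\<Inter>\<Sigma> \<in> {\<Sigma>. mutation_equiv \<iota> \<Sigma> \<Sigma>\<^sub>0}. upper_bound \<iota> \<Sigma>) \<subseteq> upper_bound \<iota> \<Sigma>\<^sub>0"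
      by (rule INT_lower) (simp add: mutation_equiv_def)
    show "upper_bound \<iota> \<Sigma>\<^sub>0 \<subseteq> (\<Inter>\<Sigma> \<in> {\<Sigma>. mutation_equiv \<iota> \<Sigma> \<Sigma>\<^sub>0}. upper_bound \<iota> \<Sigma>)"
      by (rule INT_greatest) (metis eq mem_Collect_eq order_refl)
  qed
  then show ?thesis using eq by metis
qed

end
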